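(* Let $\Bbbk$ be a field and let $m,n$ be integers with $2 \le m < n$. Let $\Delta$ be the $(n-2)$-dimensional simplicial complex defined in the context (obtained from the Stanley-Reisner complex of $I=\mathrm{in}_<(I_2)$ by deleting its cone points), and let $$G := \{\sigma \in \Delta : H_{n-2}(\Delta,\mathrm{cost}_\Delta(\sigma);\Bbbk) \neq 0 \text{ and } H_{n-2}(\Delta,\mathrm{cost}_\Delta(\varepsilon);\Bbbk) = 0 \text{ for all } \varepsilon \subsetneq \sigma\}.$$ Then every $\sigma \in G$ satisfies $|\sigma| = n-m$. In particular, $\Delta$ is level over $\Bbbk$.
   Context: Notation: $[k]=\{1,\dots,k\}$. Let $X=(x_{i,j})_{i\in[m],\,j\in[n]}$ be an $m\times n$ matrix of variables, $S=\Bbbk[X]$ (standard grading), and $I_2\subseteq S$ the ideal generated by the $2$-minors of $X$. Let $<$ be the degree reverse lexicographic order on $S$ induced by the following order of the variables: $x_{i,j}>x_{k,l}$ if one of these holds: (i) $i\ne j$, $k\neq l$ and $i<k$; (ii) $i\neq j$, $k\neq l$, $i=k$ and $j<l$; (iii) $i\neq j$ and $k=l$; (iv) $i=j$, $k=l$ and $i<k$. (So the off-diagonal variables are listed in decreasing order row by row from left to right, followed by the main diagonal variables $x_{1,1}>\dots>x_{m,m}$.) Let $I=\mathrm{in}_<(I_2)$, a square-free monomial ideal. Let $\Delta_I$ be its Stanley-Reisner complex on $V_I=[m]\times[n]$, i.e. $\sigma\subseteq V_I$ is in $\Delta_I$ iff $\prod_{(i,j)\in\sigma}x_{i,j}\notin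 I$. The cone points of $\Delta_I$ are exactly $(k,k)$, $k\in[m]$. Put $V=V_I\setminus\{(k,k):k\in[m]\}$ and $\Delta=\{\sigma\in\Delta_I:\sigma\subseteq V\}$, a pure simplicial complex of dimension $n-2$. For a simplicial complex $\Gamma$ and $\sigma\in\Gamma$, $\mathrm{cost}_\Gamma(\sigma)=\{\tau\in\Gamma:\sigma\not\subseteq\tau\}$ (contrastar), and $H_i(\Gamma,\Gamma';\Bbbk)$ denotes relative simplicial homology of a pair $\Gamma'\subseteq\Gamma$ with coefficients in $\Bbbk$. A Noetherian $\mathbb{N}$-graded $\Bbbk$-algebra $R$ is level if it is Cohen-Macaulay and the socle of one (equivalently every) homogeneous Artinian reduction of $R$ is concentrated in a single degree; equivalently, $R$ is Cohen-Macaulay and its graded canonical module is minimally generated in a single degree. A simplicial complex is level over $\Bbbk$ if its Stanley-Reisner ring over $\Bbbk$ is level. *)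

theory Defs
  imports
    "HOL-Algebra.QuotRing"
    "HOL-Algebra.Elementary_Groups"
    "HOL-Library.Poly_Mapping"
    "HOL-Library.Extended_Nat"
begin

section \<open>Polynomial rings\<close>

text \<open>A monomial is its exponent vector, a polynomial is a finitely supported function from
  monomials to coefficients. \<open>poly_ring K V\<close> is the polynomial ring over the field
  \<open>'k\<close> whose variables are indexed by the set \<open>V\<close>; the argument \<open>K\<close> only carries the type of
  coefficients.\<close>

type_synonym 'v mon = "'v \<Rightarrow>\<^sub>0 nat"
type_synonym ('v, 'k) mpoly = "'v mon \<Rightarrow>\<^sub>0 'k"

definition poly_ring :: "'k::field itself \<Rightarrow> 'v set \<Rightarrow> ('v, 'k) mpoly ring" where
  "poly_ring K V =
    \<lparr>carrier = {p. \<forall>u\<in>Poly_Mapping.keys p. Poly_Mapping.keys u \<subseteq> V},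
     mult = (*), one = 1, zero = 0, add = (+)\<rparr>"

definition mono_poly :: "'v mon \<Rightarrow> ('v, 'k::field) mpoly" where
  "mono_poly u = Poly_Mapping.single u 1"

definition var :: "'v \<Rightarrow> ('v, 'k::field) mpoly" where
  "var x = mono_poly (Poly_Mapping.single x 1)"

definition mon_deg :: "'v mon \<Rightarrow> nat" where
  "mon_deg u = (\<Sum>x\<in>Poly_Mapping.keys u. Poly_Mapping.lookup u x)"

definition poly_grading :: "'k::field itself \<Rightarrow> 'v set \<Rightarrow> nat \<Rightarrow> ('v, 'k) mpoly set" where
  "poly_grading K V d =
    {p \<in> carrier (poly_ring K V). \<forall>u\<in>Poly_Mapping.keys p. mon_deg u = d}"

section \<open>Monomial orders and initial ideals\<close>

text \<open>The degree reverse lexicographic order induced by the order \<open>gt\<close> of the variables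
  (\<open>gt x y\<close> means \<open>x > y\<close>): among monomials of equal degree, \<open>u < w\<close> iff at the smallest
  variable \<open>x\<close> where they differ \<open>u\<close> has the larger exponent.\<close>

definition degrevlex_less :: "('v \<Rightarrow> 'v \<Rightarrow> bool) \<Rightarrow> 'v mon \<Rightarrow> 'v mon \<Rightarrow> bool" where
  "degrevlex_less gt u w \<longleftrightarrow>
    mon_deg u < mon_deg w \<or>
    (mon_deg u = mon_deg w \<and>
     (\<exists>x. Poly_Mapping.lookup u x > Poly_Mapping.lookup w x \<and>
          (\<forall>y. gt x y \<longrightarrow> Poly_Mapping.lookup u y = Poly_Mapping.lookup w y)))"

definition is_initial_mon ::
    "('v mon \<Rightarrow> 'v mon \<Rightarrow> bool) \<Rightarrow> ('v, 'k::field) mpoly \<Rightarrow> 'v mon \<Rightarrow> bool" where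
  "is_initial_mon lt f u \<longleftrightarrow>
    u \<in> Poly_Mapping.keys f \<and> (\<forall>w\<in>Poly_Mapping.keys f. w \<noteq> u \<longrightarrow> lt w u)"

definition initial_ideal ::
    "'k::field itself \<Rightarrow> 'v set \<Rightarrow> ('v mon \<Rightarrow> 'v mon \<Rightarrow> bool) \<Rightarrow> ('v, 'k) mpoly set
      \<Rightarrow> ('v, 'k) mpoly set" where
  "initial_ideal K V lt J =
    Idl\<^bsub>poly_ring K V\<^esub> {mono_poly u |u. \<exists>f\<in>J. is_initial_mon lt f u}"

section \<open>Simplicial complexes and Stanley-Reisner rings\<close>

definition complex_of_ideal ::
    "'k::field itself \<Rightarrow> 'v set \<Rightarrow> ('v, 'k) mpoly set \<Rightarrow> 'v set set" where
  "complex_of_ideal K V I = {\<sigma>. \<sigma> \<subseteq> V \<and> (\<Prod>x\<in>\<sigma>. var x) \<notin> I}"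

definition contrastar :: "'v set set \<Rightarrow> 'v set \<Rightarrow> 'v set set" where
  "contrastar \<Gamma> \<sigma> = {\<tau> \<in> \<Gamma>. \<not> \<sigma> \<subseteq> \<tau>}"

definition sr_ideal :: "'k::field itself \<Rightarrow> 'v set \<Rightarrow> 'v set set \<Rightarrow> ('v, 'k) mpoly set" where
  "sr_ideal K V \<Gamma> = Idl\<^bsub>poly_ring K V\<^esub> {(\<Prod>x\<in>\<sigma>. var x) |\<sigma>. \<sigma> \<subseteq> V \<and> \<sigma> \<notin> \<Gamma>}"

definition sr_ring ::
    "'k::field itself \<Rightarrow> 'v set \<Rightarrow> 'v set set \<Rightarrow> ('v, 'k) mpoly set ring" where
  "sr_ring K V \<Gamma> = poly_ring K V Quot sr_ideal K V \<Gamma>"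

section \<open>Relative simplicial homology\<close>

text \<open>Chains are indexed by the number of vertices, so that \<open>simplicial_chains K \<Gamma> (Suc i)\<close> is
  the space of \<open>i\<close>-chains and the empty face spans \<open>simplicial_chains K \<Gamma> 0\<close>. Hence in degree
  0 (only) the homology below is reduced homology when the subcomplex is void. Faces are oriented
  by listing their vertices decreasingly with respect to a strict linear order \<open>gt\<close>; up to
  isomorphism the homology does not depend on the choice of \<open>gt\<close>.\<close>

definition simplicial_chains ::
    "'k::field itself \<Rightarrow> 'v set set \<Rightarrow> nat \<Rightarrow> ('v set \<Rightarrow>\<^sub>0 'k) set" where
  "simplicial_chains K \<Gamma> d =
    {c. \<forall>\<tau>\<in>Poly_Mapping.keys c. \<tau> \<in> \<Gamma> \<and> finite \<tau> \<and> card \<tau> = d}"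

definition simplicial_boundary ::
    "('v \<Rightarrow> 'v \<Rightarrow> bool) \<Rightarrow> ('v set \<Rightarrow>\<^sub>0 'k::field) \<Rightarrow> ('v set \<Rightarrow>\<^sub>0 'k)" where
  "simplicial_boundary gt c =
    (\<Sum>\<tau>\<in>Poly_Mapping.keys c. \<Sum>x\<in>\<tau>.
      Poly_Mapping.single (\<tau> - {x})
        ((-1) ^ card {y \<in> \<tau>. gt y x} * Poly_Mapping.lookup c \<tau>))"

definition simplicial_relcycles ::
    "'k::field itself \<Rightarrow> ('v \<Rightarrow> 'v \<Rightarrow> bool) \<Rightarrow> nat \<Rightarrow> 'v set set \<Rightarrow> 'v set set
      \<Rightarrow> ('v set \<Rightarrow>\<^sub>0 'k) set" where
  "simplicial_relcycles K gt i \<Gamma> \<Gamma>' =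
    {c \<in> simplicial_chains K \<Gamma> (Suc i). simplicial_boundary gt c \<in> simplicial_chains K \<Gamma>' i}"

definition simplicial_relboundaries ::
    "'k::field itself \<Rightarrow> ('v \<Rightarrow> 'v \<Rightarrow> bool) \<Rightarrow> nat \<Rightarrow> 'v set set \<Rightarrow> 'v set set
      \<Rightarrow> ('v set \<Rightarrow>\<^sub>0 'k) set" where
  "simplicial_relboundaries K gt i \<Gamma> \<Gamma>' =
    {c \<in> simplicial_chains K \<Gamma> (Suc i).
      \<exists>b\<in>simplicial_chains K \<Gamma> (Suc (Suc i)).
        c - simplicial_boundary gt b \<in> simplicial_chains K \<Gamma>' (Suc i)}"

definition relative_simplicial_homology ::
    "'k::field itself \<Rightarrow> ('v \<Rightarrow> 'v \<Rightarrow> bool) \<Rightarrow> nat \<Rightarrow> 'v set set \<Rightarrow> 'v set set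
      \<Rightarrow> ('v set \<Rightarrow>\<^sub>0 'k) set monoid" where
  "relative_simplicial_homology K gt i \<Gamma> \<Gamma>' =
    \<lparr>carrier = simplicial_relcycles K gt i \<Gamma> \<Gamma>', monoid.mult = (+), one = 0\<rparr>
      Mod simplicial_relboundaries K gt i \<Gamma> \<Gamma>'"

section \<open>Level graded algebras\<close>

text \<open>Throughout, \<open>R\<close> is a Noetherian commutative ring and \<open>A d\<close> is the component of degree \<open>d\<close>
  of a grading of \<open>R\<close> by the natural numbers, with \<open>A 0\<close> the base field; the irrelevant ideal is
  then the unique homogeneous maximal ideal.\<close>

definition irrelevant_ideal :: "'a ring \<Rightarrow> (nat \<Rightarrow> 'a set) \<Rightarrow> 'a set" where
  "irrelevant_ideal R A = Idl\<^bsub>R\<^esub> (\<Union>d\<in>{1..}. A d)"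

definition quot_grading :: "'a ring \<Rightarrow> (nat \<Rightarrow> 'a set) \<Rightarrow> 'a set \<Rightarrow> nat \<Rightarrow> 'a set set" where
  "quot_grading R A J d = (\<lambda>f. J +>\<^bsub>R\<^esub> f) ` A d"

definition krull_dim :: "'a ring \<Rightarrow> enat" where
  "krull_dim R =
    Sup {enat l |l. \<exists>P :: nat \<Rightarrow> 'a set.
      (\<forall>i\<le>l. primeideal (P i) R) \<and> (\<forall>i<l. P i \<subset> P (Suc i))}"

definition regular_sequence :: "'a ring \<Rightarrow> 'a list \<Rightarrow> bool" where
  "regular_sequence R xs \<longleftrightarrow>
    set xs \<subseteq> carrier R \<and>
    (\<forall>i<length xs. \<forall>r\<in>carrier R.
      xs ! i \<otimes>\<^bsub>R\<^esub> r \<in> Idl\<^bsub>R\<^esub> set (take i xs) \<longrightarrow> r \<in> Idl\<^bsub>R\<^esub> set (take i xs)) \<and>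
    Idl\<^bsub>R\<^esub> set xs \<noteq> carrier R"

definition graded_depth :: "'a ring \<Rightarrow> (nat \<Rightarrow> 'a set) \<Rightarrow> enat" where
  "graded_depth R A =
    Sup {enat (length xs) |xs. regular_sequence R xs \<and> set xs \<subseteq> irrelevant_ideal R A}"

definition cohen_macaulay :: "'a ring \<Rightarrow> (nat \<Rightarrow> 'a set) \<Rightarrow> bool" where
  "cohen_macaulay R A \<longleftrightarrow> graded_depth R A = krull_dim R"

definition artinian :: "'a ring \<Rightarrow> bool" where
  "artinian R \<longleftrightarrow>
    (\<forall>J :: nat \<Rightarrow> 'a set. (\<forall>i. ideal (J i) R \<and> J (Suc i) \<subseteq> J i) \<longrightarrow> (\<exists>N. \<forall>i\<ge>N. J i = J N))"

definition homogeneous_sop :: "'a ring \<Rightarrow> (nat \<Rightarrow> 'a set) \<Rightarrow> 'a list \<Rightarrow> bool" where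
  "homogeneous_sop R A xs \<longleftrightarrow>
    (\<forall>x\<in>set xs. \<exists>d>0. x \<in> A d) \<and>
    enat (length xs) = krull_dim R \<and>
    artinian (R Quot (Idl\<^bsub>R\<^esub> set xs))"

definition socle :: "'a ring \<Rightarrow> (nat \<Rightarrow> 'a set) \<Rightarrow> 'a set" where
  "socle R A = {s \<in> carrier R. \<forall>a\<in>irrelevant_ideal R A. a \<otimes>\<^bsub>R\<^esub> s = \<zero>\<^bsub>R\<^esub>}"

text \<open>Homogeneous Artinian reductions exist over every field, since the parameters are not
  required to be linear; the socle condition does not depend on the chosen reduction.\<close>

definition level_algebra :: "'a ring \<Rightarrow> (nat \<Rightarrow> 'a set) \<Rightarrow> bool" where
  "level_algebra R A \<longleftrightarrow>
    cohen_macaulay R A \<and>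
    (\<exists>xs. homogeneous_sop R A xs \<and>
      (let J = Idl\<^bsub>R\<^esub> set xs
       in \<exists>d. socle (R Quot J) (quot_grading R A J) \<subseteq> quot_grading R A J d))"

definition level_complex :: "'k::field itself \<Rightarrow> 'v set \<Rightarrow> 'v set set \<Rightarrow> bool" where
  "level_complex K V \<Gamma> \<longleftrightarrow>
    level_algebra (sr_ring K V \<Gamma>)
      (quot_grading (poly_ring K V) (poly_grading K V) (sr_ideal K V \<Gamma>))"

section \<open>The complex attached to the 2-minors\<close>

fun var_gt :: "nat \<times> nat \<Rightarrow> nat \<times> nat \<Rightarrow> bool" where
  "var_gt (i, j) (k, l) \<longleftrightarrow>
    (i \<noteq> j \<and> k \<noteq> l \<and> i < k) \<or>
    (i \<noteq> j \<and> k \<noteq> l \<and> i = k \<and> j < l) \<or>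
    (i \<noteq> j \<and> k = l) \<or>
    (i = j \<and> k = l \<and> i < k)"

definition grid :: "nat \<Rightarrow> nat \<Rightarrow> (nat \<times> nat) set" where
  "grid m n = {1..m} \<times> {1..n}"

definition minors_ideal ::
    "'k::field itself \<Rightarrow> nat \<Rightarrow> nat \<Rightarrow> (nat \<times> nat, 'k) mpoly set" where
  "minors_ideal K m n =
    Idl\<^bsub>poly_ring K (grid m n)\<^esub>
      {var (i, j) * var (k, l) - var (i, l) * var (k, j) |i j k l.
        i \<in> {1..m} \<and> k \<in> {1..m} \<and> j \<in> {1..n} \<and> l \<in> {1..n} \<and> i < k \<and> j < l}"

definition initial_minors_ideal ::
    "'k::field itself \<Rightarrow> nat \<Rightarrow> nat \<Rightarrow> (nat \<times> nat, 'k) mpoly set" where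
  "initial_minors_ideal K m n =
    initial_ideal K (grid m n) (degrevlex_less var_gt) (minors_ideal K m n)"

definition offdiag :: "nat \<Rightarrow> nat \<Rightarrow> (nat \<times> nat) set" where
  "offdiag m n = grid m n - {(k, k) |k. k \<in> {1..m}}"

definition Delta :: "'k::field itself \<Rightarrow> nat \<Rightarrow> nat \<Rightarrow> (nat \<times> nat) set set" where
  "Delta K m n =
    {\<sigma> \<in> complex_of_ideal K (grid m n) (initial_minors_ideal K m n). \<sigma> \<subseteq> offdiag m n}"

abbreviation H_contrastar ::
    "'k::field itself \<Rightarrow> nat \<Rightarrow> nat \<Rightarrow> (nat \<times> nat) set \<Rightarrow> ((nat \<times> nat) set \<Rightarrow>\<^sub>0 'k) set monoid" where
  "H_contrastar K m n \<sigma> \<equiv>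
    relative_simplicial_homology K var_gt (n - 2) (Delta K m n) (contrastar (Delta K m n) \<sigma>)"

definition G_set :: "'k::field itself \<Rightarrow> nat \<Rightarrow> nat \<Rightarrow> (nat \<times> nat) set set" where
  "G_set K m n =
    {\<sigma> \<in> Delta K m n.
      \<not> trivial_group (H_contrastar K m n \<sigma>) \<and>
      (\<forall>\<epsilon>. \<epsilon> \<subset> \<sigma> \<longrightarrow> trivial_group (H_contrastar K m n \<epsilon>))}"

end

theory Submission
  imports Defs "HOL-Library.FuncSet" "Jordan_Normal_Form.Determinant"
begin

text \<open>Away from the diagonal, the standard monomials of \<open>I\<^sub>2\<close> are the outcomes of the northwest
  corner rule, so \<open>\<Delta>\<close> consists of staircases: sets of cells increasing weakly from row to row and having no index both as a row
  and as a column. Sending the cell \<open>(i, j)\<close> to the vector \<open>e\<^sub>j - e\<^sub>i\<close> turns the staircases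
  into the cones of a unimodular triangulation of the cone of all vectors with coordinate sum 0 and
  nonnegative coordinates beyond \<open>m\<close>. Hence \<open>\<Delta>\<close> is a ball, and its interior faces are those
  meeting every column beyond \<open>m\<close>.

  The position of a facet relative to the point \<open>(1 - n, 1, \<dots>, 1)\<close> gives a shelling with the row
  heads of a facet as restriction set, and the column heads restrict the reversed shelling, where a
  row (column) head is the first cell of a row (column) other than 1. The top relative homology of a
  face vanishes iff the face is not interior: the determinants of the facets form a fundamental cycle,
  and a relative cycle over a boundary face is killed facet by facet along the shelling. The minimal
  interior faces have exactly one cell in each of the last \<open>n - m\<close> columns.

  For levelness, the coordinates of the above vectors give linear forms \<open>\<theta>\<close> that restrict to a
  system of coordinates on every facet. Along the shelling, \<open>\<theta>\<close> is regular and the monomials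
  of the sets of row heads span the Artinian reduction. Along the reversed shelling, \<open>\<theta>\<close> is regular
  on the ideal \<open>J\<close> of the interior faces, so that the facet monomials, which are congruent to each
  other modulo \<open>\<theta> J\<close>, do not vanish there. As a result, the monomials of row heads and of column
  heads pair triangularly into \<open>J / \<theta> J\<close>. Since \<open>J\<close> is generated in degree \<open>n - m\<close>, an element of
  the socle only involves monomials of row heads of the maximal degree \<open>m - 1\<close>.\<close>

section \<open>Staircases\<close>

text \<open>Rows up to n are allowed although \<Delta> only has rows up to m: the larger complex is
  invariant under transposing cells, so all that concerns column heads and the reversed shelling is
  obtained from row heads by \<open>prod.swap\<close>. Completing a face to a facet adds no row
  except 1, and dually no row that is a column of the face, so the bound m can be imposed
  afterwards. The heads come from a tree: a facet is a spanning tree on the indices with root 1,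
  each cell being an edge directed from its row to its column. The point (1 - n, 1, ..., 1) is the
  sum of the paths from the root to the other vertices. A path enters a row against the direction of
  the edge and a column along it, so the row heads are the cells in which the point has a negative
  coordinate. The walls opposite to them are those that separate the facet from the point, which
  makes the row heads the restriction set. All geometry is condensed into integer relations between
  cells whose decisive coefficients are 1 or -1, so the linear forms and the orientation work over
  fields of every size and characteristic.\<close>

definition staircases :: "nat \<Rightarrow> (nat \<times> nat) set set" where
  "staircases n = {\<tau>. \<tau> \<subseteq> {1..n} \<times> {1..n} \<and>
     (\<forall>(i, j)\<in>\<tau>. \<forall>(k, l)\<in>\<tau>. i < k \<longrightarrow> j \<le> l) \<and> fst ` \<tau> \<inter> snd ` \<tau> = {}}"

definition row_heads :: "(nat \<times> nat) set \<Rightarrow> (nat \<times> nat) set" where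
  "row_heads \<tau> = {(i, j) \<in> \<tau>. i \<noteq> 1 \<and> (\<forall>j'<j. (i, j') \<notin> \<tau>)}"

definition col_heads :: "(nat \<times> nat) set \<Rightarrow> (nat \<times> nat) set" where
  "col_heads \<tau> = {(i, j) \<in> \<tau>. j \<noteq> 1 \<and> (\<forall>i'<i. (i', j) \<notin> \<tau>)}"

definition facets :: "nat \<Rightarrow> (nat \<times> nat) set set" where
  "facets n = {F \<in> staircases n. card F = n - 1}"

text \<open>Heads leave out the root 1, so it has to be decoded from them whether 1 is a row or a
  column: a cell in column 1 is the head of its row, since nothing lies to its left. If 1 is
  neither, it is made a row.\<close>

definition head_rows :: "(nat \<times> nat) set \<Rightarrow> nat set" where
  "head_rows \<rho> = fst ` \<rho> \<union> (if 1 \<in> snd ` \<rho> then {} else {1})"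

text \<open>Every row runs from its own head to the head of the next row, skipping the indices that
  are rows; row 1 has no head and starts at the left margin.\<close>

definition completion :: "nat \<Rightarrow> (nat \<times> nat) set \<Rightarrow> (nat \<times> nat) set" where
  "completion n \<rho> = {(i, j). i \<in> head_rows \<rho> \<and> j \<in> {1..n} - head_rows \<rho> \<and>
     (\<forall>(k, l)\<in>\<rho>. (k \<le> i \<longrightarrow> l \<le> j) \<and> (i < k \<longrightarrow> j \<le> l))}"

text \<open>The offset n + 1 keeps each summand positive, as columns are at most n. So an additional
  row raises the weight just as a head further to the left does.\<close>

definition shell_weight :: "nat \<Rightarrow> (nat \<times> nat) set \<Rightarrow> nat" where
  "shell_weight n F = (\<Sum>i\<in>fst ` F - {1}. n + 1 - (LEAST j. (i, j) \<in> F))"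

section \<open>Elementary properties of staircases and heads\<close>

lemma staircases_mono: "\<tau> \<in> staircases n \<Longrightarrow> \<sigma> \<subseteq> \<tau> \<Longrightarrow> \<sigma> \<in> staircases n"
  unfolding staircases_def by blast

lemma staircases_finite: "\<tau> \<in> staircases n \<Longrightarrow> finite \<tau>"
  unfolding staircases_def using finite_subset[of \<tau> "{1..n} \<times> {1..n}"] by blast

lemma staircases_le: "\<tau> \<in> staircases n \<Longrightarrow> (i, j) \<in> \<tau> \<Longrightarrow> (k, l) \<in> \<tau> \<Longrightarrow> i < k \<Longrightarrow> j \<le> l"
  unfolding staircases_def by blast

lemma staircases_neq: "\<tau> \<in> staircases n \<Longrightarrow> (i, j) \<in> \<tau> \<Longrightarrow> (k, l) \<in> \<tau> \<Longrightarrow> i \<noteq> l"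
  unfolding staircases_def disjoint_iff by (metis (mono_tags, lifting) fst_conv snd_conv image_eqI mem_Collect_eq)

lemma staircases_range:
  "\<tau> \<in> staircases n \<Longrightarrow> (i, j) \<in> \<tau> \<Longrightarrow> 1 \<le> i \<and> i \<le> n \<and> 1 \<le> j \<and> j \<le> n"
  unfolding staircases_def by auto

lemma completion_le:
  assumes "(i, j) \<in> completion n \<rho>" "(k, l) \<in> \<rho>"
  shows "k \<le> i \<Longrightarrow> l \<le> j" and "i < k \<Longrightarrow> j \<le> l"
  using assms unfolding completion_def by blast+

lemma staircases_swap: "prod.swap ` \<tau> \<in> staircases n \<longleftrightarrow> \<tau> \<in> staircases n"
proof -
  have *: "prod.swap ` \<tau> \<in> staircases n" if "\<tau> \<in> staircases n" for \<tau>
  proof -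
    have "l \<le> j" if "(j, i) \<in> \<tau>" "(l, k) \<in> \<tau>" "k < i" for i j k l
    proof (rule ccontr)
      assume "\<not> l \<le> j"
      then have "i \<le> k" using staircases_le[OF \<open>\<tau> \<in> _\<close> that(1,2)] by simp
      then show False using that by simp
    qed
    moreover have "fst ` prod.swap ` \<tau> = snd ` \<tau>" "snd ` prod.swap ` \<tau> = fst ` \<tau>"
      by (simp_all add: image_image)
    moreover have "fst ` \<tau> \<inter> snd ` \<tau> = {}" "\<tau> \<subseteq> {1..n} \<times> {1..n}"
      using that unfolding staircases_def by blast+
    ultimately show ?thesis unfolding staircases_def by (auto simp: disjoint_iff)
  qed
  have "prod.swap ` prod.swap ` \<tau> = \<tau>" by (simp add: image_image)
  then show ?thesis using *[of \<tau>] *[of "prod.swap ` \<tau>"] by auto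
qed

lemma heads_swap: "col_heads (prod.swap ` \<tau>) = prod.swap ` row_heads \<tau>"
  "row_heads (prod.swap ` \<tau>) = prod.swap ` col_heads \<tau>"
  unfolding col_heads_def row_heads_def by (auto simp: pair_in_swap_image)

lemma heads_subset: "row_heads \<tau> \<subseteq> \<tau>" "col_heads \<tau> \<subseteq> \<tau>"
  unfolding row_heads_def col_heads_def by auto

lemma row_head_exists:
  assumes "(i, j) \<in> \<tau>" "i \<noteq> 1"
  obtains j' where "(i, j') \<in> row_heads \<tau>" "j' \<le> j" "j' = (LEAST j. (i, j) \<in> \<tau>)"
proof -
  define j' where "j' = (LEAST j. (i, j) \<in> \<tau>)"
  have "(i, j') \<in> \<tau>" unfolding j'_def using assms(1) by (rule LeastI)
  moreover have "j' \<le> j" unfolding j'_def using assms(1) by (rule Least_le)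
  moreover have "(i, j'') \<notin> \<tau>" if "j'' < j'" for j''
    using not_less_Least that unfolding j'_def by blast
  ultimately have "(i, j') \<in> row_heads \<tau>" using assms(2) unfolding row_heads_def by blast
  then show ?thesis using \<open>j' \<le> j\<close> j'_def by (rule that)
qed

lemma row_heads_Least: "(i, j) \<in> row_heads \<tau> \<Longrightarrow> j = (LEAST j. (i, j) \<in> \<tau>)"
  unfolding row_heads_def by (auto intro!: Least_equality[symmetric] simp: not_less[symmetric])

lemma row_heads_eq: "row_heads \<tau> = (\<lambda>i. (i, LEAST j. (i, j) \<in> \<tau>)) ` (fst ` \<tau> - {1})"
proof (intro equalityI subrelI)
  fix i j assume "(i, j) \<in> row_heads \<tau>"
  then have "j = (LEAST j. (i, j) \<in> \<tau>)" "(i, j) \<in> \<tau>" "i \<noteq> 1"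
    using row_heads_Least unfolding row_heads_def by blast+
  then show "(i, j) \<in> (\<lambda>i. (i, LEAST j. (i, j) \<in> \<tau>)) ` (fst ` \<tau> - {1})"
    by (intro image_eqI[of _ _ i] DiffI image_eqI[of i fst "(i, j)"]) simp_all
next
  fix i j assume "(i, j) \<in> (\<lambda>i. (i, LEAST j. (i, j) \<in> \<tau>)) ` (fst ` \<tau> - {1})"
  then have i: "i \<in> fst ` \<tau>" "i \<noteq> 1" "j = (LEAST j. (i, j) \<in> \<tau>)" by blast+
  then obtain j' where "(i, j') \<in> \<tau>" by auto
  note j' = this i(2,3)
  show "(i, j) \<in> row_heads \<tau>" using row_head_exists[OF j'(1,2)] j'(3) by metis
qed

lemma fst_row_heads: "fst ` row_heads \<tau> = fst ` \<tau> - {1}"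
  unfolding row_heads_eq by (auto simp: image_image)

lemma card_row_heads: "card (row_heads \<tau>) = card (fst ` \<tau> - {1})"
  unfolding row_heads_eq by (intro card_image inj_onI) auto

lemma snd_col_heads: "snd ` col_heads \<tau> = snd ` \<tau> - {1}"
proof -
  have "fst ` prod.swap ` col_heads \<tau> = fst ` prod.swap ` \<tau> - {1}"
    using fst_row_heads[of "prod.swap ` \<tau>"] by (simp add: heads_swap)
  then show ?thesis by (simp add: image_image)
qed

lemma card_col_heads: "card (col_heads \<tau>) = card (snd ` \<tau> - {1})"
proof -
  have "card (prod.swap ` col_heads \<tau>) = card (fst ` prod.swap ` \<tau> - {1})"
    using card_row_heads[of "prod.swap ` \<tau>"] by (simp add: heads_swap)
  then show ?thesis by (simp add: image_image card_image)
qed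

text \<open>A cell in column 1 is the first of its row, and this row is not 1 because no index is
  both a row and a column.\<close>

lemma one_in_snd_row_heads:
  assumes "\<tau> \<in> staircases n" shows "1 \<in> snd ` row_heads \<tau> \<longleftrightarrow> 1 \<in> snd ` \<tau>"
proof
  show "1 \<in> snd ` \<tau>" if "1 \<in> snd ` row_heads \<tau>" using that heads_subset(1)[of \<tau>] by auto
next
  assume "1 \<in> snd ` \<tau>"
  then obtain i where i: "(i, 1) \<in> \<tau>" by auto
  have "(i, 1) \<in> row_heads \<tau>"
    using i staircases_neq[OF assms i i] staircases_range[OF assms] unfolding row_heads_def by force
  then show "1 \<in> snd ` row_heads \<tau>" by force
qed

section \<open>The facet determined by the row heads of a staircase\<close>

context
  fixes n :: nat and \<tau> :: "(nat \<times> nat) set"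
  assumes n: "1 \<le> n" and \<tau>: "\<tau> \<in> staircases n"
begin

lemma head_rows_eq: "head_rows (row_heads \<tau>) = (fst ` \<tau> - {1}) \<union> (if 1 \<in> snd ` \<tau> then {} else {1})"
  unfolding head_rows_def fst_row_heads one_in_snd_row_heads[OF \<tau>] ..

lemma head_rows_subset: "head_rows (row_heads \<tau>) \<subseteq> {1..n}"
  unfolding head_rows_eq using staircases_range[OF \<tau>] n by (auto split: if_splits)

lemma subset_completion: "\<tau> \<subseteq> completion n (row_heads \<tau>)"
proof (intro subrelI)
  fix i j assume ij: "(i, j) \<in> \<tau>"
  have *: "i \<in> fst ` \<tau>" "j \<in> snd ` \<tau>" using ij by force+
  have d: "fst ` \<tau> \<inter> snd ` \<tau> = {}" using \<tau> unfolding staircases_def by blast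
  have "i \<notin> snd ` \<tau>" "j \<notin> fst ` \<tau>" using * d by blast+
  then have "i \<in> head_rows (row_heads \<tau>)" unfolding head_rows_eq using * by (cases "i = 1"; simp)
  moreover have "j \<notin> head_rows (row_heads \<tau>)"
    using \<open>j \<notin> fst ` \<tau>\<close> * unfolding head_rows_eq by (cases "j = 1"; simp)
  moreover have "l \<le> j" if "(k, l) \<in> row_heads \<tau>" "k \<le> i" for k l
  proof (cases "k = i")
    case True
    then show ?thesis using that ij unfolding row_heads_def by (auto simp: not_le[symmetric])
  next
    case False
    then show ?thesis using that staircases_le[OF \<tau> _ ij, of k l] heads_subset(1) by auto
  qed
  moreover have "j \<le> l" if "(k, l) \<in> row_heads \<tau>" "i < k" for k l
    using staircases_le[OF \<tau> ij] that heads_subset(1) by blast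
  ultimately show "(i, j) \<in> completion n (row_heads \<tau>)"
    using staircases_range[OF \<tau> ij] unfolding completion_def by auto
qed

lemma completion_staircase: "completion n (row_heads \<tau>) \<in> staircases n"
proof -
  have "j \<le> l" if "(i, j) \<in> completion n (row_heads \<tau>)" "(k, l) \<in> completion n (row_heads \<tau>)" "i < k" for i j k l
  proof -
    have "k \<in> head_rows (row_heads \<tau>)" "i \<in> head_rows (row_heads \<tau>)" using that unfolding completion_def by auto
    then have "k \<in> fst ` \<tau>" "k \<noteq> 1" using head_rows_subset that(3) unfolding head_rows_eq
      by (auto split: if_splits)
    then have "k \<in> fst ` row_heads \<tau>" unfolding fst_row_heads by simp
    then obtain l' where "(k, l') \<in> row_heads \<tau>" by auto
    then have "j \<le> l'" "l' \<le> l" using that unfolding completion_def by auto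
    then show ?thesis by simp
  qed
  moreover have "fst ` completion n (row_heads \<tau>) \<inter> snd ` completion n (row_heads \<tau>) = {}" unfolding completion_def by auto
  moreover have "completion n (row_heads \<tau>) \<subseteq> {1..n} \<times> {1..n}" using head_rows_subset unfolding completion_def by auto
  ultimately show ?thesis unfolding staircases_def by blast
qed

lemma fst_completion: "fst ` completion n (row_heads \<tau>) \<subseteq> head_rows (row_heads \<tau>)" and snd_completion: "snd ` completion n (row_heads \<tau>) \<subseteq> {1..n} - head_rows (row_heads \<tau>)"
  unfolding completion_def by auto

text \<open>With \<open>subset_completion\<close>, this puts \<tau> into the interval between the
  row heads of a facet and the facet itself, which is the covering property of the shelling.\<close>

lemma row_heads_completion: "row_heads (completion n (row_heads \<tau>)) = row_heads \<tau>"
proof (intro equalityI subrelI)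
  fix i j assume a: "(i, j) \<in> row_heads (completion n (row_heads \<tau>))"
  then have ij: "(i, j) \<in> completion n (row_heads \<tau>)" "i \<noteq> 1" unfolding row_heads_def by auto
  then have "i \<in> fst ` row_heads \<tau>"
    unfolding fst_row_heads completion_def head_rows_eq by (auto split: if_splits)
  then obtain l where l: "(i, l) \<in> row_heads \<tau>" by auto
  then have "l \<le> j" using ij unfolding completion_def by auto
  moreover have "(i, l) \<in> completion n (row_heads \<tau>)" using l heads_subset(1) subset_completion by blast
  ultimately have "l = j" using a unfolding row_heads_def by (auto simp: le_less)
  then show "(i, j) \<in> row_heads \<tau>" using l by simp
next
  fix i j assume a: "(i, j) \<in> row_heads \<tau>"
  have "(i, j) \<in> completion n (row_heads \<tau>)" using a heads_subset(1) subset_completion by blast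
  moreover have "i \<noteq> 1" using a unfolding row_heads_def by auto
  moreover have "(i, j') \<notin> completion n (row_heads \<tau>)" if "j' < j" for j'
    using completion_le(1)[OF _ a] that by fastforce
  ultimately show "(i, j) \<in> row_heads (completion n (row_heads \<tau>))" unfolding row_heads_def by auto
qed

text \<open>The head of a row lies in the column in which the preceding row ends, so it does not
  open that column (column 1 is left out by \<open>col_heads\<close>). A later cell of the row does
  open its column, because all rows above end at or before the head.\<close>

lemma col_heads_completion: "col_heads (completion n (row_heads \<tau>)) = completion n (row_heads \<tau>) - row_heads (completion n (row_heads \<tau>))"
proof -
  have "(i, j) \<in> col_heads (completion n (row_heads \<tau>)) \<longleftrightarrow> (i, j) \<notin> row_heads (completion n (row_heads \<tau>))" if ij: "(i, j) \<in> completion n (row_heads \<tau>)" for i j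
  proof
    assume top: "(i, j) \<in> col_heads (completion n (row_heads \<tau>))"
    show "(i, j) \<notin> row_heads (completion n (row_heads \<tau>))"
    proof
      assume "(i, j) \<in> row_heads (completion n (row_heads \<tau>))"
      then have h: "(i, j) \<in> row_heads \<tau>" by (simp add: row_heads_completion)
      then have i1: "i \<noteq> 1" "(i, j) \<in> \<tau>" and j1: "j \<noteq> 1"
        using top unfolding row_heads_def col_heads_def by auto
      define P where "P = {k \<in> head_rows (row_heads \<tau>). k < i}"
      have fP: "finite P" unfolding P_def by simp
      \<comment> \<open>There is a row above \<open>i\<close>: if 1 is a column, its cell lies in an
        earlier row, as the head of row \<open>i\<close> is at \<open>j\<close> \<noteq> 1;
        otherwise 1 itself is a row. The last such row will contain column \<open>j\<close>.\<close>
      have "P \<noteq> {}"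
      proof (cases "1 \<in> snd ` \<tau>")
        case True
        then obtain k where k: "(k, 1) \<in> \<tau>" by auto
        have "\<not> i < k" using staircases_le[OF \<tau> i1(2) k] j1 staircases_range[OF \<tau> i1(2)] by auto
        moreover have "k \<noteq> i" using h k j1 staircases_range[OF \<tau> i1(2)]
          unfolding row_heads_def by (auto simp: le_less)
        moreover have "k \<in> head_rows (row_heads \<tau>)" using subset_completion k fst_completion by force
        ultimately show ?thesis unfolding P_def by force
      next
        case False
        then have "1 \<in> head_rows (row_heads \<tau>)" unfolding head_rows_eq by simp
        then show ?thesis using i1 staircases_range[OF \<tau> i1(2)] unfolding P_def by force
      qed
      define k where "k = Max P"
      have "k \<in> P" using fP \<open>P \<noteq> {}\<close> unfolding k_def by simp
      then have k: "k \<in> head_rows (row_heads \<tau>)" "k < i" unfolding P_def by auto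
      have kmax: "k' \<le> k" if "k' \<in> head_rows (row_heads \<tau>)" "k' < i" for k'
        unfolding k_def using that fP by (intro Max_ge) (auto simp: P_def)
      have "(k, j) \<in> completion n (row_heads \<tau>)" unfolding completion_def
      proof (clarsimp, intro conjI ballI)
        show "k \<in> head_rows (row_heads \<tau>)" by (fact k)
        show "Suc 0 \<le> j" "j \<le> n" "j \<notin> head_rows (row_heads \<tau>)" using ij unfolding completion_def by auto
        fix x assume x: "x \<in> row_heads \<tau>"
        obtain a b where ab: "x = (a, b)" by force
        have "b \<le> j" if "a \<le> k" using ij x ab k that unfolding completion_def by auto
        moreover have "j \<le> b" if "k < a"
        proof -
          have "a \<in> head_rows (row_heads \<tau>)" using x ab unfolding head_rows_def by force
          then have "i \<le> a" using kmax[of a] that by linarith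
          then show ?thesis
            using h x ab staircases_le[OF \<tau> i1(2), of a b] heads_subset(1)[of \<tau>]
            by (cases "i = a") (auto simp: row_heads_def not_less[symmetric])
        qed
        ultimately show "case x of (a, b) \<Rightarrow> (a \<le> k \<longrightarrow> b \<le> j) \<and> (k < a \<longrightarrow> j \<le> b)"
          using ab by simp
      qed
      then show False using top k unfolding col_heads_def by auto
    qed
  next
    assume not_head: "(i, j) \<notin> row_heads (completion n (row_heads \<tau>))"
    have "j \<noteq> 1 \<and> (\<forall>i'<i. (i', j) \<notin> completion n (row_heads \<tau>))"
    proof (cases "i = 1")
      case True
      then show ?thesis using ij head_rows_subset unfolding completion_def by auto
    next
      case False
      obtain j' where j': "(i, j') \<in> row_heads (completion n (row_heads \<tau>))" "j' \<le> j" using row_head_exists[OF ij False] .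
      then have "j' < j" using not_head by (cases "j = j'") auto
      moreover have "1 \<le> j'" using j' heads_subset(1) staircases_range[OF completion_staircase] by blast
      moreover have "(i', j) \<notin> completion n (row_heads \<tau>)" if "i' < i" for i'
        using completion_le(2)[of i' j n "row_heads \<tau>" i j'] j'(1) that \<open>j' < j\<close>
        unfolding row_heads_completion by auto
      ultimately show ?thesis by auto
    qed
    then show "(i, j) \<in> col_heads (completion n (row_heads \<tau>))" using ij unfolding col_heads_def by auto
  qed
  then show ?thesis using heads_subset(2)[of "completion n (row_heads \<tau>)"] by auto
qed

text \<open>A column \<open>j\<close> occurs in the last row whose head is not to the right of
  \<open>j\<close>. Row 1 has no head and always qualifies; if 1 is a column, the row of its head
  does.\<close>

lemma snd_completion_eq: "snd ` completion n (row_heads \<tau>) = {1..n} - head_rows (row_heads \<tau>)"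
proof (intro equalityI snd_completion subsetI)
  fix j assume j: "j \<in> {1..n} - head_rows (row_heads \<tau>)"
  define P where "P = {i \<in> head_rows (row_heads \<tau>). \<forall>l. (i, l) \<in> row_heads \<tau> \<longrightarrow> l \<le> j}"
  have fP: "finite P" unfolding P_def
    by (rule finite_subset[of _ "{1..n}"]) (use head_rows_subset in auto)
  have "P \<noteq> {}"
  proof (cases "1 \<in> snd ` \<tau>")
    case True
    then have "1 \<in> snd ` row_heads \<tau>" using one_in_snd_row_heads[OF \<tau>] by simp
    then obtain k where k: "(k, 1) \<in> row_heads \<tau>" by auto
    then have "k \<in> P" using j unfolding P_def head_rows_def row_heads_def by force
    then show ?thesis by blast
  next
    case False
    then have "1 \<in> head_rows (row_heads \<tau>)" unfolding head_rows_eq by simp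
    then have "1 \<in> P" unfolding P_def by (simp add: row_heads_def)
    then show ?thesis by blast
  qed
  define i where "i = Max P"
  have "i \<in> P" using fP \<open>P \<noteq> {}\<close> unfolding i_def by simp
  then have i: "i \<in> head_rows (row_heads \<tau>)" "\<And>l. (i, l) \<in> row_heads \<tau> \<Longrightarrow> l \<le> j" unfolding P_def by auto
  have imax: "k \<le> i" if "k \<in> P" for k unfolding i_def using that fP by simp
  have "(i, j) \<in> completion n (row_heads \<tau>)" unfolding completion_def
  proof (clarsimp, intro conjI ballI)
    show "i \<in> head_rows (row_heads \<tau>)" by (fact i)
    show "Suc 0 \<le> j" "j \<le> n" "j \<notin> head_rows (row_heads \<tau>)" using j by auto
    fix x assume x: "x \<in> row_heads \<tau>"
    obtain a b where ab: "x = (a, b)" by force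
    have abt: "(a, b) \<in> \<tau>" using x ab heads_subset(1) by blast
    have "j \<le> b" if "i < a"
    proof -
      have "a \<in> head_rows (row_heads \<tau>)" using x ab unfolding head_rows_def by force
      then have "a \<notin> P" using imax that by force
      then obtain l where "(a, l) \<in> row_heads \<tau>" "j < l" using \<open>a \<in> head_rows (row_heads \<tau>)\<close> unfolding P_def by force
      moreover have "l = b" using row_heads_Least calculation(1) x ab by blast
      ultimately show ?thesis by simp
    qed
    moreover have "b \<le> j" if "a \<le> i"
    proof (cases "a = i")
      case True then show ?thesis using i x ab by auto
    next
      case False
      then have "a < i" using that by simp
      then have "i \<noteq> 1" using staircases_range[OF \<tau> abt] by auto
      then have "i \<in> fst ` row_heads \<tau>" using i(1) unfolding head_rows_def by (auto split: if_splits)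
      then obtain l where l: "(i, l) \<in> row_heads \<tau>" by auto
      then have "b \<le> l" using staircases_le[OF \<tau> abt _ \<open>a < i\<close>] heads_subset(1) by blast
      then show ?thesis using i(2)[OF l] by simp
    qed
    ultimately show "case x of (a, b) \<Rightarrow> (a \<le> i \<longrightarrow> b \<le> j) \<and> (i < a \<longrightarrow> j \<le> b)" using ab by simp
  qed
  then show "j \<in> snd ` completion n (row_heads \<tau>)" by force
qed

text \<open>Edges of a tree correspond to the vertices other than the root: each index from 2 to n
  is either a row or a column, it has one head, and every cell is the head of exactly one of
  them.\<close>

lemma card_completion: "card (completion n (row_heads \<tau>)) = n - 1"
proof -
  have fin: "finite (completion n (row_heads \<tau>))" by (rule staircases_finite[OF completion_staircase])
  have "card (row_heads (completion n (row_heads \<tau>))) = card (head_rows (row_heads \<tau>) - {1})"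
    unfolding row_heads_completion card_row_heads head_rows_eq by (rule arg_cong[of _ _ card]) auto
  moreover have "card (col_heads (completion n (row_heads \<tau>))) = card ({1..n} - head_rows (row_heads \<tau>) - {1})"
    unfolding card_col_heads snd_completion_eq ..
  moreover have "card (completion n (row_heads \<tau>)) = card (row_heads (completion n (row_heads \<tau>))) + card (col_heads (completion n (row_heads \<tau>)))"
    using fin heads_subset(1)[of "completion n (row_heads \<tau>)"] card_Un_disjoint[of "row_heads (completion n (row_heads \<tau>))" "completion n (row_heads \<tau>) - row_heads (completion n (row_heads \<tau>))"]
    unfolding col_heads_completion by (simp add: Un_absorb1 finite_subset)
  moreover have "card (head_rows (row_heads \<tau>) - {1}) + card ({1..n} - head_rows (row_heads \<tau>) - {1}) = card ((head_rows (row_heads \<tau>) - {1}) \<union> ({1..n} - head_rows (row_heads \<tau>) - {1}))"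
    by (rule card_Un_disjoint[symmetric]) (use head_rows_subset finite_subset in auto)
  moreover have "(head_rows (row_heads \<tau>) - {1}) \<union> ({1..n} - head_rows (row_heads \<tau>) - {1}) = {1..n} - {1}" using head_rows_subset by auto
  ultimately show ?thesis using n by simp
qed

lemma completion_facet: "completion n (row_heads \<tau>) \<in> facets n"
  unfolding facets_def using completion_staircase card_completion by simp

end

section \<open>Facets, their order by weight, and transposition\<close>

lemma staircases_card:
  assumes "1 \<le> n" "\<tau> \<in> staircases n" shows "card \<tau> \<le> n - 1"
  using card_mono[OF staircases_finite[OF completion_staircase[OF assms]] subset_completion[OF assms]]
  by (simp add: card_completion[OF assms])

lemma facets_staircases: "F \<in> facets n \<Longrightarrow> F \<in> staircases n"
  and facets_card: "F \<in> facets n \<Longrightarrow> card F = n - 1"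
  and facets_finite: "F \<in> facets n \<Longrightarrow> finite F"
  unfolding facets_def using staircases_finite by auto

lemma completion_of_facet:
  assumes "1 \<le> n" "F \<in> facets n" shows "completion n (row_heads F) = F"
  using card_subset_eq[OF staircases_finite[OF completion_staircase] subset_completion, of n F] assms
  by (simp add: facets_card facets_staircases card_completion)

lemma facet_col_heads:
  assumes "1 \<le> n" "F \<in> facets n" shows "col_heads F = F - row_heads F"
  using col_heads_completion[OF assms(1) facets_staircases[OF assms(2)]]
  unfolding completion_of_facet[OF assms] .

lemma facet_cols:
  assumes "1 \<le> n" "F \<in> facets n" shows "{1..n} - fst ` F - {1} \<subseteq> snd ` F"
proof -
  have "snd ` F = {1..n} - head_rows (row_heads F)"
    using snd_completion_eq[OF assms(1) facets_staircases[OF assms(2)]]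
    unfolding completion_of_facet[OF assms] .
  moreover have "head_rows (row_heads F) \<subseteq> insert 1 (fst ` F)"
    unfolding head_rows_def fst_row_heads by simp blast
  ultimately show ?thesis by blast
qed

lemma facet_eqI:
  assumes "1 \<le> n" "F \<in> facets n" "G \<in> facets n" "row_heads F = row_heads G" shows "F = G"
  using completion_of_facet[OF assms(1,2)] completion_of_facet[OF assms(1,3)] assms(4) by metis

text \<open>The hypotheses compare the weights summand by summand. If the weight does not grow,
  neither a row nor a shift of a head is gained; then the row heads agree, and they determine the
  facet. Both shellings rest on this.\<close>

lemma shell_weight_less:
  assumes n: "1 \<le> n" and F: "F \<in> facets n" and G: "G \<in> facets n"
    and rows: "fst ` F - {1} \<subseteq> fst ` G - {1}"
    and heads: "\<And>i j. (i, j) \<in> row_heads F \<Longrightarrow> (LEAST j. (i, j) \<in> G) \<le> j \<or> i \<notin> fst ` G"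
  shows "F = G \<or> shell_weight n F < shell_weight n G"
proof (rule disjCI)
  assume "\<not> shell_weight n F < shell_weight n G"
  define f where "f F i = n + 1 - (LEAST j. (i, j) \<in> F)" for F :: "(nat \<times> nat) set" and i
  have finG: "finite (fst ` G - {1})" using facets_finite[OF G] by simp
  have head: "(i, LEAST j. (i, j) \<in> F) \<in> row_heads F" if "i \<in> fst ` F - {1}" for F i
    using that unfolding row_heads_eq by simp
  have least_le: "(LEAST j. (i, j) \<in> F) \<le> n" if "i \<in> fst ` F - {1}" "F \<in> facets n" for F i
    using head[OF that(1)] heads_subset(1) staircases_range[OF facets_staircases[OF that(2)]] by blast
  have pos: "0 < f F i" if "i \<in> fst ` F - {1}" "F \<in> facets n" for F i
    using least_le[OF that] unfolding f_def by simp
  have le: "f F i \<le> f G i" if "i \<in> fst ` F - {1}" for i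
    using heads[OF head[OF that]] that rows unfolding f_def by auto
  have "sum (f F) (fst ` F - {1}) \<le> sum (f G) (fst ` F - {1})" by (intro sum_mono le)
  moreover have split: "sum (f G) (fst ` G - {1}) = sum (f G) (fst ` F - {1}) +
      sum (f G) (fst ` G - {1} - (fst ` F - {1}))"
    using sum.subset_diff[OF rows finG, of "f G"] by simp
  ultimately have eq: "sum (f F) (fst ` F - {1}) = sum (f G) (fst ` F - {1})"
    "sum (f G) (fst ` G - {1} - (fst ` F - {1})) = 0"
    using \<open>\<not> _\<close> unfolding shell_weight_def f_def by linarith+
  have rows_eq: "fst ` G - {1} = fst ` F - {1}"
  proof (rule ccontr)
    assume "fst ` G - {1} \<noteq> fst ` F - {1}"
    then obtain i where i: "i \<in> fst ` G - {1}" "i \<notin> fst ` F - {1}" using rows by blast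
    then have "f G i = 0" using eq(2) finG by (simp add: sum_eq_0_iff)
    then show False using pos[OF i(1) G] by simp
  qed
  have "f F i = f G i" if "i \<in> fst ` F - {1}" for i
  proof (rule ccontr)
    assume "f F i \<noteq> f G i"
    then have "sum (f F) (fst ` F - {1}) < sum (f G) (fst ` F - {1})"
      using that le facets_finite[OF F] by (intro sum_strict_mono_ex1) (auto simp: le_less)
    then show False using eq by simp
  qed
  then have f_eq: "f F i = f G i" if "i \<in> fst ` F - {1}" for i using that .
  have "(LEAST j. (i, j) \<in> F) = (LEAST j. (i, j) \<in> G)" if "i \<in> fst ` F - {1}" for i
  proof -
    have "(LEAST j. (i, j) \<in> F) \<le> n" "(LEAST j. (i, j) \<in> G) \<le> n"
      using least_le[OF that F] least_le[OF _ G, of i] that rows_eq by blast+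
    then show ?thesis using f_eq[OF that] unfolding f_def by linarith
  qed
  then have "row_heads F = row_heads G"
    unfolding row_heads_eq rows_eq by (intro image_cong) auto
  then show "F = G" by (rule facet_eqI[OF n F G])
qed

lemma row_heads_subset_less:
  assumes n: "1 \<le> n" and F: "F \<in> facets n" and G: "G \<in> facets n" and sub: "row_heads F \<subseteq> G"
  shows "F = G \<or> shell_weight n F < shell_weight n G"
proof (rule shell_weight_less[OF n F G])
  show "fst ` F - {1} \<subseteq> fst ` G - {1}" using image_mono[OF sub, of fst] fst_row_heads[of F] by blast
  show "(LEAST j. (i, j) \<in> G) \<le> j \<or> i \<notin> fst ` G" if "(i, j) \<in> row_heads F" for i j
    using that sub by (intro disjI1 Least_le) blast
qed

text \<open>Sharing the column heads of F, the facet G has at least the columns of F other than 1,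
  hence at most its rows. In a common row, the head of F does not open its column unless that column
  is 1; the cell that does lies further up and belongs to G as well, and monotonicity in G keeps the
  head of G from being further to the left.\<close>

lemma col_heads_subset_less:
  assumes n: "1 \<le> n" and F: "F \<in> facets n" and G: "G \<in> facets n" and sub: "col_heads F \<subseteq> G"
  shows "G = F \<or> shell_weight n G < shell_weight n F"
proof (rule shell_weight_less[OF n G F])
  note FS = facets_staircases[OF F] and GS = facets_staircases[OF G]
  show rows: "fst ` G - {1} \<subseteq> fst ` F - {1}"
  proof
    fix i assume i: "i \<in> fst ` G - {1}"
    then have "i \<in> {1..n}" using staircases_range[OF GS] by auto
    have "i \<notin> snd ` G" using i staircases_neq[OF GS] by auto
    then have "i \<notin> snd ` F - {1}" using image_mono[OF sub, of snd] snd_col_heads[of F] by auto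
    then show "i \<in> fst ` F - {1}" using facet_cols[OF n F] i \<open>i \<in> {1..n}\<close> by blast
  qed
  show "(LEAST j. (i, j) \<in> F) \<le> l \<or> i \<notin> fst ` F" if il: "(i, l) \<in> row_heads G" for i l
  proof (cases "i \<in> fst ` F")
    case True
    then obtain j0 where "(i, j0) \<in> F" by auto
    moreover have "i \<noteq> 1" using il unfolding row_heads_def by auto
    ultimately obtain j where j: "(i, j) \<in> row_heads F" "j = (LEAST j. (i, j) \<in> F)"
      using row_head_exists by metis
    have ilG: "(i, l) \<in> G" and ijF: "(i, j) \<in> F" using il j heads_subset(1) by blast+
    have "j \<le> l"
    proof (cases "j = 1")
      case True then show ?thesis using staircases_range[OF GS ilG] by simp
    next
      case False
      have "(i, j) \<notin> col_heads F" using j facet_col_heads[OF n F] by simp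
      then obtain i' where "i' < i" "(i', j) \<in> F" using False ijF unfolding col_heads_def by auto
      then have "j \<in> snd ` F - {1}" using False by force
      then have "j \<in> snd ` col_heads F" unfolding snd_col_heads .
      then obtain i'' where i'': "(i'', j) \<in> col_heads F" by auto
      then have "i'' \<le> i'" using \<open>(i', j) \<in> F\<close> unfolding col_heads_def by (auto simp: not_less[symmetric])
      then show ?thesis using staircases_le[OF GS _ ilG] i'' sub \<open>i' < i\<close> by force
    qed
    then show ?thesis using j by simp
  qed simp
qed

definition dual_completion :: "nat \<Rightarrow> (nat \<times> nat) set \<Rightarrow> (nat \<times> nat) set" where
  "dual_completion n \<rho> = prod.swap ` completion n (prod.swap ` \<rho>)"

lemma facets_swap: "prod.swap ` F \<in> facets n \<longleftrightarrow> F \<in> facets n"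
  unfolding facets_def by (simp add: staircases_swap card_image)

text \<open>The last claim is what keeps an interior face within the ball: its columns include all
  indices beyond m, so no such index becomes a row.\<close>

lemma dual_completion_facet:
  assumes "1 \<le> n" "\<tau> \<in> staircases n"
  shows "dual_completion n (col_heads \<tau>) \<in> facets n"
    and "\<tau> \<subseteq> dual_completion n (col_heads \<tau>)"
    and "col_heads (dual_completion n (col_heads \<tau>)) = col_heads \<tau>"
    and "fst ` dual_completion n (col_heads \<tau>) \<subseteq> {1..n} - (snd ` \<tau> - {1})"
proof -
  let ?\<tau> = "prod.swap ` \<tau>" and ?D = "dual_completion n (col_heads \<tau>)"
  have s: "?\<tau> \<in> staircases n" using assms(2) by (simp add: staircases_swap)
  have D: "?D = prod.swap ` completion n (row_heads ?\<tau>)"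
    unfolding dual_completion_def heads_swap ..
  show "?D \<in> facets n" unfolding D facets_swap by (rule completion_facet[OF assms(1) s])
  show "\<tau> \<subseteq> ?D" using image_mono[OF subset_completion[OF assms(1) s], of prod.swap]
    unfolding D by (simp add: image_image)
  show "col_heads ?D = col_heads \<tau>" unfolding D heads_swap(1) row_heads_completion[OF assms(1) s]
    by (simp add: heads_swap image_image)
  have "fst ` ?D = snd ` completion n (row_heads ?\<tau>)" unfolding D by (simp add: image_image)
  also have "\<dots> \<subseteq> {1..n} - (fst ` ?\<tau> - {1})"
    using snd_completion[OF assms(1) s] unfolding head_rows_eq[OF assms(1) s] by auto
  also have "fst ` ?\<tau> = snd ` \<tau>" by (simp add: image_image)
  finally show "fst ` ?D \<subseteq> {1..n} - (snd ` \<tau> - {1})" .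
qed

lemma fst_completion_subset:
  assumes "1 \<le> n" "\<tau> \<in> staircases n"
  shows "fst ` completion n (row_heads \<tau>) \<subseteq> insert 1 (fst ` \<tau>)"
  using fst_completion[OF assms] unfolding head_rows_eq[OF assms] by (auto split: if_splits)

section \<open>Independence and unimodularity of the cells of a facet\<close>

section \<open>Cells as vectors\<close>

definition cell_vec :: "nat \<times> nat \<Rightarrow> nat \<Rightarrow> int" where
  "cell_vec v k = of_bool (snd v = k) - of_bool (fst v = k)"

lemma staircases_subset: "\<tau> \<in> staircases n \<Longrightarrow> \<tau> \<subseteq> {1..n} \<times> {1..n}"
  by (simp add: staircases_def)

text \<open>The deficit of \<open>u\<close> at (i, j) cannot be compensated after (i, j), so
  \<open>u\<close> is positive both earlier in row i and earlier in column j, and these two cells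
  violate monotonicity. The array \<open>w\<close> is arbitrary, so that the lemma also serves for
  comparing a staircase monomial with any other monomial.\<close>

lemma margins_contradiction:
  fixes u w :: "nat \<times> nat \<Rightarrow> nat"
  assumes fin: "finite A" "finite B" and ij: "i \<in> A" "j \<in> B"
    and row: "(\<Sum>b\<in>B. u (i, b)) = (\<Sum>b\<in>B. w (i, b))"
    and col: "(\<Sum>a\<in>A. u (a, j)) = (\<Sum>a\<in>A. w (a, j))"
    and mono: "\<And>a b. 0 < u (a, j) \<Longrightarrow> 0 < u (i, b) \<Longrightarrow> a < i \<Longrightarrow> j \<le> b"
    and less: "u (i, j) < w (i, j)"
    and after_row: "\<And>b. b \<in> B \<Longrightarrow> j < b \<Longrightarrow> u (i, b) = w (i, b)"
    and after_col: "\<And>a. a \<in> A \<Longrightarrow> i < a \<Longrightarrow> u (a, j) = w (a, j)"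
  shows False
proof -
  have "\<exists>a. a < i \<and> 0 < u (a, j)"
  proof (rule ccontr)
    assume "\<not> ?thesis"
    then have "u (a, j) \<le> w (a, j)" if "a \<in> A" for a
      using that less after_col by (cases a i rule: linorder_cases) (auto simp: less_imp_le)
    then have "(\<Sum>a\<in>A. u (a, j)) < (\<Sum>a\<in>A. w (a, j))"
      using fin ij less by (intro sum_strict_mono_ex1) auto
    then show False using col by simp
  qed
  moreover have "\<exists>b. b < j \<and> 0 < u (i, b)"
  proof (rule ccontr)
    assume "\<not> ?thesis"
    then have "u (i, b) \<le> w (i, b)" if "b \<in> B" for b
      using that less after_row by (cases b j rule: linorder_cases) (auto simp: less_imp_le)
    then have "(\<Sum>b\<in>B. u (i, b)) < (\<Sum>b\<in>B. w (i, b))"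
      using fin ij less by (intro sum_strict_mono_ex1) auto
    then show False using row by simp
  qed
  ultimately show False using mono by (meson not_le)
qed

lemma margins_unique:
  fixes u w :: "nat \<times> nat \<Rightarrow> nat"
  assumes u: "{v. u v \<noteq> 0} \<in> staircases n" and w: "{v. w v \<noteq> 0} \<in> staircases n"
    and rows: "\<And>i. i \<in> {1..n} \<Longrightarrow> (\<Sum>j\<in>{1..n}. u (i, j)) = (\<Sum>j\<in>{1..n}. w (i, j))"
    and cols: "\<And>j. j \<in> {1..n} \<Longrightarrow> (\<Sum>i\<in>{1..n}. u (i, j)) = (\<Sum>i\<in>{1..n}. w (i, j))"
  shows "u = w"
proof (rule ccontr)
  assume "u \<noteq> w"
  define D where "D = {v. u v \<noteq> w v}"
  have "D \<subseteq> {v. u v \<noteq> 0} \<union> {v. w v \<noteq> 0}" unfolding D_def by auto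
  then have sub: "D \<subseteq> {1..n} \<times> {1..n}"
    using staircases_subset[OF u] staircases_subset[OF w] by (meson Un_least subset_trans)
  then have fin: "finite D" by (rule finite_subset) simp
  have "D \<noteq> {}" using \<open>u \<noteq> w\<close> unfolding D_def by auto
  \<comment> \<open>In reading order, (i, j) becomes the last position where the arrays differ, so
    that row i and column j agree beyond it.\<close>
  define i where "i = Max (fst ` D)"
  have "i \<in> fst ` D" unfolding i_def using fin \<open>D \<noteq> {}\<close> by simp
  define j where "j = Max {j. (i, j) \<in> D}"
  have finj: "finite {j. (i, j) \<in> D}"
    by (rule finite_subset[of _ "snd ` D"]) (use fin in force)+
  have "j \<in> {j. (i, j) \<in> D}" unfolding j_def
    using \<open>i \<in> fst ` D\<close> finj by (intro Max_in) auto
  then have ij: "(i, j) \<in> D" by simp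
  have later: "u (a, b) = w (a, b)" if "i < a \<or> a = i \<and> j < b" for a b
  proof (rule ccontr)
    assume "u (a, b) \<noteq> w (a, b)"
    then have ab: "(a, b) \<in> D" unfolding D_def by simp
    then have "a \<in> fst ` D" by force
    then have "a \<le> i" unfolding i_def using fin by simp
    moreover have "b \<le> j" if "a = i" unfolding j_def using ab that finj by simp
    ultimately show False using that by auto
  qed
  have mem: "i \<in> {1..n}" "j \<in> {1..n}" using sub ij by auto
  have monou: "j \<le> b" if "0 < u (a, j)" "0 < u (i, b)" "a < i" for a b
    using staircases_le[OF u, of a j i b] that by simp
  have monow: "j \<le> b" if "0 < w (a, j)" "0 < w (i, b)" "a < i" for a b
    using staircases_le[OF w, of a j i b] that by simp
  have "u (i, j) \<noteq> w (i, j)" using ij unfolding D_def by simp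
  then consider "u (i, j) < w (i, j)" | "w (i, j) < u (i, j)" by linarith
  then show False
  proof cases
    case 1
    show ?thesis
      by (rule margins_contradiction[OF _ _ mem rows[OF mem(1)] cols[OF mem(2)] monou 1])
        (use later in auto)
  next
    case 2
    show ?thesis
      by (rule margins_contradiction[OF _ _ mem rows[OF mem(1), symmetric]
            cols[OF mem(2), symmetric] monow 2]) (use later in auto)
  qed
qed

lemma sum_cell_vec:
  fixes u :: "nat \<times> nat \<Rightarrow> 'a::comm_ring_1"
  assumes "k \<in> {1..n}"
  shows "(\<Sum>v\<in>{1..n} \<times> {1..n}. u v * of_int (cell_vec v k)) =
    (\<Sum>i\<in>{1..n}. u (i, k)) - (\<Sum>j\<in>{1..n}. u (k, j))"
proof -
  have "u v * of_int (cell_vec v k) = u v * of_bool (snd v = k) - u v * of_bool (fst v = k)" for v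
    by (auto simp: cell_vec_def of_bool_def)
  then have "(\<Sum>v\<in>{1..n} \<times> {1..n}. u v * of_int (cell_vec v k)) =
      (\<Sum>i\<in>{1..n}. \<Sum>j\<in>{1..n}. u (i, j) * of_bool (j = k)) -
      (\<Sum>i\<in>{1..n}. \<Sum>j\<in>{1..n}. u (i, j) * of_bool (i = k))"
    by (simp only: sum_subtractf) (simp only: sum.cartesian_product case_prod_unfold prod.collapse)
  also have "(\<Sum>i\<in>{1..n}. \<Sum>j\<in>{1..n}. u (i, j) * of_bool (j = k)) = (\<Sum>i\<in>{1..n}. u (i, k))"
    using assms by (simp add: of_bool_def if_distrib[of "(*) _"] cong: if_cong)
  also have "(\<Sum>i\<in>{1..n}. \<Sum>j\<in>{1..n}. u (i, j) * of_bool (i = k)) = (\<Sum>j\<in>{1..n}. u (k, j))"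
    using assms by (subst sum.swap) (simp add: of_bool_def if_distrib[of "(*) _"] cong: if_cong)
  finally show ?thesis .
qed

text \<open>No index is both a row and a column of a staircase. A coordinate is therefore a column
  sum or the negative of a row sum, its sign tells which, and the vector determines all
  margins.\<close>

lemma staircase_rep_unique:
  fixes u w :: "nat \<times> nat \<Rightarrow> nat"
  assumes u: "{v. u v \<noteq> 0} \<in> staircases n" and w: "{v. w v \<noteq> 0} \<in> staircases n"
    and eq: "\<And>k. k \<in> {1..n} \<Longrightarrow> (\<Sum>v\<in>{1..n} \<times> {1..n}. int (u v) * cell_vec v k) =
      (\<Sum>v\<in>{1..n} \<times> {1..n}. int (w v) * cell_vec v k)"
  shows "u = w"
proof -
  have zero: "(\<Sum>i\<in>{1..n}. u (i, k)) = 0 \<or> (\<Sum>j\<in>{1..n}. u (k, j)) = 0"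
    if u: "{v. u v \<noteq> 0} \<in> staircases n" for u :: "nat \<times> nat \<Rightarrow> nat" and k
  proof (rule ccontr)
    assume "\<not> ?thesis"
    then obtain i j where "u (i, k) \<noteq> 0" "u (k, j) \<noteq> 0" by (meson sum.neutral)
    then show False using staircases_neq[OF u, of k j i k] by simp
  qed
  have "(\<Sum>i\<in>{1..n}. u (i, k)) = (\<Sum>i\<in>{1..n}. w (i, k)) \<and>
      (\<Sum>j\<in>{1..n}. u (k, j)) = (\<Sum>j\<in>{1..n}. w (k, j))" if k: "k \<in> {1..n}" for k
  proof -
    have "int (\<Sum>i\<in>{1..n}. u (i, k)) - int (\<Sum>j\<in>{1..n}. u (k, j)) =
        int (\<Sum>i\<in>{1..n}. w (i, k)) - int (\<Sum>j\<in>{1..n}. w (k, j))"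
      using eq[OF k] sum_cell_vec[OF k, of "\<lambda>v. int (u v)"] sum_cell_vec[OF k, of "\<lambda>v. int (w v)"]
      by simp
    then show ?thesis using zero[OF u, of k] zero[OF w, of k] by linarith
  qed
  then show ?thesis by (intro margins_unique[OF u w]) auto
qed

lemma sum_cells_extend:
  fixes a :: "nat \<times> nat \<Rightarrow> int"
  assumes "F \<in> staircases n" "\<And>v. v \<notin> F \<Longrightarrow> a v = 0"
  shows "(\<Sum>v\<in>F. a v * cell_vec v k) = (\<Sum>v\<in>{1..n} \<times> {1..n}. a v * cell_vec v k)"
  using assms by (intro sum.mono_neutral_left) (auto simp: staircases_def)

text \<open>The positive and the negative part of a relation represent the same vector by subsets of
  F, which are staircases.\<close>

lemma cell_vec_independent:
  fixes a :: "nat \<times> nat \<Rightarrow> int"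
  assumes F: "F \<in> staircases n" and v: "v \<in> F"
    and eq: "\<And>k. k \<in> {1..n} \<Longrightarrow> (\<Sum>v\<in>F. a v * cell_vec v k) = 0"
  shows "a v = 0"
proof -
  define u where "u v = (if v \<in> F then nat (a v) else 0)" for v
  define w where "w v = (if v \<in> F then nat (- a v) else 0)" for v
  have "u = w"
  proof (rule staircase_rep_unique[of _ n])
    show "{v. u v \<noteq> 0} \<in> staircases n" "{v. w v \<noteq> 0} \<in> staircases n"
      by (rule staircases_mono[OF F]; auto simp: u_def w_def)+
    fix k assume k: "k \<in> {1..n}"
    have "(\<Sum>v\<in>F. int (u v) * cell_vec v k) - (\<Sum>v\<in>F. int (w v) * cell_vec v k) =
        (\<Sum>v\<in>F. a v * cell_vec v k)"
      unfolding sum_subtractf[symmetric]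
      by (intro sum.cong refl) (auto simp: u_def w_def left_diff_distrib[symmetric])
    then show "(\<Sum>v\<in>{1..n} \<times> {1..n}. int (u v) * cell_vec v k) =
        (\<Sum>v\<in>{1..n} \<times> {1..n}. int (w v) * cell_vec v k)"
      using eq[OF k] sum_cells_extend[OF F, of "\<lambda>v. int (u v)" k]
        sum_cells_extend[OF F, of "\<lambda>v. int (w v)" k] by (simp add: u_def w_def)
  qed
  then have "u v = w v" by simp
  then show ?thesis using v unfolding u_def w_def by (simp split: if_splits)
qed

definition in_cell_span :: "nat \<Rightarrow> (nat \<times> nat) set \<Rightarrow> (nat \<Rightarrow> int) \<Rightarrow> bool" where
  "in_cell_span n F x \<longleftrightarrow> (\<exists>a :: nat \<times> nat \<Rightarrow> int. \<forall>k\<in>{1..n}. x k = (\<Sum>v\<in>F. a v * cell_vec v k))"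

lemma in_cell_span_add:
  assumes "in_cell_span n F x" "in_cell_span n F y"
  shows "in_cell_span n F (\<lambda>k. c * x k + d * y k)"
proof -
  from assms obtain a b :: "nat \<times> nat \<Rightarrow> int"
    where "\<forall>k\<in>{1..n}. x k = (\<Sum>v\<in>F. a v * cell_vec v k)"
      and "\<forall>k\<in>{1..n}. y k = (\<Sum>v\<in>F. b v * cell_vec v k)"
    unfolding in_cell_span_def by blast
  then have "\<forall>k\<in>{1..n}. c * x k + d * y k = (\<Sum>v\<in>F. (c * a v + d * b v) * cell_vec v k)"
    by (auto simp: sum_distrib_left sum.distrib[symmetric] algebra_simps intro!: sum.cong)
  then show ?thesis unfolding in_cell_span_def by (intro exI)
qed

lemma in_cell_span_cell:
  assumes "finite F" "v \<in> F" shows "in_cell_span n F (cell_vec v)"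
proof -
  have "\<forall>k\<in>{1..n}. cell_vec v k = (\<Sum>w\<in>F. of_bool (w = v) * cell_vec w k)"
    using assms by (simp add: of_bool_def if_distrib[of "\<lambda>x. x * _"] cong: if_cong)
  then show ?thesis unfolding in_cell_span_def by (rule exI[of _ "\<lambda>w. of_bool (w = v)"])
qed

text \<open>Viewed as a bipartite graph on \<open>{1..n}\<close> with edges the cells, a facet is a spanning tree;
  the edge from a vertex towards the root 1 is the head of its row or column.\<close>

lemma facet_spans:
  assumes n: "1 \<le> n" and F: "F \<in> facets n" and k: "k \<in> {1..n}"
  shows "in_cell_span n F (\<lambda>l. of_bool (l = k) - of_bool (l = 1))"
proof -
  let ?S = "\<lambda>k. in_cell_span n F (\<lambda>l. of_bool (l = k) - of_bool (l = 1))"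
  have fin: "finite F" by (rule facets_finite[OF F])
  have one: "?S 1" unfolding in_cell_span_def by (rule exI[of _ "\<lambda>_. 0"]) simp
  have cells: "?S i \<and> ?S j" if "(i, j) \<in> F" for i j
    using that
  \<comment> \<open>The index sum decreases because the next edge towards the root is a cell further
    up or further to the left.\<close>
  proof (induction "i + j" arbitrary: i j rule: less_induct)
    case less
    note vec = in_cell_span_cell[OF fin less.prems]
    have "?S i \<or> ?S j"
    proof (cases "(i, j) \<in> row_heads F")
      case True
      then have "(i, j) \<notin> col_heads F" using facet_col_heads[OF n F] by simp
      then have "j = 1 \<or> (\<exists>i'<i. (i', j) \<in> F)" using less.prems unfolding col_heads_def by auto
      then show ?thesis using one less.hyps by (metis add_less_cancel_right)
    next
      case False
      then have "i = 1 \<or> (\<exists>j'<j. (i, j') \<in> F)" using less.prems unfolding row_heads_def by auto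
      then show ?thesis using one less.hyps by (metis add_less_cancel_left)
    qed
    then show ?case
    proof
      assume i: "?S i"
      have "(\<lambda>l. 1 * (of_bool (l = i) - of_bool (l = 1)) + 1 * cell_vec (i, j) l) =
          (\<lambda>l. of_bool (l = j) - of_bool (l = 1) :: int)"
        by (auto simp: cell_vec_def of_bool_def fun_eq_iff)
      then have "?S j" using in_cell_span_add[OF i vec, of 1 1] by simp
      then show ?thesis using i by simp
    next
      assume j: "?S j"
      have "(\<lambda>l. 1 * (of_bool (l = j) - of_bool (l = 1)) + - 1 * cell_vec (i, j) l) =
          (\<lambda>l. of_bool (l = i) - of_bool (l = 1) :: int)"
        by (auto simp: cell_vec_def of_bool_def fun_eq_iff)
      then have "?S i" using in_cell_span_add[OF j vec, of 1 "-1"] by metis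
      then show ?thesis using j by simp
    qed
  qed
  show ?thesis
  proof (cases "k = 1")
    case False
    then have "k \<in> fst ` F \<or> k \<in> snd ` F" using facet_cols[OF n F] k by blast
    then show ?thesis using cells by auto
  qed (use one in simp)
qed

lemma facet_spans_cell:
  assumes n: "1 \<le> n" and F: "F \<in> facets n" and v: "v \<in> {1..n} \<times> {1..n}"
  shows "in_cell_span n F (cell_vec v)"
proof -
  obtain i j where ij: "v = (i, j)" "i \<in> {1..n}" "j \<in> {1..n}" using v by auto
  have "(\<lambda>l. 1 * (of_bool (l = j) - of_bool (l = 1)) + - 1 * (of_bool (l = i) - of_bool (l = 1))) =
      cell_vec v"
    unfolding ij(1) by (auto simp: cell_vec_def of_bool_def fun_eq_iff)
  then show ?thesis
    using in_cell_span_add[OF facet_spans[OF n F ij(3)] facet_spans[OF n F ij(2)], of 1 "-1"]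
    by metis
qed

text \<open>\<open>b k\<close> expands the difference of the unit vectors at k and at 1 over the
  cells of F. Coordinate 1 is dropped because coordinates sum to 0, so both matrices are square;
  their entries are integers, and they remain inverse to each other over every field.\<close>

lemma facet_dual_basis:
  assumes n: "1 \<le> n" and F: "F \<in> facets n"
  obtains b :: "nat \<Rightarrow> nat \<times> nat \<Rightarrow> int"
  where "\<And>k l. k \<in> {2..n} \<Longrightarrow> l \<in> {2..n} \<Longrightarrow> (\<Sum>v\<in>F. b k v * cell_vec v l) = of_bool (k = l)"
    and "\<And>v w. v \<in> F \<Longrightarrow> w \<in> F \<Longrightarrow> (\<Sum>k\<in>{2..n}. cell_vec w k * b k v) = of_bool (v = w)"
proof -
  have "\<forall>k\<in>{1..n}. \<exists>a :: nat \<times> nat \<Rightarrow> int. \<forall>l\<in>{1..n}.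
      of_bool (l = k) - of_bool (l = 1) = (\<Sum>v\<in>F. a v * cell_vec v l)"
    using facet_spans[OF n F] unfolding in_cell_span_def by blast
  then obtain b :: "nat \<Rightarrow> nat \<times> nat \<Rightarrow> int" where
    b: "\<And>k l. k \<in> {1..n} \<Longrightarrow> l \<in> {1..n} \<Longrightarrow>
      (\<Sum>v\<in>F. b k v * cell_vec v l) = of_bool (l = k) - of_bool (l = 1)"
    by metis
  show ?thesis
  proof (rule that)
    show "(\<Sum>v\<in>F. b k v * cell_vec v l) = of_bool (k = l)" if "k \<in> {2..n}" "l \<in> {2..n}" for k l
      using b[of k l] that by (cases "k = l") auto
    fix v w assume v: "v \<in> F" and w: "w \<in> F"
    have wr: "fst w \<in> {1..n}" "snd w \<in> {1..n}"
      using staircases_range[OF facets_staircases[OF F], of "fst w" "snd w"] w by auto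
    \<comment> \<open>The difference of two expansions of \<open>cell_vec w\<close> over F, which
      vanishes by independence.\<close>
    define a where "a v = (\<Sum>k\<in>{2..n}. cell_vec w k * b k v) - of_bool (v = w)" for v
    have total: "(\<Sum>k\<in>{2..n}. cell_vec w k) = - cell_vec w 1"
    proof -
      have "(\<Sum>k\<in>{1..n}. cell_vec w k) = 0"
        using wr by (simp add: cell_vec_def sum_subtractf of_bool_def)
      moreover have "(\<Sum>k\<in>{1..n}. cell_vec w k) = cell_vec w 1 + (\<Sum>k\<in>{2..n}. cell_vec w k)"
        using n by (simp add: sum.atLeast_Suc_atMost numeral_2_eq_2)
      ultimately show ?thesis by simp
    qed
    have "(\<Sum>v\<in>F. a v * cell_vec v l) = 0" if l: "l \<in> {1..n}" for l
    proof -
      have "(\<Sum>v\<in>F. (\<Sum>k\<in>{2..n}. cell_vec w k * b k v) * cell_vec v l) =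
          (\<Sum>k\<in>{2..n}. cell_vec w k * (\<Sum>v\<in>F. b k v * cell_vec v l))"
        unfolding sum_distrib_left sum_distrib_right by (subst sum.swap) (simp add: mult.assoc)
      also have "\<dots> = (\<Sum>k\<in>{2..n}. cell_vec w k * (of_bool (l = k) - of_bool (l = 1)))"
        using l by (intro sum.cong refl) (simp add: b)
      also have "\<dots> = (\<Sum>k\<in>{2..n}. if k = l then cell_vec w k else 0) -
          of_bool (l = 1) * (\<Sum>k\<in>{2..n}. cell_vec w k)"
        unfolding sum_distrib_left sum_subtractf[symmetric]
        by (intro sum.cong refl) (simp add: of_bool_def)
      also have "\<dots> = cell_vec w l"
        using l unfolding total by (cases "l = 1") (auto simp: of_bool_def)
      finally have 1: "(\<Sum>v\<in>F. (\<Sum>k\<in>{2..n}. cell_vec w k * b k v) * cell_vec v l) = cell_vec w l" .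
      have "(\<Sum>v\<in>F. of_bool (v = w) * cell_vec v l) = cell_vec w l"
        using w facets_finite[OF F] by (simp add: of_bool_def if_distrib[of "\<lambda>x. x * _"] cong: if_cong)
      then show ?thesis using 1 by (simp add: a_def left_diff_distrib sum_subtractf)
    qed
    then have "a v = 0" by (rule cell_vec_independent[OF facets_staircases[OF F] v])
    then show "(\<Sum>k\<in>{2..n}. cell_vec w k * b k v) = of_bool (v = w)" unfolding a_def by simp
  qed
qed

text \<open>If each of the cells is expanded over the facet of the other, the coefficients at v and
  w multiply to 1, so as integers they are 1 or -1. With the value 1 both facets would lie on the
  same side of the wall and their cones would overlap.\<close>

lemma wall_relation:
  assumes n: "1 \<le> n" and F: "insert v \<tau> \<in> facets n" and G: "insert w \<tau> \<in> facets n"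
    and v: "v \<notin> \<tau>" and w: "w \<notin> \<tau>" and vw: "v \<noteq> w"
  shows "in_cell_span n \<tau> (\<lambda>k. cell_vec v k + cell_vec w k)"
proof -
  have fin: "finite \<tau>" using facets_finite[OF F] by simp
  have FS: "insert v \<tau> \<in> staircases n" and GS: "insert w \<tau> \<in> staircases n"
    by (intro facets_staircases F G)+
  have "v \<in> {1..n} \<times> {1..n}" "w \<in> {1..n} \<times> {1..n}" using FS GS unfolding staircases_def by auto
  then have "in_cell_span n (insert w \<tau>) (cell_vec v)" "in_cell_span n (insert v \<tau>) (cell_vec w)"
    using facet_spans_cell[OF n] F G by blast+
  then obtain a c :: "nat \<times> nat \<Rightarrow> int"
    where a0: "\<forall>k\<in>{1..n}. cell_vec w k = (\<Sum>x\<in>insert v \<tau>. a x * cell_vec x k)"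
      and c0: "\<forall>k\<in>{1..n}. cell_vec v k = (\<Sum>x\<in>insert w \<tau>. c x * cell_vec x k)"
    unfolding in_cell_span_def by blast
  have a: "cell_vec w k = a v * cell_vec v k + (\<Sum>x\<in>\<tau>. a x * cell_vec x k)" if "k \<in> {1..n}" for k
    using bspec[OF a0 that] fin v by simp
  have c: "cell_vec v k = c w * cell_vec w k + (\<Sum>x\<in>\<tau>. c x * cell_vec x k)" if "k \<in> {1..n}" for k
    using bspec[OF c0 that] fin w by simp
  \<comment> \<open>Substituting the expansion of v into that of w leaves a relation within a single
    facet, so its coefficient at w is 0.\<close>
  define e where "e x = (if x = w then a v * c w - 1 else a v * c x + a x)" for x
  have "(\<Sum>x\<in>insert w \<tau>. e x * cell_vec x k) = 0" if k: "k \<in> {1..n}" for k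
  proof -
    have "(\<Sum>x\<in>\<tau>. e x * cell_vec x k) = (\<Sum>x\<in>\<tau>. (a v * c x + a x) * cell_vec x k)"
      using w by (intro sum.cong) (auto simp: e_def)
    also have "\<dots> = a v * (\<Sum>x\<in>\<tau>. c x * cell_vec x k) + (\<Sum>x\<in>\<tau>. a x * cell_vec x k)"
      by (simp add: sum_distrib_left sum.distrib algebra_simps)
    finally have *: "(\<Sum>x\<in>\<tau>. e x * cell_vec x k) =
      a v * (cell_vec v k - c w * cell_vec w k) + (cell_vec w k - a v * cell_vec v k)"
      using a[OF k] c[OF k] by simp
    have "(\<Sum>x\<in>insert w \<tau>. e x * cell_vec x k) =
        (a v * c w - 1) * cell_vec w k + (\<Sum>x\<in>\<tau>. e x * cell_vec x k)"
      using fin w by (simp add: e_def)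
    then show ?thesis unfolding * by (simp add: algebra_simps)
  qed
  then have "e w = 0" by (rule cell_vec_independent[OF GS insertI1])
  then have "a v * c w = 1" unfolding e_def by simp
  then have "a v = 1 \<or> a v = -1" by (auto simp: zmult_eq_1_iff)
  moreover have "a v \<noteq> 1"
  proof
    assume av: "a v = 1"
    \<comment> \<open>Moving the negative coefficients of w = v + ... to the other side yields two
      different staircase representations of one vector.\<close>
    define p where "p x = (if x = w then 1 else if x \<in> \<tau> then nat (- a x) else 0)" for x
    define q where "q x = (if x = v then 1 else if x \<in> \<tau> then nat (a x) else 0)" for x
    have "p = q"
    proof (rule staircase_rep_unique[of _ n])
      show "{x. p x \<noteq> 0} \<in> staircases n"
        by (rule staircases_mono[OF GS]) (auto simp: p_def split: if_splits)
      show "{x. q x \<noteq> 0} \<in> staircases n"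
        by (rule staircases_mono[OF FS]) (auto simp: q_def split: if_splits)
      fix k assume k: "k \<in> {1..n}"
      have "(\<Sum>x\<in>\<tau>. int (p x) * cell_vec x k) - (\<Sum>x\<in>\<tau>. int (q x) * cell_vec x k) =
          (\<Sum>x\<in>\<tau>. - (a x * cell_vec x k))"
        unfolding sum_subtractf[symmetric] using v w
        by (intro sum.cong refl) (auto simp: p_def q_def left_diff_distrib[symmetric])
      then have "(\<Sum>x\<in>insert w \<tau>. int (p x) * cell_vec x k) =
          (\<Sum>x\<in>insert v \<tau>. int (q x) * cell_vec x k)"
        using fin v w a[OF k] av by (simp add: p_def q_def sum_negf)
      then show "(\<Sum>x\<in>{1..n} \<times> {1..n}. int (p x) * cell_vec x k) =
          (\<Sum>x\<in>{1..n} \<times> {1..n}. int (q x) * cell_vec x k)"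
        using sum_cells_extend[OF GS, of "\<lambda>x. int (p x)" k] sum_cells_extend[OF FS, of "\<lambda>x. int (q x)" k]
        by (simp add: p_def q_def)
    qed
    then have "p w = q w" by simp
    then show False using w vw unfolding p_def q_def by simp
  qed
  ultimately have "\<forall>k\<in>{1..n}. cell_vec v k + cell_vec w k = (\<Sum>x\<in>\<tau>. a x * cell_vec x k)"
    using a by simp
  then show ?thesis unfolding in_cell_span_def by (intro exI)
qed

section \<open>Polynomials as finitely supported functions, and substitution homomorphisms\<close>

section \<open>Polynomials and substitution\<close>

abbreviation const :: "'k \<Rightarrow> ('v, 'k::field) mpoly" where
  "const c \<equiv> Poly_Mapping.single 0 c"

lemma keys_mon_add: "Poly_Mapping.keys (u + w) = Poly_Mapping.keys u \<union> Poly_Mapping.keys w"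
  for u w :: "'v mon"
  by (auto simp: in_keys_iff lookup_add)

lemma mon_deg_sum:
  assumes "finite A" "Poly_Mapping.keys u \<subseteq> A"
  shows "mon_deg u = (\<Sum>x\<in>A. Poly_Mapping.lookup u x)"
  unfolding mon_deg_def using assms by (intro sum.mono_neutral_left) (auto simp: in_keys_iff)

lemma mon_deg_add: "mon_deg (u + w) = mon_deg u + mon_deg w"
proof -
  let ?A = "Poly_Mapping.keys u \<union> Poly_Mapping.keys w"
  show ?thesis
    by (simp add: mon_deg_sum[of ?A] keys_mon_add lookup_add sum.distrib)
qed

lemma mon_deg_single [simp]: "mon_deg (Poly_Mapping.single x c) = c"
  by (cases "c = 0") (simp_all add: mon_deg_def)

lemma mon_deg_zero [simp]: "mon_deg 0 = 0"
  by (simp add: mon_deg_def)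

lemma mono_poly_mult: "mono_poly (u + w) = mono_poly u * mono_poly w"
  by (simp add: mono_poly_def mult_single)

lemma mono_poly_zero [simp]: "mono_poly 0 = 1"
  by (simp add: mono_poly_def)

lemma keys_mono_poly [simp]: "Poly_Mapping.keys (mono_poly u :: ('v, 'k::field) mpoly) = {u}"
  by (simp add: mono_poly_def)

lemma single_eq_const_mult: "Poly_Mapping.single u c = const c * mono_poly u"
  by (simp add: mono_poly_def mult_single)

lemma sum_single_keys: "(\<Sum>u\<in>Poly_Mapping.keys f. Poly_Mapping.single u (Poly_Mapping.lookup f u)) = f"
  for f :: "'a \<Rightarrow>\<^sub>0 'b::comm_monoid_add"
  by (intro poly_mapping_eqI)
    (simp add: lookup_sum lookup_single when_def in_keys_iff)

text \<open>The step for monomials is restricted to those of f, which keeps hypotheses about the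
  support of f available.\<close>

lemma poly_induct [case_names zero single add]:
  fixes f :: "('v, 'k::field) mpoly"
  assumes zero: "P 0"
    and single: "\<And>u c. u \<in> Poly_Mapping.keys f \<Longrightarrow> P (const c * mono_poly u)"
    and add: "\<And>p q. P p \<Longrightarrow> P q \<Longrightarrow> P (p + q)"
  shows "P f"
proof -
  have "P (\<Sum>u\<in>A. Poly_Mapping.single u (Poly_Mapping.lookup f u))"
    if "A \<subseteq> Poly_Mapping.keys f" for A
  proof -
    have "finite A" using that by (rule finite_subset) simp
    then show ?thesis using that
    proof (induction rule: finite_induct)
      case (insert u A)
      then show ?case
        using single[of u "Poly_Mapping.lookup f u"] unfolding single_eq_const_mult[symmetric]
        by (simp add: add)
    qed (simp add: zero)
  qed
  from this[OF order_refl] show ?thesis by (simp add: sum_single_keys)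
qed

lemma lookup_mono_mult: "Poly_Mapping.lookup (mono_poly w * f) (w + u) = Poly_Mapping.lookup f u"
  for f :: "('v, 'k::field) mpoly"
proof (induction f rule: poly_induct)
  case (single w' c)
  show ?case
    by (simp add: mono_poly_def mult_single lookup_single when_def)
qed (simp_all add: lookup_add distrib_left)

lemma keys_mono_mult:
  "Poly_Mapping.keys (mono_poly w * f) = (+) w ` Poly_Mapping.keys f" for f :: "('v, 'k::field) mpoly"
proof
  show "Poly_Mapping.keys (mono_poly w * f) \<subseteq> (+) w ` Poly_Mapping.keys f"
    using keys_mult[of "mono_poly w" f] by auto
  show "(+) w ` Poly_Mapping.keys f \<subseteq> Poly_Mapping.keys (mono_poly w * f)"
    by (auto simp: in_keys_iff lookup_mono_mult)
qed

lemma keys_mult_const: "Poly_Mapping.keys (const c * f) \<subseteq> Poly_Mapping.keys f"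
  for f :: "('v, 'k::field) mpoly"
  using keys_mult[of "const c" f] by (auto split: if_splits)

lemma lookup_const_mult: "Poly_Mapping.lookup (const c * f) u = c * Poly_Mapping.lookup f u"
  for f :: "('v, 'k::field) mpoly"
  by (induction f rule: poly_induct)
    (simp_all add: mono_poly_def mult_single lookup_single when_def lookup_add distrib_left)

definition mon_subst :: "('v \<Rightarrow> 'b) \<Rightarrow> 'v mon \<Rightarrow> 'b::comm_ring_1" where
  "mon_subst h u = (\<Prod>x\<in>Poly_Mapping.keys u. h x ^ Poly_Mapping.lookup u x)"

definition subst :: "('v \<Rightarrow> ('w, 'k) mpoly) \<Rightarrow> ('v, 'k::field) mpoly \<Rightarrow> ('w, 'k) mpoly" where
  "subst h f = (\<Sum>u\<in>Poly_Mapping.keys f. const (Poly_Mapping.lookup f u) * mon_subst h u)"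

lemma mon_subst_prod:
  assumes "finite A" "Poly_Mapping.keys u \<subseteq> A"
  shows "mon_subst h u = (\<Prod>x\<in>A. h x ^ Poly_Mapping.lookup u x)"
  unfolding mon_subst_def using assms by (intro prod.mono_neutral_left) (auto simp: in_keys_iff)

lemma mon_subst_add: "mon_subst h (u + w) = mon_subst h u * mon_subst h w"
proof -
  let ?A = "Poly_Mapping.keys u \<union> Poly_Mapping.keys w"
  show ?thesis
    by (simp add: mon_subst_prod[of ?A] keys_mon_add lookup_add power_add prod.distrib)
qed

lemma mon_subst_zero [simp]: "mon_subst h 0 = 1"
  by (simp add: mon_subst_def)

lemma mon_subst_single [simp]: "mon_subst h (Poly_Mapping.single x (Suc 0)) = h x"
  unfolding mon_subst_def by simp

lemma subst_sum:
  fixes f :: "('v, 'k::field) mpoly"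
  assumes "finite A" "Poly_Mapping.keys f \<subseteq> A"
  shows "subst h f = (\<Sum>u\<in>A. const (Poly_Mapping.lookup f u) * mon_subst h u)"
  unfolding subst_def using assms by (intro sum.mono_neutral_left) (auto simp: in_keys_iff)

lemma subst_add: "subst h (f + g) = subst h f + subst h g"
proof -
  let ?A = "Poly_Mapping.keys f \<union> Poly_Mapping.keys g"
  have "Poly_Mapping.keys (f + g) \<subseteq> ?A" by (rule keys_add)
  then show ?thesis
    by (simp add: subst_sum[of ?A] lookup_add single_add distrib_right sum.distrib)
qed

lemma subst_zero [simp]: "subst h 0 = 0"
  by (simp add: subst_def)

lemma subst_single: "subst h (Poly_Mapping.single u c) = const c * mon_subst h u"
  by (cases "c = 0") (simp_all add: subst_def)

lemma subst_mono: "subst h (mono_poly u) = mon_subst h u"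
  by (simp add: mono_poly_def subst_single)

lemma subst_const [simp]: "subst h (const c) = const c"
  by (simp add: subst_single)

lemma subst_one [simp]: "subst h 1 = 1"
  using subst_mono[of h 0] by simp

lemma subst_mult: "subst h (f * g) = subst h f * subst h g"
  for h :: "'v \<Rightarrow> ('w, 'k::field) mpoly"
proof (induction f rule: poly_induct)
  case (single u c)
  show ?case
  proof (induction g rule: poly_induct)
    case (single w e)
    have *: "const a * mono_poly x = Poly_Mapping.single x a" for a :: 'k and x :: "'v mon"
      by (rule single_eq_const_mult[symmetric])
    have "const (c * e) = (const c * const e :: ('w, 'k) mpoly)" by (simp add: mult_single)
    then have "const (c * e) * mon_subst h (u + w) =
        const c * mon_subst h u * (const e * mon_subst h w)"
      by (simp only: mon_subst_add mult_ac)
    then show ?case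
      by (simp only: * mult_single subst_single)
  qed (simp_all add: distrib_left subst_add)
qed (simp_all add: distrib_right subst_add)

lemma subst_uminus: "subst h (- f) = - subst h f"
  using subst_add[of h f "- f"] by (simp add: eq_neg_iff_add_eq_0 add.commute)

lemma subst_diff: "subst h (f - g) = subst h f - subst h g"
  using subst_add[of h f "- g"] by (simp add: subst_uminus)

lemma subst_setsum: "subst h (\<Sum>x\<in>A. f x) = (\<Sum>x\<in>A. subst h (f x))"
  by (induction A rule: infinite_finite_induct) (simp_all add: subst_add)

lemma subst_prod: "subst h (\<Prod>x\<in>A. f x) = (\<Prod>x\<in>A. subst h (f x))"
  by (induction A rule: infinite_finite_induct) (simp_all add: subst_mult)

lemma subst_power: "subst h (f ^ n) = subst h f ^ n"
  by (induction n) (simp_all add: subst_mult)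

lemma subst_var [simp]: "subst h (var x) = h x"
  by (simp add: var_def subst_mono)

lemma mono_poly_prod:
  "(mono_poly u :: ('v, 'k::field) mpoly) = (\<Prod>x\<in>Poly_Mapping.keys u. var x ^ Poly_Mapping.lookup u x)"
proof -
  have pow: "var x ^ k = (mono_poly (Poly_Mapping.single x k) :: ('v, 'k) mpoly)" for x :: 'v and k
    by (induction k) (simp_all add: var_def mono_poly_mult[symmetric] single_add[symmetric])
  have "mono_poly (\<Sum>x\<in>A. f x) = (\<Prod>x\<in>A. mono_poly (f x) :: ('v, 'k) mpoly)"
    for A :: "'v set" and f :: "'v \<Rightarrow> 'v mon"
    by (induction A rule: infinite_finite_induct) (simp_all add: mono_poly_mult)
  then show ?thesis
    unfolding pow using sum_single_keys[of u] by metis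
qed

lemma subst_subst: "subst g (subst h f) = subst (\<lambda>x. subst g (h x)) f"
  by (induction f rule: poly_induct)
    (simp_all add: subst_mult subst_add subst_mono mon_subst_def subst_prod subst_power)

lemma mon_subst_var: "mon_subst var u = mono_poly u"
  unfolding mon_subst_def mono_poly_prod ..

lemma subst_var_id [simp]: "subst var f = f"
  by (induction f rule: poly_induct) (simp_all add: subst_mult subst_add subst_mono mon_subst_var)

lemma mon_subst_eq_zero:
  assumes "x \<in> Poly_Mapping.keys u" "h x = 0" shows "mon_subst h u = 0"
  unfolding mon_subst_def using assms by (intro prod_zero bexI[of _ x]) (auto simp: in_keys_iff zero_power)

lemma subst_eq_zero:
  assumes "\<And>u. u \<in> Poly_Mapping.keys f \<Longrightarrow> \<exists>x\<in>Poly_Mapping.keys u. h x = 0"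
  shows "subst h f = 0"
  unfolding subst_def using assms mon_subst_eq_zero by (intro sum.neutral) fastforce

lemma subst_cong:
  assumes "\<And>u x. u \<in> Poly_Mapping.keys f \<Longrightarrow> x \<in> Poly_Mapping.keys u \<Longrightarrow> h x = g x"
  shows "subst h f = subst g f"
  unfolding subst_def mon_subst_def using assms by (intro sum.cong refl arg_cong2[of _ _ _ _ "(*)"] prod.cong) auto

section \<open>Face ideals, and regularity on quotients of ideals\<close>

section \<open>Monomial ideals of subcomplexes and regular sequences\<close>

definition polys :: "'v set \<Rightarrow> ('v, 'k::field) mpoly set" where
  "polys V = {p. \<forall>u\<in>Poly_Mapping.keys p. Poly_Mapping.keys u \<subseteq> V}"

text \<open>A single notation for all modules of the proof: for D empty it is the whole ring, for
  the complex its Stanley-Reisner ideal, and for the boundary the ideal of interior faces and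
  nonfaces. Enlarging D along a shelling filters one by the other.\<close>

definition nonface_polys :: "'v set \<Rightarrow> 'v set set \<Rightarrow> ('v, 'k::field) mpoly set" where
  "nonface_polys V D = {p \<in> polys V. \<forall>u\<in>Poly_Mapping.keys p. Poly_Mapping.keys u \<notin> D}"

definition down_closed :: "'v set set \<Rightarrow> bool" where
  "down_closed D \<longleftrightarrow> (\<forall>\<tau>\<in>D. \<forall>\<sigma>. \<sigma> \<subseteq> \<tau> \<longrightarrow> \<sigma> \<in> D)"

lemma down_closedD: "down_closed D \<Longrightarrow> \<tau> \<in> D \<Longrightarrow> \<sigma> \<subseteq> \<tau> \<Longrightarrow> \<sigma> \<in> D"
  unfolding down_closed_def by blast

definition indicator_mon :: "'v set \<Rightarrow> 'v mon" where
  "indicator_mon \<sigma> = (\<Sum>x\<in>\<sigma>. Poly_Mapping.single x 1)"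

lemma lookup_indicator_mon: "finite \<sigma> \<Longrightarrow> Poly_Mapping.lookup (indicator_mon \<sigma>) x = of_bool (x \<in> \<sigma>)"
  by (simp add: indicator_mon_def lookup_sum lookup_single when_def)

lemma keys_indicator_mon [simp]: "finite \<sigma> \<Longrightarrow> Poly_Mapping.keys (indicator_mon \<sigma>) = \<sigma>"
  by (auto simp: in_keys_iff lookup_indicator_mon)

lemma mon_deg_indicator_mon [simp]: "finite \<sigma> \<Longrightarrow> mon_deg (indicator_mon \<sigma>) = card \<sigma>"
  by (simp add: mon_deg_def lookup_indicator_mon)

lemma prod_var: "(\<Prod>x\<in>\<sigma>. var x) = (mono_poly (indicator_mon \<sigma>) :: ('v, 'k::field) mpoly)"
  unfolding indicator_mon_def
  by (induction \<sigma> rule: infinite_finite_induct) (simp_all add: var_def mono_poly_mult)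

lemma indicator_mon_insert:
  "finite \<sigma> \<Longrightarrow> x \<notin> \<sigma> \<Longrightarrow> indicator_mon (insert x \<sigma>) = Poly_Mapping.single x 1 + indicator_mon \<sigma>"
  by (simp add: indicator_mon_def)

lemma indicator_mon_Un:
  "finite \<sigma> \<Longrightarrow> finite \<tau> \<Longrightarrow> \<sigma> \<inter> \<tau> = {} \<Longrightarrow> indicator_mon (\<sigma> \<union> \<tau>) = indicator_mon \<sigma> + indicator_mon \<tau>"
  by (simp add: indicator_mon_def sum.union_disjoint)

lemma mon_split:
  assumes "\<And>x. x \<in> \<sigma> \<Longrightarrow> Poly_Mapping.lookup u x \<noteq> 0" "finite \<sigma>"
  obtains w where "u = indicator_mon \<sigma> + w" "Poly_Mapping.keys w \<subseteq> Poly_Mapping.keys u"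
proof
  show "u = indicator_mon \<sigma> + (u - indicator_mon \<sigma>)"
    using assms by (intro poly_mapping_eqI) (auto simp: lookup_add lookup_minus lookup_indicator_mon)
  show "Poly_Mapping.keys (u - indicator_mon \<sigma>) \<subseteq> Poly_Mapping.keys u"
    using assms(2) by (auto simp: in_keys_iff lookup_minus lookup_indicator_mon)
qed

lemma polys_zero [simp]: "0 \<in> polys V"
  and polys_one [simp]: "1 \<in> polys V"
  and polys_const [simp]: "const c \<in> polys V"
  and polys_mono: "Poly_Mapping.keys u \<subseteq> V \<Longrightarrow> mono_poly u \<in> polys V"
  by (simp_all add: polys_def)

lemma polys_add: "p \<in> polys V \<Longrightarrow> q \<in> polys V \<Longrightarrow> p + q \<in> polys V"
  unfolding polys_def using keys_add[of p q] by blast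

lemma polys_uminus: "p \<in> polys V \<Longrightarrow> - p \<in> polys V"
  unfolding polys_def by (simp add: in_keys_iff)

lemma polys_diff: "p \<in> polys V \<Longrightarrow> q \<in> polys V \<Longrightarrow> p - q \<in> polys V"
  using polys_add[of p V "- q"] polys_uminus[of q V] by simp

lemma polys_mult: "p \<in> polys V \<Longrightarrow> q \<in> polys V \<Longrightarrow> p * q \<in> polys V"
  unfolding polys_def using keys_mult[of p q] by (fastforce simp: keys_mon_add)

lemma polys_var: "x \<in> V \<Longrightarrow> var x \<in> polys V"
  unfolding var_def by (rule polys_mono) simp

lemma polys_sum: "(\<And>x. x \<in> A \<Longrightarrow> f x \<in> polys V) \<Longrightarrow> sum f A \<in> polys V"
  by (induction A rule: infinite_finite_induct) (simp_all add: polys_add)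

lemma polys_prod: "(\<And>x. x \<in> A \<Longrightarrow> f x \<in> polys V) \<Longrightarrow> prod f A \<in> polys V"
  by (induction A rule: infinite_finite_induct) (simp_all add: polys_mult)

lemma polys_power: "p \<in> polys V \<Longrightarrow> p ^ k \<in> polys V"
  by (induction k) (simp_all add: polys_mult)

lemma polys_subset: "W \<subseteq> V \<Longrightarrow> polys W \<subseteq> polys V"
  unfolding polys_def by blast

lemma polys_subst:
  assumes "\<And>x. h x \<in> polys V" shows "subst h f \<in> polys V"
  unfolding subst_def mon_subst_def
  by (intro polys_sum polys_mult polys_const polys_prod polys_power assms)

lemma nonface_polys_subset: "nonface_polys V D \<subseteq> polys V"
  unfolding nonface_polys_def by blast

lemma nonface_polys_empty [simp]: "nonface_polys V {} = polys V"
  unfolding nonface_polys_def by simp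

lemma nonface_polys_antimono: "D \<subseteq> D' \<Longrightarrow> nonface_polys V D' \<subseteq> nonface_polys V D"
  unfolding nonface_polys_def by blast

lemma nonface_polys_zero [simp]: "0 \<in> nonface_polys V D"
  unfolding nonface_polys_def by simp

lemma nonface_polys_add:
  "p \<in> nonface_polys V D \<Longrightarrow> q \<in> nonface_polys V D \<Longrightarrow> p + q \<in> nonface_polys V D"
  unfolding nonface_polys_def using keys_add[of p q] by (auto intro: polys_add)

lemma nonface_polys_uminus: "p \<in> nonface_polys V D \<Longrightarrow> - p \<in> nonface_polys V D"
  unfolding nonface_polys_def using polys_uminus[of p V] by (simp add: in_keys_iff)

lemma nonface_polys_diff:
  "p \<in> nonface_polys V D \<Longrightarrow> q \<in> nonface_polys V D \<Longrightarrow> p - q \<in> nonface_polys V D"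
  using nonface_polys_add[of p V D "- q"] nonface_polys_uminus[of q V D] by simp

lemma nonface_polys_sum: "(\<And>x. x \<in> A \<Longrightarrow> f x \<in> nonface_polys V D) \<Longrightarrow> sum f A \<in> nonface_polys V D"
  by (induction A rule: infinite_finite_induct) (simp_all add: nonface_polys_add)

lemma nonface_polys_mult:
  assumes "down_closed D" "p \<in> polys V" "q \<in> nonface_polys V D" shows "p * q \<in> nonface_polys V D"
proof -
  have "Poly_Mapping.keys w \<notin> D" if "w \<in> Poly_Mapping.keys (p * q)" for w
  proof
    assume w: "Poly_Mapping.keys w \<in> D"
    have "w \<in> {a + b |a b. a \<in> Poly_Mapping.keys p \<and> b \<in> Poly_Mapping.keys q}"
      using that keys_mult by (rule rev_subsetD)
    then obtain u v where "w = u + v" "v \<in> Poly_Mapping.keys q" by blast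
    then show False
      using w assms(3) down_closedD[OF assms(1) w, of "Poly_Mapping.keys v"]
      unfolding nonface_polys_def by (auto simp: keys_mon_add)
  qed
  then show ?thesis
    using assms polys_mult[of p V q] nonface_polys_subset unfolding nonface_polys_def by blast
qed

lemma nonface_polys_mono_mult:
  assumes "Poly_Mapping.keys w \<subseteq> V" "q \<in> polys V"
    and "\<And>\<tau>. Poly_Mapping.keys w \<subseteq> \<tau> \<Longrightarrow> \<tau> \<notin> D"
  shows "mono_poly w * q \<in> nonface_polys V D"
  using polys_mult[OF polys_mono[OF assms(1)] assms(2)] assms(3)
  unfolding nonface_polys_def by (auto simp: keys_mono_mult keys_mon_add)

definition combinations :: "(nat \<Rightarrow> ('v, 'k::field) mpoly) \<Rightarrow> nat \<Rightarrow> ('v, 'k) mpoly set \<Rightarrow> ('v, 'k) mpoly set" where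
  "combinations \<theta> k N = {(\<Sum>l<k. \<theta> l * h l) |h. \<forall>l. h l \<in> N}"

lemma combinationsI: "(\<And>l. h l \<in> N) \<Longrightarrow> (\<Sum>l<k. \<theta> l * h l) \<in> combinations \<theta> k N"
  unfolding combinations_def by blast

lemma combinationsE:
  assumes "s \<in> combinations \<theta> k N"
  obtains h where "\<And>l. h l \<in> N" "s = (\<Sum>l<k. \<theta> l * h l)"
  using assms unfolding combinations_def by blast

lemma combinations_zero: "0 \<in> N \<Longrightarrow> 0 \<in> combinations \<theta> k N"
  using combinationsI[of "\<lambda>_. 0" N \<theta> k] by simp

lemma combinations_add:
  assumes "\<And>p q. p \<in> N \<Longrightarrow> q \<in> N \<Longrightarrow> p + q \<in> N"
    and "s \<in> combinations \<theta> k N" "s' \<in> combinations \<theta> k N"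
  shows "s + s' \<in> combinations \<theta> k N"
proof -
  obtain h h' where "\<And>l. h l \<in> N" "s = (\<Sum>l<k. \<theta> l * h l)"
    and "\<And>l. h' l \<in> N" "s' = (\<Sum>l<k. \<theta> l * h' l)"
    using assms(2,3) by (elim combinationsE) blast
  then show ?thesis
    using combinationsI[of "\<lambda>l. h l + h' l" N \<theta> k] assms(1) by (simp add: distrib_left sum.distrib)
qed

lemma combinations_mult:
  assumes "\<And>p. p \<in> N \<Longrightarrow> c * p \<in> N'" "s \<in> combinations \<theta> k N"
  shows "c * s \<in> combinations \<theta> k N'"
proof -
  obtain h where "\<And>l. h l \<in> N" "s = (\<Sum>l<k. \<theta> l * h l)" using assms(2) by (rule combinationsE) blast
  then show ?thesis
    using combinationsI[of "\<lambda>l. c * h l" N' \<theta> k] assms(1) by (simp add: sum_distrib_left mult_ac)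
qed

lemma combinations_mono: "N \<subseteq> N' \<Longrightarrow> combinations \<theta> k N \<subseteq> combinations \<theta> k N'"
  unfolding combinations_def by blast

lemma combinations_Suc:
  assumes "s \<in> combinations \<theta> k N" "h \<in> N" shows "s + \<theta> k * h \<in> combinations \<theta> (Suc k) N"
proof -
  obtain g where g: "\<And>l. g l \<in> N" "s = (\<Sum>l<k. \<theta> l * g l)" using assms(1) by (rule combinationsE) blast
  have "(\<Sum>l<Suc k. \<theta> l * (if l = k then h else g l)) \<in> combinations \<theta> (Suc k) N"
    using g assms(2) by (intro combinationsI) simp
  then show ?thesis using g by simp
qed

text \<open>\<open>\<theta> 0, \<dots>, \<theta> (d - 1)\<close> is a regular sequence on the module \<open>N / N'\<close>.\<close>

definition regular_on :: "(nat \<Rightarrow> ('v, 'k::field) mpoly) \<Rightarrow> nat \<Rightarrow> ('v, 'k) mpoly set \<Rightarrow> ('v, 'k) mpoly set \<Rightarrow> bool" where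
  "regular_on \<theta> d N N' \<longleftrightarrow> (\<forall>k<d. \<forall>f\<in>N. (\<exists>s\<in>combinations \<theta> k N. \<theta> k * f - s \<in> N') \<longrightarrow>
     (\<exists>s\<in>combinations \<theta> k N. f - s \<in> N'))"

locale ideal_chain =
  fixes V :: "'v set" and \<theta> :: "nat \<Rightarrow> ('v, 'k::field) mpoly" and N N' :: "('v, 'k) mpoly set"
  assumes \<theta>: "\<And>l. \<theta> l \<in> polys V" and sub: "N' \<subseteq> N"
    and zero: "0 \<in> N'"
    and add: "\<And>p q. p \<in> N \<Longrightarrow> q \<in> N \<Longrightarrow> p + q \<in> N" "\<And>p q. p \<in> N' \<Longrightarrow> q \<in> N' \<Longrightarrow> p + q \<in> N'"
    and mult: "\<And>c p. c \<in> polys V \<Longrightarrow> p \<in> N \<Longrightarrow> c * p \<in> N" "\<And>c p. c \<in> polys V \<Longrightarrow> p \<in> N' \<Longrightarrow> c * p \<in> N'"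
begin

lemma uminus: "p \<in> N \<Longrightarrow> - p \<in> N" "p \<in> N' \<Longrightarrow> - p \<in> N'"
  using mult[of "- 1" p] polys_uminus[OF polys_one, of V] by simp_all

lemma diff: "p \<in> N \<Longrightarrow> q \<in> N \<Longrightarrow> p - q \<in> N" "p \<in> N' \<Longrightarrow> q \<in> N' \<Longrightarrow> p - q \<in> N'"
  using add[of p "- q"] uminus[of q] by simp_all

text \<open>A vanishing of Tor for N / N'. If a combination lies in N', regularity rewrites its last
  coefficient, modulo N', as a combination of the earlier forms; these terms are absorbed there, and
  the induction continues with one form fewer.\<close>

lemma combinations_Int:
  assumes "regular_on \<theta> d N N'" "k \<le> d"
  shows "s \<in> combinations \<theta> k N \<Longrightarrow> s \<in> N' \<Longrightarrow> s \<in> combinations \<theta> k N'"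
  using assms(2)
proof (induction k arbitrary: s)
  case 0
  then show ?case by (auto simp: combinations_def)
next
  case (Suc k)
  obtain h where h: "\<And>l. h l \<in> N" "s = (\<Sum>l<Suc k. \<theta> l * h l)" using Suc.prems(1) by (rule combinationsE) blast
  define r where "r = (\<Sum>l<k. \<theta> l * h l)"
  have r: "r \<in> combinations \<theta> k N" unfolding r_def using h by (intro combinationsI)
  have "- r \<in> combinations \<theta> k N" using combinations_mult[OF _ r, of "-1" N] uminus by simp
  moreover have "\<theta> k * h k - (- r) \<in> N'" using Suc.prems(2) h(2) by (simp add: r_def add.commute)
  ultimately obtain g where g: "g \<in> combinations \<theta> k N" "h k - g \<in> N'"
    using assms(1) Suc.prems(3) h(1) unfolding regular_on_def by (metis Suc_le_eq)
  have "\<theta> k * g \<in> combinations \<theta> k N"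
    using combinations_mult[OF _ g(1), of "\<theta> k" N] mult \<theta> by blast
  then have "r + \<theta> k * g \<in> combinations \<theta> k N" by (intro combinations_add[OF add(1) r])
  moreover have "r + \<theta> k * g = s - \<theta> k * (h k - g)" using h(2) by (simp add: r_def right_diff_distrib)
  then have "r + \<theta> k * g \<in> N'" using Suc.prems(2) g(2) mult \<theta> diff by metis
  ultimately have "r + \<theta> k * g \<in> combinations \<theta> k N'" using Suc by simp
  from combinations_Suc[OF this g(2)] show ?case using h(2) by (simp add: r_def right_diff_distrib)
qed

text \<open>Regularity on N / N' corrects f into N', with an error x that is a combination and lies
  in N'. By \<open>combinations_Int\<close> its coefficients can be taken from N', and regularity on
  N' / N'' applies.\<close>

lemma regular_on_trans:
  assumes "regular_on \<theta> d N N'" "regular_on \<theta> d N' N''" "N'' \<subseteq> N'"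
  shows "regular_on \<theta> d N N''"
  unfolding regular_on_def
proof (intro allI ballI impI)
  fix k f assume k: "k < d" and f: "f \<in> N" and "\<exists>s\<in>combinations \<theta> k N. \<theta> k * f - s \<in> N''"
  then obtain s where s: "s \<in> combinations \<theta> k N" "\<theta> k * f - s \<in> N''" by blast
  then obtain r where r: "r \<in> combinations \<theta> k N" "f - r \<in> N'"
    using assms(1,3) k f unfolding regular_on_def by blast
  define x where "x = s - \<theta> k * r"
  have "- \<theta> k * r \<in> combinations \<theta> k N"
    by (rule combinations_mult[OF _ r(1)]) (use mult \<theta> polys_uminus in blast)
  then have "x \<in> combinations \<theta> k N"
    using combinations_add[OF add(1) s(1)] unfolding x_def by fastforce
  moreover have x: "x = \<theta> k * (f - r) - (\<theta> k * f - s)" by (simp add: x_def right_diff_distrib)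
  have "\<theta> k * f - s \<in> N'" using s(2) assms(3) by blast
  then have "x \<in> N'" unfolding x by (rule diff(2)[OF mult(2)[OF \<theta> r(2)]])
  ultimately have "x \<in> combinations \<theta> k N'" using combinations_Int[OF assms(1)] k by simp
  moreover have "\<theta> k * (f - r) - x \<in> N''" using s(2) by (simp add: x)
  ultimately obtain y where y: "y \<in> combinations \<theta> k N'" "f - r - y \<in> N''"
    using assms(2) k r(2) unfolding regular_on_def by blast
  then have "r + y \<in> combinations \<theta> k N"
    using combinations_add[OF add(1) r(1)] combinations_mono[OF sub] by blast
  then show "\<exists>s\<in>combinations \<theta> k N. f - s \<in> N''"
    using y(2) by (metis diff_diff_eq)
qed

end

lemma ideal_chain_nonface_polys:
  assumes "\<And>l. \<theta> l \<in> polys V" "D \<subseteq> D'" "down_closed D" "down_closed D'"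
  shows "ideal_chain V \<theta> (nonface_polys V D) (nonface_polys V D')"
proof unfold_locales
  show "nonface_polys V D' \<subseteq> nonface_polys V D" by (rule nonface_polys_antimono) (fact assms)
qed (simp_all add: assms nonface_polys_add nonface_polys_mult)

lemma in_variable_ideal:
  fixes g :: "(nat, 'k::field) mpoly"
  assumes "\<And>u. u \<in> Poly_Mapping.keys g \<Longrightarrow> \<exists>l<k. Poly_Mapping.lookup u l \<noteq> 0"
  obtains p where "g = (\<Sum>l<k. var l * p l)"
proof -
  have "\<exists>p. g = (\<Sum>l<k. var l * p l)"
  proof (induction g rule: poly_induct)
    case zero
    show ?case by (rule exI[of _ "\<lambda>_. 0"]) simp
  next
    case (single u c)
    then obtain l where l: "l < k" "Poly_Mapping.lookup u l \<noteq> 0" using assms by blast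
    then obtain w where "u = indicator_mon {l} + w" using mon_split[of "{l}" u] by auto
    then have "const c * mono_poly u = (var l * (const c * mono_poly w) :: (nat, 'k) mpoly)"
      by (simp add: mono_poly_mult var_def indicator_mon_def mult_ac)
    also have "\<dots> = (\<Sum>i<k. if i = l then var l * (const c * mono_poly w) else 0)" using l by simp
    also have "\<dots> = (\<Sum>i<k. var i * (if i = l then const c * mono_poly w else 0))"
      by (intro sum.cong) auto
    finally show ?case by (rule exI[of _ "\<lambda>i. if i = l then const c * mono_poly w else 0"])
  next
    case (add p q)
    then obtain a b where "p = (\<Sum>l<k. var l * a l)" "q = (\<Sum>l<k. var l * b l)" by blast
    then have "p + q = (\<Sum>l<k. var l * (a l + b l))" by (simp add: distrib_left sum.distrib)
    then show ?case by (rule exI[of _ "\<lambda>l. a l + b l"])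
  qed
  then show ?thesis using that by blast
qed

lemma variables_regular:
  fixes g :: "(nat, 'k::field) mpoly"
  assumes eq: "var k * g = (\<Sum>l<k. var l * h l)"
  obtains p where "g = (\<Sum>l<k. var l * p l)"
proof (rule in_variable_ideal)
  fix u assume "u \<in> Poly_Mapping.keys g"
  then have "Poly_Mapping.single k 1 + u \<in> Poly_Mapping.keys (\<Sum>l<k. var l * h l)"
    unfolding eq[symmetric] by (simp add: var_def keys_mono_mult)
  then obtain l where l: "l < k" "Poly_Mapping.single k 1 + u \<in> Poly_Mapping.keys (var l * h l)"
    using keys_sum[of "\<lambda>l. var l * h l" "{..<k}"] by blast
  then obtain w where "Poly_Mapping.single k 1 + u = Poly_Mapping.single l 1 + w"
    by (auto simp: var_def keys_mono_mult)
  then have "Poly_Mapping.lookup (Poly_Mapping.single k 1 + u) l \<noteq> 0" by (simp add: lookup_add)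
  then show "\<exists>l<k. Poly_Mapping.lookup u l \<noteq> 0"
    using l(1) by (auto simp: lookup_add lookup_single)
qed

section \<open>Linear forms as coordinates, and one step of the filtration\<close>

lemma const_sum: "const (\<Sum>x\<in>A. f x) = (\<Sum>x\<in>A. const (f x) :: ('w, 'k::field) mpoly)"
  by (induction A rule: infinite_finite_induct) (simp_all add: single_add)

lemma const_mult: "const (a * c) = (const a * const c :: ('w, 'k::field) mpoly)"
  by (simp add: mult_single)

definition linear_form :: "'v set \<Rightarrow> ('v \<Rightarrow> 'k) \<Rightarrow> ('v, 'k::field) mpoly" where
  "linear_form V t = (\<Sum>v\<in>V. const (t v) * var v)"

lemma polys_linear_form: "W \<subseteq> V \<Longrightarrow> linear_form W t \<in> polys V"
  unfolding linear_form_def by (intro polys_sum polys_mult polys_const polys_var) auto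

definition dual_bases :: "(nat \<Rightarrow> 'v \<Rightarrow> 'k::field) \<Rightarrow> nat \<Rightarrow> 'v set \<Rightarrow> (nat \<Rightarrow> 'v \<Rightarrow> 'k) \<Rightarrow> bool" where
  "dual_bases t d F b \<longleftrightarrow>
     (\<forall>k<d. \<forall>l<d. (\<Sum>v\<in>F. b k v * t l v) = of_bool (k = l)) \<and>
     (\<forall>v\<in>F. \<forall>w\<in>F. (\<Sum>k<d. t k w * b k v) = of_bool (v = w))"

text \<open>Modulo \<open>nonface_polys V (D \<union> [\<rho>, F])\<close>, the module \<open>nonface_polys V D\<close> is
  the monomial of \<open>\<rho>\<close> times the polynomial ring on \<open>F\<close>, on which the linear forms with
  coefficients \<open>t\<close> are a system of coordinates.\<close>

locale interval_step =
  fixes V F \<rho> :: "'v set" and D D' :: "'v set set" and t b :: "nat \<Rightarrow> 'v \<Rightarrow> 'k::field" and d :: nat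
    and \<theta> :: "nat \<Rightarrow> ('v, 'k) mpoly"
  assumes V: "finite V" "F \<subseteq> V" and \<rho>: "\<rho> \<subseteq> F" "\<rho> \<notin> D" and D: "down_closed D"
    and D': "D' = D \<union> {\<tau>. \<rho> \<subseteq> \<tau> \<and> \<tau> \<subseteq> F}" and dual: "dual_bases t d F b"
    and \<theta>: "\<And>k. \<theta> k = linear_form V (t k)"
begin

lemma finF: "finite F" and fin\<rho>: "finite \<rho>"
  using V \<rho> finite_subset by metis+

abbreviation (input) "m\<rho> \<equiv> mono_poly (indicator_mon \<rho>) :: ('v, 'k) mpoly"

text \<open>The change of basis inverse to the forms, as a ring homomorphism that kills the
  variables outside F. It sends \<open>\<theta> l\<close> to the l-th variable for l < d, so that
  questions about the forms become questions about variables.\<close>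

definition to_coords :: "('v, 'k) mpoly \<Rightarrow> (nat, 'k) mpoly" where
  "to_coords = subst (\<lambda>x. if x \<in> F then (\<Sum>k<d. const (b k x) * var k) else 0)"

definition of_coords :: "(nat, 'k) mpoly \<Rightarrow> ('v, 'k) mpoly" where
  "of_coords = subst (\<lambda>k. if k < d then linear_form F (t k) else 0)"

lemma of_coords_polys: "of_coords p \<in> polys F"
  unfolding of_coords_def by (intro polys_subst) (simp add: polys_linear_form)

lemma of_to_coords:
  assumes "q \<in> polys F" shows "of_coords (to_coords q) = q"
proof -
  have "of_coords (to_coords q) = subst var q" unfolding of_coords_def to_coords_def subst_subst
  proof (rule subst_cong)
    fix u x assume "u \<in> Poly_Mapping.keys q" "x \<in> Poly_Mapping.keys u"
    then have x: "x \<in> F" using assms unfolding polys_def by blast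
    have "(\<Sum>k<d. const (b k x) * linear_form F (t k)) =
        (\<Sum>w\<in>F. const (\<Sum>k<d. t k w * b k x) * var w)"
      unfolding linear_form_def const_sum sum_distrib_left sum_distrib_right const_mult
      by (subst sum.swap) (simp only: mult_ac)
    also have "\<dots> = (\<Sum>w\<in>F. if x = w then var w else 0)"
      using dual x unfolding dual_bases_def by (intro sum.cong) (auto simp: of_bool_def)
    also have "\<dots> = var x" using x finF by simp
    finally show "subst (\<lambda>k. if k < d then linear_form F (t k) else 0)
        (if x \<in> F then \<Sum>k<d. const (b k x) * var k else 0) = var x"
      using x by (simp add: subst_setsum subst_mult)
  qed
  then show ?thesis by simp
qed

lemma to_coords_theta:
  assumes "l < d" shows "to_coords (\<theta> l) = var l"
proof -
  have "to_coords (\<theta> l) = (\<Sum>v\<in>V. const (t l v) * (if v \<in> F then (\<Sum>k<d. const (b k v) * var k) else 0))"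
    unfolding to_coords_def \<theta> linear_form_def by (simp add: subst_setsum subst_mult)
  also have "\<dots> = (\<Sum>v\<in>F. const (t l v) * (\<Sum>k<d. const (b k v) * var k))"
    using V by (intro sum.mono_neutral_cong_right) auto
  also have "\<dots> = (\<Sum>k<d. const (\<Sum>v\<in>F. b k v * t l v) * var k)"
    unfolding const_sum sum_distrib_left sum_distrib_right const_mult
    by (subst sum.swap) (simp only: mult_ac)
  also have "\<dots> = (\<Sum>k<d. if k = l then var k else 0)"
    using dual assms unfolding dual_bases_def by (intro sum.cong) (auto simp: of_bool_def)
  also have "\<dots> = var l" using assms by simp
  finally show ?thesis .
qed

lemma decompose:
  assumes "f \<in> nonface_polys V D"
  obtains q where "q \<in> polys F" "f - m\<rho> * q \<in> nonface_polys V D'"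
proof -
  have "\<exists>q\<in>polys F. f - m\<rho> * q \<in> nonface_polys V D'"
  proof (induction f rule: poly_induct)
    case zero
    show ?case by (rule bexI[of _ 0]) auto
  next
    case (single u c)
    then have u: "Poly_Mapping.keys u \<subseteq> V" "Poly_Mapping.keys u \<notin> D"
      using assms unfolding nonface_polys_def polys_def by auto
    show ?case
    proof (cases "\<rho> \<subseteq> Poly_Mapping.keys u \<and> Poly_Mapping.keys u \<subseteq> F")
      case True
      then obtain w where w: "u = indicator_mon \<rho> + w" "Poly_Mapping.keys w \<subseteq> Poly_Mapping.keys u"
        using mon_split[of \<rho> u] fin\<rho> by (metis in_keys_iff subsetD)
      have "const c * mono_poly u - m\<rho> * (const c * mono_poly w) = 0"
        unfolding w(1) mono_poly_mult by (simp add: mult_ac)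
      moreover have "const c * mono_poly w \<in> polys F"
        using w True by (intro polys_mult polys_const polys_mono) auto
      ultimately show ?thesis by (metis nonface_polys_zero)
    next
      case False
      have "Poly_Mapping.keys (const c * mono_poly u) \<subseteq> {u}" using keys_mult_const[of c "mono_poly u"] by simp
      then have "const c * mono_poly u \<in> nonface_polys V D'"
        using u False unfolding nonface_polys_def polys_def D' by auto
      then show ?thesis by (intro bexI[of _ 0]) auto
    qed
  next
    case (add p q)
    then obtain p' q' where "p' \<in> polys F" "p - m\<rho> * p' \<in> nonface_polys V D'"
      "q' \<in> polys F" "q - m\<rho> * q' \<in> nonface_polys V D'" by blast
    moreover have "p + q - m\<rho> * (p' + q') = (p - m\<rho> * p') + (q - m\<rho> * q')" by (simp add: algebra_simps)
    ultimately show ?case using polys_add nonface_polys_add by metis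
  qed
  then show ?thesis using that by blast
qed

lemma mono_in: "q \<in> polys V \<Longrightarrow> m\<rho> * q \<in> nonface_polys V D"
  using V \<rho> fin\<rho> down_closedD[OF D] by (intro nonface_polys_mono_mult) auto

text \<open>A form \<open>\<theta> l\<close> differs from its part on F by variables outside F, and
  these turn the monomial of \<rho> into a monomial whose support is not in D'. Hence identities in
  the coordinates of F lift to the module.\<close>

lemma lift_combination:
  assumes "q \<in> polys F" "to_coords q = const c + (\<Sum>l<k. var l * p l)" "k \<le> d"
  obtains s where "s \<in> combinations \<theta> k (nonface_polys V D)"
    and "m\<rho> * q - const c * m\<rho> - s \<in> nonface_polys V D'"
proof
  define r where "r l = m\<rho> * of_coords (p l)" for l
  have rV: "of_coords (p l) \<in> polys V" for l using of_coords_polys polys_subset[OF V(2)] by blast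
  show "(\<Sum>l<k. \<theta> l * r l) \<in> combinations \<theta> k (nonface_polys V D)"
    unfolding r_def using rV by (intro combinationsI mono_in)
  have "q = const c + (\<Sum>l<k. linear_form F (t l) * of_coords (p l))"
    using of_to_coords[OF assms(1)] assms(3)
    unfolding assms(2) of_coords_def by (simp add: subst_add subst_setsum subst_mult)
  then have "m\<rho> * q - const c * m\<rho> - (\<Sum>l<k. \<theta> l * r l) =
      (\<Sum>l<k. (linear_form F (t l) - \<theta> l) * r l)"
    unfolding r_def by (simp add: distrib_left sum_distrib_left sum_subtractf[symmetric] algebra_simps)
  also have "\<dots> = (\<Sum>l<k. \<Sum>v\<in>V - F. mono_poly (Poly_Mapping.single v 1 + indicator_mon \<rho>) *
      (- const (t l v) * of_coords (p l)))"
  proof (intro sum.cong refl)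
    fix l
    have "\<theta> l = linear_form F (t l) + linear_form (V - F) (t l)"
      unfolding \<theta> linear_form_def using V by (simp add: sum.subset_diff add.commute)
    then show "(linear_form F (t l) - \<theta> l) * r l = (\<Sum>v\<in>V - F.
        mono_poly (Poly_Mapping.single v 1 + indicator_mon \<rho>) * (- const (t l v) * of_coords (p l)))"
      unfolding r_def linear_form_def mono_poly_mult var_def
      by (simp add: sum_distrib_right sum_distrib_left sum_negf mult_ac)
  qed
  also have "\<dots> \<in> nonface_polys V D'"
  proof (intro nonface_polys_sum nonface_polys_mono_mult)
    fix l v assume v: "v \<in> V - F"
    show "Poly_Mapping.keys (Poly_Mapping.single v 1 + indicator_mon \<rho>) \<subseteq> V"
      using v V \<rho> fin\<rho> by (auto simp: keys_mon_add)
    show "- const (t l v) * of_coords (p l) \<in> polys V" by (intro polys_mult polys_uminus polys_const rV)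
    fix \<tau> assume "Poly_Mapping.keys (Poly_Mapping.single v 1 + indicator_mon \<rho>) \<subseteq> \<tau>"
    then have "v \<in> \<tau>" "\<rho> \<subseteq> \<tau>" using fin\<rho> by (auto simp: keys_mon_add)
    then show "\<tau> \<notin> D'" using v \<rho> down_closedD[OF D] unfolding D' by blast
  qed
  finally show "m\<rho> * q - const c * m\<rho> - (\<Sum>l<k. \<theta> l * r l) \<in> nonface_polys V D'" .
qed

lemma theta_polys: "\<theta> k \<in> polys V"
  unfolding \<theta> by (rule polys_linear_form) simp

lemma combinations_decompose:
  assumes "s \<in> combinations \<theta> k (nonface_polys V D)" "down_closed D'"
  obtains h where "\<And>l. h l \<in> polys F" "s - m\<rho> * (\<Sum>l<k. \<theta> l * h l) \<in> nonface_polys V D'"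
proof -
  obtain g where g: "\<And>l. g l \<in> nonface_polys V D" "s = (\<Sum>l<k. \<theta> l * g l)"
    using assms(1) by (rule combinationsE) blast
  have "\<exists>q. q \<in> polys F \<and> g l - m\<rho> * q \<in> nonface_polys V D'" for l
    by (rule decompose[OF g(1)[of l]]) blast
  then obtain h where h: "\<And>l. h l \<in> polys F" "\<And>l. g l - m\<rho> * h l \<in> nonface_polys V D'" by metis
  have "s - m\<rho> * (\<Sum>l<k. \<theta> l * h l) = (\<Sum>l<k. \<theta> l * (g l - m\<rho> * h l))"
    unfolding g(2) by (simp add: sum_distrib_left sum_subtractf right_diff_distrib mult_ac)
  also have "\<dots> \<in> nonface_polys V D'"
    by (intro nonface_polys_sum nonface_polys_mult[OF assms(2) theta_polys] h)
  finally show ?thesis using that h(1) by blast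
qed

lemma regular_step:
  assumes "down_closed D'" shows "regular_on \<theta> d (nonface_polys V D) (nonface_polys V D')"
  unfolding regular_on_def
proof (intro allI ballI impI)
  fix k f assume k: "k < d" and f: "f \<in> nonface_polys V D"
    and "\<exists>s\<in>combinations \<theta> k (nonface_polys V D). \<theta> k * f - s \<in> nonface_polys V D'"
  then obtain s where s: "s \<in> combinations \<theta> k (nonface_polys V D)" "\<theta> k * f - s \<in> nonface_polys V D'"
    by blast
  obtain q where q: "q \<in> polys F" "f - m\<rho> * q \<in> nonface_polys V D'" using decompose[OF f] .
  obtain h where h: "\<And>l. h l \<in> polys F" "s - m\<rho> * (\<Sum>l<k. \<theta> l * h l) \<in> nonface_polys V D'"
    by (rule combinations_decompose[OF s(1) assms]) blast
  define p where "p = \<theta> k * q - (\<Sum>l<k. \<theta> l * h l)"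
  have FV: "polys F \<subseteq> (polys V :: ('v, 'k) mpoly set)" using V by (intro polys_subset)
  have pV: "p \<in> polys V" unfolding p_def using q h(1) FV
    by (intro polys_diff polys_mult polys_sum theta_polys) auto
  have "m\<rho> * p = (\<theta> k * f - s) - \<theta> k * (f - m\<rho> * q) + (s - m\<rho> * (\<Sum>l<k. \<theta> l * h l))"
    unfolding p_def by (simp add: algebra_simps)
  also have "\<dots> \<in> nonface_polys V D'"
    by (intro nonface_polys_add nonface_polys_diff nonface_polys_mult[OF assms theta_polys] s q h)
  finally have mp: "m\<rho> * p \<in> nonface_polys V D'" .
  \<comment> \<open>Each monomial of p has a variable outside F: otherwise its support together with
    \<rho> would lie in the interval and hence in D'.\<close>
  have "to_coords p = 0" unfolding to_coords_def
  proof (rule subst_eq_zero)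
    fix u assume "u \<in> Poly_Mapping.keys p"
    then have "indicator_mon \<rho> + u \<in> Poly_Mapping.keys (m\<rho> * p)" by (simp add: keys_mono_mult)
    then have "\<rho> \<union> Poly_Mapping.keys u \<notin> D'"
      using mp fin\<rho> unfolding nonface_polys_def by (auto simp: keys_mon_add)
    then have "\<not> Poly_Mapping.keys u \<subseteq> F" using \<rho> unfolding D' by auto
    then show "\<exists>x\<in>Poly_Mapping.keys u. (if x \<in> F then \<Sum>k<d. const (b k x) * var k else 0) = (0 :: (nat, 'k) mpoly)"
      by auto
  qed
  moreover have "to_coords p = to_coords (\<theta> k) * to_coords q - (\<Sum>l<k. to_coords (\<theta> l) * to_coords (h l))"
    unfolding p_def to_coords_def by (simp add: subst_diff subst_mult subst_setsum)
  ultimately have "var k * to_coords q = (\<Sum>l<k. var l * to_coords (h l))"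
    using k by (simp add: to_coords_theta)
  then obtain a where "to_coords q = (\<Sum>l<k. var l * a l)" by (rule variables_regular)
  then have "to_coords q = const 0 + (\<Sum>l<k. var l * a l)" by simp
  from lift_combination[OF q(1) this less_imp_le[OF k]] obtain s'
    where s': "s' \<in> combinations \<theta> k (nonface_polys V D)"
    "m\<rho> * q - const 0 * m\<rho> - s' \<in> nonface_polys V D'" by blast
  have "f - s' = (f - m\<rho> * q) + (m\<rho> * q - const 0 * m\<rho> - s')" by simp
  also have "\<dots> \<in> nonface_polys V D'" by (intro nonface_polys_add q s')
  finally show "\<exists>s\<in>combinations \<theta> k (nonface_polys V D). f - s \<in> nonface_polys V D'" using s'(1) by blast
qed

text \<open>In the coordinates of F, all of a polynomial but its constant term lies in the ideal of
  the variables, so one scalar multiple of the monomial of \<rho> is left.\<close>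

lemma span_step:
  assumes f: "f \<in> nonface_polys V D"
  obtains c s where "s \<in> combinations \<theta> d (nonface_polys V D)"
    "f - const c * m\<rho> - s \<in> nonface_polys V D'"
proof -
  obtain q where q: "q \<in> polys F" "f - m\<rho> * q \<in> nonface_polys V D'" using decompose[OF f] .
  define g where "g = to_coords q"
  define c where "c = Poly_Mapping.lookup g 0"
  have "g \<in> polys {..<d}" unfolding g_def to_coords_def
    by (intro polys_subst) (auto intro!: polys_sum polys_mult polys_var)
  then have gk: "Poly_Mapping.keys u \<subseteq> {..<d}" if "u \<in> Poly_Mapping.keys g" for u
    using that unfolding polys_def by blast
  have "\<exists>l<d. Poly_Mapping.lookup u l \<noteq> 0" if "u \<in> Poly_Mapping.keys (g - const c)" for u
  proof -
    have "u \<noteq> 0" using that by (auto simp: in_keys_iff lookup_minus c_def)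
    then have "u \<in> Poly_Mapping.keys g" using that by (auto simp: in_keys_iff lookup_minus lookup_single)
    moreover obtain l where "l \<in> Poly_Mapping.keys u" using \<open>u \<noteq> 0\<close> by (metis all_not_in_conv keys_eq_empty)
    ultimately show ?thesis using gk by (metis in_keys_iff lessThan_iff subsetD)
  qed
  then obtain p where "g - const c = (\<Sum>l<d. var l * p l)" by (rule in_variable_ideal)
  then have "to_coords q = const c + (\<Sum>l<d. var l * p l)" unfolding g_def by (simp add: algebra_simps)
  from lift_combination[OF q(1) this] obtain s where
    s: "s \<in> combinations \<theta> d (nonface_polys V D)" "m\<rho> * q - const c * m\<rho> - s \<in> nonface_polys V D'"
    by blast
  have "f - const c * m\<rho> - s = (f - m\<rho> * q) + (m\<rho> * q - const c * m\<rho> - s)" by simp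
  also have "\<dots> \<in> nonface_polys V D'" by (intro nonface_polys_add q s)
  finally show ?thesis using that s(1) by blast
qed

end

section \<open>Relative shellings and the filtrations that they induce\<close>

section \<open>Shellings\<close>

text \<open>A shelling that starts from the subcomplex \<open>D\<^sub>0\<close>. The values of
  \<kappa> are integers so that the reversed shelling can use negated weights. Ties are harmless: a
  facet of equal weight does not contain the restriction set of another one.\<close>

locale shelling =
  fixes V :: "'v set" and \<Delta> D\<^sub>0 Fs :: "'v set set" and \<rho> :: "'v set \<Rightarrow> 'v set" and \<kappa> :: "'v set \<Rightarrow> int"
  assumes finV: "finite V" and \<Delta>: "\<Delta> \<subseteq> Pow V" "down_closed \<Delta>"
    and D\<^sub>0: "D\<^sub>0 \<subseteq> \<Delta>" "down_closed D\<^sub>0" and Fs: "Fs \<subseteq> \<Delta>"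
    and \<rho>: "\<And>F. F \<in> Fs \<Longrightarrow> \<rho> F \<subseteq> F" "\<And>F. F \<in> Fs \<Longrightarrow> \<rho> F \<notin> D\<^sub>0"
    and less: "\<And>F G. F \<in> Fs \<Longrightarrow> G \<in> Fs \<Longrightarrow> \<rho> F \<subseteq> G \<Longrightarrow> F = G \<or> \<kappa> F < \<kappa> G"
    and cover: "\<And>\<tau>. \<tau> \<in> \<Delta> \<Longrightarrow> \<tau> \<notin> D\<^sub>0 \<Longrightarrow> \<exists>F\<in>Fs. \<rho> F \<subseteq> \<tau> \<and> \<tau> \<subseteq> F"
begin

lemma finite_Fs: "finite Fs"
  using Fs \<Delta>(1) finV by (meson finite_Pow_iff finite_subset)

definition generated :: "'v set set \<Rightarrow> 'v set set" where
  "generated \<G> = D\<^sub>0 \<union> {\<tau> \<in> \<Delta>. \<exists>F\<in>\<G>. \<tau> \<subseteq> F}"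

definition initial :: "'v set set \<Rightarrow> bool" where
  "initial \<G> \<longleftrightarrow> \<G> \<subseteq> Fs \<and> (\<forall>F\<in>\<G>. \<forall>G\<in>Fs. \<kappa> G < \<kappa> F \<longrightarrow> G \<in> \<G>)"

lemma generated_empty: "generated {} = D\<^sub>0"
  unfolding generated_def by simp

lemma generated_all: "generated Fs = \<Delta>"
  unfolding generated_def using D\<^sub>0(1) cover by blast

lemma down_closed_generated: "down_closed (generated \<G>)"
  unfolding down_closed_def generated_def
  using D\<^sub>0(2) \<Delta>(2) by (blast dest: down_closedD)

lemma generated_mono: "\<G> \<subseteq> \<H> \<Longrightarrow> generated \<G> \<subseteq> generated \<H>"
  unfolding generated_def by blast

text \<open>A facet F of largest weight is added last. No other facet present contains its
  restriction set, while a face of F outside the interval and outside \<open>D\<^sub>0\<close> lies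
  in the interval of a facet of smaller weight, which is already there.\<close>

lemma shelling_induct:
  assumes init: "initial \<G>" and base: "P D\<^sub>0"
    and step: "\<And>F \<H>. F \<in> Fs \<Longrightarrow> P (generated \<H>) \<Longrightarrow> \<rho> F \<notin> generated \<H> \<Longrightarrow>
      generated (insert F \<H>) = generated \<H> \<union> {\<tau>. \<rho> F \<subseteq> \<tau> \<and> \<tau> \<subseteq> F} \<Longrightarrow> P (generated (insert F \<H>))"
  shows "P (generated \<G>)"
proof -
  have "finite \<G>" using init finite_Fs unfolding initial_def by (blast intro: rev_finite_subset)
  then show ?thesis using init
  proof (induction "card \<G>" arbitrary: \<G>)
    case 0
    then show ?case using base by (simp add: generated_empty)
  next
    case (Suc n)
    then have ne: "\<G> \<noteq> {}" by auto
    have "Max (\<kappa> ` \<G>) \<in> \<kappa> ` \<G>" using Suc.prems(1) ne by simp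
    then obtain F where F0: "F \<in> \<G>" "\<kappa> F = Max (\<kappa> ` \<G>)" by auto
    then have F: "F \<in> \<G>" "\<And>G. G \<in> \<G> \<Longrightarrow> \<kappa> G \<le> \<kappa> F" using Suc.prems(1) by auto
    define \<H> where "\<H> = \<G> - {F}"
    have FF: "F \<in> Fs" and sub: "\<G> \<subseteq> Fs" using F Suc.prems unfolding initial_def by auto
    have init: "initial \<H>" using Suc.prems(2) F(2) unfolding \<H>_def initial_def
      by (auto simp: not_less[symmetric])
    have card: "n = card \<H>" "finite \<H>" using Suc F(1) unfolding \<H>_def by auto
    have out: "\<rho> F \<notin> generated \<H>"
    proof
      assume "\<rho> F \<in> generated \<H>"
      then obtain G where "G \<in> \<G>" "G \<noteq> F" "\<rho> F \<subseteq> G"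
        using \<rho>(2)[OF FF] unfolding generated_def \<H>_def by blast
      then show False using less[OF FF, of G] F(2)[of G] sub by auto
    qed
    have "generated (insert F \<H>) = generated \<H> \<union> {\<tau>. \<rho> F \<subseteq> \<tau> \<and> \<tau> \<subseteq> F}"
    proof (intro equalityI subsetI)
      fix \<tau> assume "\<tau> \<in> generated (insert F \<H>)"
      show "\<tau> \<in> generated \<H> \<union> {\<tau>. \<rho> F \<subseteq> \<tau> \<and> \<tau> \<subseteq> F}"
      proof (rule ccontr)
        assume *: "\<tau> \<notin> generated \<H> \<union> {\<tau>. \<rho> F \<subseteq> \<tau> \<and> \<tau> \<subseteq> F}"
        then have \<tau>: "\<tau> \<in> \<Delta>" "\<tau> \<notin> D\<^sub>0" "\<tau> \<subseteq> F"
          using \<open>\<tau> \<in> generated (insert F \<H>)\<close> unfolding generated_def by auto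
        then obtain G where G: "G \<in> Fs" "\<rho> G \<subseteq> \<tau>" "\<tau> \<subseteq> G" using cover by blast
        then have "G = F \<or> \<kappa> G < \<kappa> F" using less[OF G(1) FF] \<tau>(3) by blast
        then have "G \<in> \<H> \<or> G = F" using Suc.prems(2) F(1) G(1) unfolding initial_def \<H>_def by blast
        then show False using * \<tau> G unfolding generated_def by blast
      qed
    next
      fix \<tau> assume "\<tau> \<in> generated \<H> \<union> {\<tau>. \<rho> F \<subseteq> \<tau> \<and> \<tau> \<subseteq> F}"
      moreover have "\<tau> \<in> \<Delta>" if "\<tau> \<subseteq> F" using that FF Fs \<Delta>(2) down_closedD by blast
      ultimately show "\<tau> \<in> generated (insert F \<H>)" unfolding generated_def by blast
    qed
    from step[OF FF Suc.hyps(1)[OF card init] out this]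
    show ?case using F(1) unfolding \<H>_def by (simp add: insert_absorb)
  qed
qed

context
  fixes t :: "nat \<Rightarrow> 'v \<Rightarrow> 'k::field" and d :: nat and \<theta> :: "nat \<Rightarrow> ('v, 'k) mpoly"
  assumes dual: "\<And>F. F \<in> Fs \<Longrightarrow> \<exists>b. dual_bases t d F b"
    and \<theta>: "\<And>k. \<theta> k = linear_form V (t k)"
begin

lemma theta_polys': "\<theta> k \<in> polys V"
  unfolding \<theta> by (rule polys_linear_form) simp

lemma interval_step_generated:
  assumes "F \<in> Fs" "\<rho> F \<notin> generated \<H>"
    "generated (insert F \<H>) = generated \<H> \<union> {\<tau>. \<rho> F \<subseteq> \<tau> \<and> \<tau> \<subseteq> F}"
  obtains b where "interval_step V F (\<rho> F) (generated \<H>) (generated (insert F \<H>)) t b d \<theta>"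
proof -
  obtain b where b: "dual_bases t d F b" using dual[OF assms(1)] ..
  have "F \<subseteq> V" using assms(1) Fs \<Delta>(1) by blast
  then have "interval_step V F (\<rho> F) (generated \<H>) (generated (insert F \<H>)) t b d \<theta>"
    unfolding interval_step_def
    using finV \<rho>(1)[OF assms(1)] assms(2,3) down_closed_generated b \<theta> by blast
  then show ?thesis by (rule that)
qed

lemma regular_on_generated:
  assumes "initial \<G>"
  shows "regular_on \<theta> d (nonface_polys V D\<^sub>0) (nonface_polys V (generated \<G>))"
proof (rule shelling_induct[OF assms])
  show "regular_on \<theta> d (nonface_polys V D\<^sub>0) (nonface_polys V D\<^sub>0)"
    unfolding regular_on_def
  proof (intro allI ballI impI)
    fix k and f :: "('v, 'k) mpoly" assume "f \<in> nonface_polys V D\<^sub>0"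
    then show "\<exists>s\<in>combinations \<theta> k (nonface_polys V D\<^sub>0). f - s \<in> nonface_polys V D\<^sub>0"
      by (intro bexI[of _ 0] combinations_zero) simp_all
  qed
  fix F \<H> assume 1: "F \<in> Fs" and IH: "regular_on \<theta> d (nonface_polys V D\<^sub>0) (nonface_polys V (generated \<H>))"
    and 2: "\<rho> F \<notin> generated \<H>" "generated (insert F \<H>) = generated \<H> \<union> {\<tau>. \<rho> F \<subseteq> \<tau> \<and> \<tau> \<subseteq> F}"
  obtain b where "interval_step V F (\<rho> F) (generated \<H>) (generated (insert F \<H>)) t b d \<theta>"
    using interval_step_generated[OF 1 2] .
  then interpret interval_step V F "\<rho> F" "generated \<H>" "generated (insert F \<H>)" t b d \<theta> .
  have "D\<^sub>0 \<subseteq> generated \<H>" unfolding generated_def by simp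
  then interpret ideal_chain V \<theta> "nonface_polys V D\<^sub>0" "nonface_polys V (generated \<H>)"
    by (intro ideal_chain_nonface_polys theta_polys' D\<^sub>0(2) down_closed_generated)
  show "regular_on \<theta> d (nonface_polys V D\<^sub>0) (nonface_polys V (generated (insert F \<H>)))"
    by (rule regular_on_trans[OF IH regular_step[OF down_closed_generated]])
      (intro nonface_polys_antimono generated_mono, blast)
qed

text \<open>Each facet leaves a multiple of its restriction monomial. The coefficients of the
  combinations come from the ideals of the filtration, all of which are contained in the
  first.\<close>

lemma monomials_span:
  assumes "f \<in> nonface_polys V D\<^sub>0"
  obtains c s where "s \<in> combinations \<theta> d (nonface_polys V D\<^sub>0)"
    "f - (\<Sum>F\<in>Fs. const (c F) * mono_poly (indicator_mon (\<rho> F))) - s \<in> nonface_polys V \<Delta>"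
proof -
  let ?m = "\<lambda>c. (\<Sum>F\<in>Fs. const (c F) * mono_poly (indicator_mon (\<rho> F))) :: ('v, 'k) mpoly"
  define P where "P D = (\<exists>c. \<exists>s\<in>combinations \<theta> d (nonface_polys V D\<^sub>0). f - ?m c - s \<in> nonface_polys V D)" for D
  have "initial Fs" unfolding initial_def by simp
  then have "P (generated Fs)"
  proof (rule shelling_induct)
    show "P D\<^sub>0" unfolding P_def
      by (intro exI[of _ "\<lambda>_. 0"] bexI[of _ 0] combinations_zero) (simp_all add: assms)
    fix F \<H> assume 1: "F \<in> Fs" and "P (generated \<H>)"
      and 2: "\<rho> F \<notin> generated \<H>" "generated (insert F \<H>) = generated \<H> \<union> {\<tau>. \<rho> F \<subseteq> \<tau> \<and> \<tau> \<subseteq> F}"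
    then obtain c s where cs: "s \<in> combinations \<theta> d (nonface_polys V D\<^sub>0)"
      "f - ?m c - s \<in> nonface_polys V (generated \<H>)" unfolding P_def by blast
    obtain b where "interval_step V F (\<rho> F) (generated \<H>) (generated (insert F \<H>)) t b d \<theta>"
      using interval_step_generated[OF 1 2] .
    then interpret interval_step V F "\<rho> F" "generated \<H>" "generated (insert F \<H>)" t b d \<theta> .
    obtain a r where ar: "r \<in> combinations \<theta> d (nonface_polys V (generated \<H>))"
      "f - ?m c - s - const a * mono_poly (indicator_mon (\<rho> F)) - r \<in> nonface_polys V (generated (insert F \<H>))"
      using span_step[OF cs(2)] .
    define e where "e G = c G + (if G = F then a else 0)" for G
    have "?m e = ?m c + (\<Sum>G\<in>Fs. if G = F then const a * mono_poly (indicator_mon (\<rho> F)) else 0)"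
      unfolding sum.distrib[symmetric] e_def by (intro sum.cong) (auto simp: single_add distrib_right)
    also have "\<dots> = ?m c + const a * mono_poly (indicator_mon (\<rho> F))" using 1 finite_Fs by simp
    finally have e: "?m e = ?m c + const a * mono_poly (indicator_mon (\<rho> F))" .
    have "D\<^sub>0 \<subseteq> generated \<H>" unfolding generated_def by simp
    then have "r \<in> combinations \<theta> d (nonface_polys V D\<^sub>0)"
      using ar(1) combinations_mono[OF nonface_polys_antimono] by blast
    then have "s + r \<in> combinations \<theta> d (nonface_polys V D\<^sub>0)"
      using combinations_add[OF nonface_polys_add cs(1)] by blast
    moreover have "f - ?m e - (s + r) \<in> nonface_polys V (generated (insert F \<H>))"
      using ar(2) unfolding e by (simp add: algebra_simps)
    ultimately show "P (generated (insert F \<H>))" unfolding P_def by blast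
  qed
  then show ?thesis using that unfolding generated_all P_def by blast
qed

end

end

section \<open>Homogeneous components\<close>

definition component :: "nat \<Rightarrow> ('v, 'k::field) mpoly \<Rightarrow> ('v, 'k) mpoly" where
  "component n f = (\<Sum>u\<in>Poly_Mapping.keys f. if mon_deg u = n then Poly_Mapping.single u (Poly_Mapping.lookup f u) else 0)"

lemma lookup_component: "Poly_Mapping.lookup (component n f) u = (if mon_deg u = n then Poly_Mapping.lookup f u else 0)"
proof -
  have "Poly_Mapping.lookup (component n f) u =
      (\<Sum>w\<in>Poly_Mapping.keys f. if w = u then if mon_deg u = n then Poly_Mapping.lookup f u else 0 else 0)"
    unfolding component_def lookup_sum by (intro sum.cong) (auto simp: lookup_single)
  then show ?thesis by (auto simp: in_keys_iff)
qed

lemma component_add: "component n (f + g) = component n f + component n g"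
  by (intro poly_mapping_eqI) (simp add: lookup_component lookup_add)

lemma component_zero [simp]: "component n 0 = 0"
  by (simp add: component_def)

lemma component_sum: "component n (\<Sum>x\<in>A. f x) = (\<Sum>x\<in>A. component n (f x))"
  by (induction A rule: infinite_finite_induct) (simp_all add: component_add)

lemma component_diff: "component n (f - g) = component n f - component n g"
  by (intro poly_mapping_eqI) (simp add: lookup_component lookup_minus)

lemma component_mono: "component n (const c * mono_poly u) = (if mon_deg u = n then const c * mono_poly u else 0)"
  by (intro poly_mapping_eqI)
    (auto simp: lookup_component single_eq_const_mult[symmetric] lookup_single when_def)

lemma component_nonface: "f \<in> nonface_polys V D \<Longrightarrow> component n f \<in> nonface_polys V D"
  unfolding nonface_polys_def polys_def by (auto simp: in_keys_iff lookup_component split: if_splits)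

lemma component_var_mult: "component (Suc n) (var v * f) = var v * component n f" "component 0 (var v * f) = 0"
proof -
  have *: "var v * (const c * mono_poly u) = const c * mono_poly (Poly_Mapping.single v 1 + u)"
    for c and u :: "'a mon"
    by (simp add: mono_poly_mult var_def mult_ac)
  show "component (Suc n) (var v * f) = var v * component n f"
    by (induction f rule: poly_induct)
      (simp_all add: * component_mono mon_deg_add component_add distrib_left)
  show "component 0 (var v * f) = 0"
    by (induction f rule: poly_induct)
      (simp_all add: * component_mono mon_deg_add component_add distrib_left)
qed

lemma component_const_mult: "component n (const c * f) = const c * component n f"
  by (intro poly_mapping_eqI) (simp add: lookup_component lookup_const_mult)

lemma component_linear_mult:
  "component (Suc n) (linear_form V t * f) = linear_form V t * component n f"
  "component 0 (linear_form V t * f) = 0"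
  unfolding linear_form_def
  by (simp_all add: sum_distrib_right component_sum mult.assoc component_const_mult component_var_mult)

text \<open>Linear forms raise degrees by one, so the coefficients of a component are components of
  one degree less; in degree 0 nothing is left.\<close>

lemma component_combinations:
  assumes "\<And>k. \<theta> k = linear_form V (t k)" "s \<in> combinations \<theta> d (nonface_polys V D)"
  shows "component n s \<in> combinations \<theta> d (nonface_polys V D)"
proof -
  obtain h where h: "\<And>l. h l \<in> nonface_polys V D" "s = (\<Sum>l<d. \<theta> l * h l)"
    using assms(2) by (rule combinationsE) blast
  show ?thesis
  proof (cases n)
    case 0
    then have "component n s = 0" unfolding h(2) assms(1) by (simp add: component_sum component_linear_mult)
    then show ?thesis by (simp add: combinations_zero)
  next
    case (Suc m)
    then have "component n s = (\<Sum>l<d. \<theta> l * component m (h l))"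
      unfolding h(2) assms(1) by (simp add: component_sum component_linear_mult)
    then show ?thesis using combinationsI[of "\<lambda>l. component m (h l)"] component_nonface[OF h(1)] by metis
  qed
qed

section \<open>The pairing with the interior ideal and the degree of the socle\<close>

section \<open>The socle of the Artinian reduction\<close>

text \<open>The combinatorics behind levelness. One weight serves for the restriction sets
  \<open>r F\<close> and, reversed, for their complements. \<open>inner\<close> stands for the faces
  off the boundary and \<open>e\<close> for the socle degree. By \<open>wall\<close>, the two facets
  at a wall lie on opposite sides of every hyperplane through it; by \<open>card_r_less\<close>, the
  inner face \<open>F - r F\<close> can shrink as long as \<open>r F\<close> is not of maximal
  size.\<close>

locale level_shelling =
  fixes V :: "'v set" and \<Delta> Fs :: "'v set set" and r :: "'v set \<Rightarrow> 'v set" and \<kappa> :: "'v set \<Rightarrow> nat"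
    and inner :: "'v set \<Rightarrow> bool" and t :: "nat \<Rightarrow> 'v \<Rightarrow> 'k::field" and d e :: nat
  assumes finV: "finite V" and \<Delta>: "\<Delta> \<subseteq> Pow V" "down_closed \<Delta>" "{} \<in> \<Delta>"
    and Fs: "Fs \<subseteq> \<Delta>" and card_facet: "\<And>F. F \<in> Fs \<Longrightarrow> card F = d"
    and r: "\<And>F. F \<in> Fs \<Longrightarrow> r F \<subseteq> F"
    and less: "\<And>F G. F \<in> Fs \<Longrightarrow> G \<in> Fs \<Longrightarrow> r F \<subseteq> G \<Longrightarrow> F = G \<or> \<kappa> F < \<kappa> G"
    and less_dual: "\<And>F G. F \<in> Fs \<Longrightarrow> G \<in> Fs \<Longrightarrow> F - r F \<subseteq> G \<Longrightarrow> G = F \<or> \<kappa> G < \<kappa> F"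
    and cover: "\<And>\<tau>. \<tau> \<in> \<Delta> \<Longrightarrow> \<exists>F\<in>Fs. r F \<subseteq> \<tau> \<and> \<tau> \<subseteq> F"
    and cover_dual: "\<And>\<tau>. \<tau> \<in> \<Delta> \<Longrightarrow> inner \<tau> \<Longrightarrow> \<exists>F\<in>Fs. F - r F \<subseteq> \<tau> \<and> \<tau> \<subseteq> F"
    and inner: "\<And>\<sigma> \<tau>. inner \<sigma> \<Longrightarrow> \<sigma> \<subseteq> \<tau> \<Longrightarrow> inner \<tau>" "\<And>F. F \<in> Fs \<Longrightarrow> inner (F - r F)"
    and dual: "\<And>F. F \<in> Fs \<Longrightarrow> \<exists>b. dual_bases t d F b"
    and wall: "\<And>v w \<tau> y. insert v \<tau> \<in> Fs \<Longrightarrow> insert w \<tau> \<in> Fs \<Longrightarrow> v \<notin> \<tau> \<Longrightarrow> w \<notin> \<tau> \<Longrightarrow> v \<noteq> w \<Longrightarrow>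
      (\<And>x. x \<in> \<tau> \<Longrightarrow> (\<Sum>k<d. y k * t k x) = 0) \<Longrightarrow> (\<Sum>k<d. y k * t k v) + (\<Sum>k<d. y k * t k w) = 0"
    and card_r: "\<And>F. F \<in> Fs \<Longrightarrow> card (r F) \<le> e"
    and card_r_less: "\<And>F. F \<in> Fs \<Longrightarrow> card (r F) < e \<Longrightarrow> \<exists>v\<in>F - r F. inner (F - r F - {v})"
begin

definition \<theta> :: "nat \<Rightarrow> ('v, 'k) mpoly" where "\<theta> k = linear_form V (t k)"

text \<open>Modulo \<open>I\<close>, this is a model of the canonical module of the Stanley-Reisner
  ring of a ball.\<close>

definition J :: "('v, 'k) mpoly set" where "J = nonface_polys V {\<tau> \<in> \<Delta>. \<not> inner \<tau>}"

definition I :: "('v, 'k) mpoly set" where "I = nonface_polys V \<Delta>"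

definition modulo :: "nat \<Rightarrow> ('v, 'k) mpoly set \<Rightarrow> ('v, 'k) mpoly set" where
  "modulo k N = {f. \<exists>s\<in>combinations \<theta> k N. f - s \<in> I}"

lemma theta_in_polys: "\<theta> k \<in> polys V"
  unfolding \<theta>_def by (rule polys_linear_form) simp

lemma face_finite: "\<tau> \<in> \<Delta> \<Longrightarrow> finite \<tau>"
  using \<Delta>(1) by (intro finite_subset[OF _ finV]) auto

lemma facet_finite: "F \<in> Fs \<Longrightarrow> finite F" and facet_subset: "F \<in> Fs \<Longrightarrow> F \<subseteq> V"
  using Fs \<Delta>(1) face_finite by blast+

lemma down_closed_boundary: "down_closed {\<tau> \<in> \<Delta>. \<not> inner \<tau>}"
  using \<Delta>(2) inner(1) unfolding down_closed_def by blast

sublocale up: shelling V \<Delta> "{}" Fs r "\<lambda>F. int (\<kappa> F)"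
  using finV \<Delta> Fs r less cover by unfold_locales (auto simp: down_closed_def)

text \<open>The complements of the restriction sets are inner faces, so the reversed order builds up
  the ball from its boundary.\<close>

sublocale down: shelling V \<Delta> "{\<tau> \<in> \<Delta>. \<not> inner \<tau>}" Fs "\<lambda>F. F - r F" "\<lambda>F. - int (\<kappa> F)"
proof unfold_locales
  show "F = G \<or> - int (\<kappa> F) < - int (\<kappa> G)" if "F \<in> Fs" "G \<in> Fs" "F - r F \<subseteq> G" for F G
    using less_dual[OF that] by auto
qed (use finV \<Delta> Fs down_closed_boundary inner cover_dual in auto)

lemma regular: "regular_on \<theta> d (polys V) I"
  using up.regular_on_generated[of t d \<theta> Fs] dual \<theta>_def
  unfolding up.generated_all I_def by (simp add: up.initial_def)

lemma span:
  assumes "f \<in> polys V"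
  obtains c s where "s \<in> combinations \<theta> d (polys V)"
    "f - (\<Sum>F\<in>Fs. const (c F) * mono_poly (indicator_mon (r F))) - s \<in> I"
proof -
  have "f \<in> nonface_polys V {}" using assms by simp
  from up.monomials_span[of t d \<theta>, OF dual \<theta>_def this] obtain c s
    where "s \<in> combinations \<theta> d (nonface_polys V {})"
      "f - (\<Sum>F\<in>Fs. const (c F) * mono_poly (indicator_mon (r F))) - s \<in> nonface_polys V \<Delta>"
    by blast
  then show ?thesis unfolding I_def[symmetric] nonface_polys_empty by (rule that)
qed

lemma I_add: "p \<in> I \<Longrightarrow> q \<in> I \<Longrightarrow> p + q \<in> I"
  and I_mult: "c \<in> polys V \<Longrightarrow> p \<in> I \<Longrightarrow> c * p \<in> I"
  and I_uminus: "p \<in> I \<Longrightarrow> - p \<in> I"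
  and I_zero: "0 \<in> I" and I_subset: "I \<subseteq> polys V"
  unfolding I_def
  by (simp_all add: nonface_polys_add nonface_polys_mult[OF \<Delta>(2)] nonface_polys_uminus nonface_polys_subset)

lemma J_add: "p \<in> J \<Longrightarrow> q \<in> J \<Longrightarrow> p + q \<in> J"
  and J_mult: "c \<in> polys V \<Longrightarrow> p \<in> J \<Longrightarrow> c * p \<in> J"
  and J_zero: "0 \<in> J"
  unfolding J_def
  by (simp_all add: nonface_polys_add nonface_polys_mult[OF down_closed_boundary])

lemma inner_monomial_in_J:
  assumes "inner \<tau>" "\<tau> \<subseteq> V" "q \<in> polys V"
  shows "mono_poly (indicator_mon \<tau>) * q \<in> J"
proof -
  have "finite \<tau>" using assms(2) finV by (rule finite_subset)
  then show ?thesis unfolding J_def using assms inner(1) by (intro nonface_polys_mono_mult) auto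
qed

lemma modulo_add:
  assumes "\<And>p q. p \<in> N \<Longrightarrow> q \<in> N \<Longrightarrow> p + q \<in> N" "f \<in> modulo k N" "g \<in> modulo k N"
  shows "f + g \<in> modulo k N"
proof -
  obtain s s' where s: "s \<in> combinations \<theta> k N" "f - s \<in> I" "s' \<in> combinations \<theta> k N" "g - s' \<in> I"
    using assms(2,3) unfolding modulo_def by blast
  have "(f - s) + (g - s') \<in> I" by (intro I_add s)
  then have "f + g - (s + s') \<in> I" by (simp add: algebra_simps)
  then show ?thesis using combinations_add[OF assms(1) s(1,3)] unfolding modulo_def by blast
qed

lemma modulo_mult:
  assumes "\<And>p. p \<in> N \<Longrightarrow> c * p \<in> N'" "f \<in> modulo k N" "c \<in> polys V"
  shows "c * f \<in> modulo k N'"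
proof -
  obtain s where s: "s \<in> combinations \<theta> k N" "f - s \<in> I" using assms(2) unfolding modulo_def by blast
  have "c * f - c * s \<in> I" using I_mult[OF assms(3) s(2)] by (simp add: right_diff_distrib)
  then show ?thesis using combinations_mult[OF assms(1) s(1)] unfolding modulo_def by blast
qed

lemma I_subset_modulo: "0 \<in> N \<Longrightarrow> p \<in> I \<Longrightarrow> p \<in> modulo k N"
  unfolding modulo_def using combinations_zero[of N \<theta> k] by force

lemma combinations_subset_modulo: "p \<in> combinations \<theta> k N \<Longrightarrow> p \<in> modulo k N"
  unfolding modulo_def using I_zero by force

lemma nonface_monomial_in_I:
  assumes "Poly_Mapping.keys w \<subseteq> V" "Poly_Mapping.keys w \<notin> \<Delta>" "q \<in> polys V"
  shows "mono_poly w * q \<in> I"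
  unfolding I_def using assms \<Delta>(2) by (intro nonface_polys_mono_mult) (auto dest: down_closedD)

text \<open>A facet with empty restriction set has the least weight, so it comes last in the
  reversed shelling, and its only new face is the facet itself. The last module of that filtration
  is thus generated modulo \<open>I\<close> by the facet monomial, which cannot be a combination of
  linear multiples of elements of that module.\<close>

lemma facet_monomial_not_in_modulo:
  assumes F\<^sub>0: "F\<^sub>0 \<in> Fs" "r F\<^sub>0 = {}"
  shows "mono_poly (indicator_mon F\<^sub>0) \<notin> modulo d J"
proof
  let ?x = "mono_poly (indicator_mon F\<^sub>0) :: ('v, 'k) mpoly"
  assume "?x \<in> modulo d J"
  then obtain s where s: "s \<in> combinations \<theta> d J" "?x - s \<in> I" unfolding modulo_def by blast
  have fin: "finite F\<^sub>0" by (rule facet_finite[OF F\<^sub>0(1)])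
  have min: "F\<^sub>0 = G \<or> \<kappa> F\<^sub>0 < \<kappa> G" if "G \<in> Fs" for G using less[OF F\<^sub>0(1) that] F\<^sub>0(2) by simp
  let ?G = "Fs - {F\<^sub>0}"
  define E where "E = down.generated ?G"
  have "down.initial ?G" unfolding down.initial_def using min by force
  then have reg: "regular_on \<theta> d J (nonface_polys V E)"
    unfolding J_def E_def using down.regular_on_generated[of t d \<theta> ?G] dual \<theta>_def by blast
  have E\<Delta>: "E \<subseteq> \<Delta>" unfolding E_def down.generated_def by auto
  have sub: "F\<^sub>0 \<notin> E"
  proof
    assume "F\<^sub>0 \<in> E"
    then obtain G where "G \<in> Fs" "G \<noteq> F\<^sub>0" "F\<^sub>0 \<subseteq> G"
      using inner(2)[OF F\<^sub>0(1)] F\<^sub>0(2) unfolding E_def down.generated_def by auto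
    then show False using less_dual[OF F\<^sub>0(1), of G] min[of G] by auto
  qed
  have "?x * 1 \<in> nonface_polys V E"
    using sub down_closedD[of E] down.down_closed_generated[of ?G] fin facet_subset[OF F\<^sub>0(1)]
    by (intro nonface_polys_mono_mult) (auto simp: E_def)
  moreover have "?x - s \<in> nonface_polys V E" using s(2) nonface_polys_antimono[OF E\<Delta>] unfolding I_def by blast
  ultimately have "?x * 1 - (?x - s) \<in> nonface_polys V E" by (rule nonface_polys_diff)
  then have sE: "s \<in> nonface_polys V E" by simp
  interpret ideal_chain V \<theta> J "nonface_polys V E"
    unfolding J_def by (intro ideal_chain_nonface_polys theta_in_polys down_closed_boundary)
      (auto simp: E_def down.generated_def down.down_closed_generated[unfolded down.generated_def])
  \<comment> \<open>Regularity up to the last step allows the coefficients in J to be replaced by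
    coefficients in the last module of the filtration.\<close>
  have "s \<in> combinations \<theta> d (nonface_polys V E)" by (rule combinations_Int[OF reg order_refl s(1) sE])
  then obtain h where h: "\<And>l. h l \<in> nonface_polys V E" "s = (\<Sum>l<d. \<theta> l * h l)"
    by (rule combinationsE) blast
  \<comment> \<open>The facet monomial could only arise from the monomial of a ridge
    \<open>F\<^sub>0 - {v}\<close>. But this ridge lies in E: it is on the boundary or in the dual
    interval of another facet.\<close>
  have zero: "Poly_Mapping.lookup (var v * h l) (indicator_mon F\<^sub>0) = 0" for v l
  proof (rule ccontr)
    assume "\<not> ?thesis"
    then have "indicator_mon F\<^sub>0 \<in> Poly_Mapping.keys (var v * h l)" by (simp add: in_keys_iff)
    then obtain u where u: "u \<in> Poly_Mapping.keys (h l)" "indicator_mon F\<^sub>0 = Poly_Mapping.single v 1 + u"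
      by (auto simp: var_def keys_mono_mult)
    then have *: "Poly_Mapping.lookup (indicator_mon F\<^sub>0) x = Poly_Mapping.lookup (Poly_Mapping.single v 1) x + Poly_Mapping.lookup u x" for x
      by (simp add: lookup_add)
    have v: "v \<in> F\<^sub>0" using *[of v] fin by (auto simp: lookup_indicator_mon of_bool_def split: if_splits)
    have "Poly_Mapping.keys u = F\<^sub>0 - {v}"
    proof (rule Set.set_eqI)
      fix x show "x \<in> Poly_Mapping.keys u \<longleftrightarrow> x \<in> F\<^sub>0 - {v}"
        using *[of x] v fin
        by (cases "x = v") (auto simp: lookup_indicator_mon in_keys_iff lookup_single of_bool_def split: if_splits)
    qed
    then have out: "F\<^sub>0 - {v} \<notin> E" using h(1)[of l] u(1) unfolding nonface_polys_def by auto
    have \<Delta>v: "F\<^sub>0 - {v} \<in> \<Delta>" using F\<^sub>0(1) Fs down_closedD[OF \<Delta>(2)] by blast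
    then have "inner (F\<^sub>0 - {v})" using out unfolding E_def down.generated_def by blast
    then obtain G where G: "G \<in> Fs" "G - r G \<subseteq> F\<^sub>0 - {v}" "F\<^sub>0 - {v} \<subseteq> G" using cover_dual[OF \<Delta>v] by blast
    then have "G \<noteq> F\<^sub>0" using F\<^sub>0(2) v by blast
    then show False using out G \<Delta>v unfolding E_def down.generated_def by blast
  qed
  have "Poly_Mapping.lookup s (indicator_mon F\<^sub>0) = 0"
    unfolding h(2) \<theta>_def linear_form_def
    by (simp add: sum_distrib_right lookup_sum mult.assoc lookup_const_mult zero)
  moreover have "Poly_Mapping.keys (indicator_mon F\<^sub>0) \<in> \<Delta>" using F\<^sub>0(1) Fs fin by auto
  then have "indicator_mon F\<^sub>0 \<notin> Poly_Mapping.keys (?x - s)"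
    using s(2) unfolding I_def nonface_polys_def by blast
  then have "Poly_Mapping.lookup (?x - s) (indicator_mon F\<^sub>0) = 0" by (simp add: in_keys_iff)
  moreover have "Poly_Mapping.lookup ?x (indicator_mon F\<^sub>0) = 1" by (simp add: mono_poly_def)
  ultimately show False by (simp add: lookup_minus)
qed

text \<open>The facet whose interval contains the wall has smaller weight than F. A third facet
  through the wall would have its weight strictly in between; its extra vertex belongs to its
  restriction set or not, and either case contradicts one of the two shellings.\<close>

lemma adjacent_facet:
  assumes F: "F \<in> Fs" and v: "v \<in> r F"
  obtains w where "insert w (F - {v}) \<in> Fs" "w \<notin> F" "\<kappa> (insert w (F - {v})) < \<kappa> F"
    "\<And>G. G \<in> Fs \<Longrightarrow> F - {v} \<subseteq> G \<Longrightarrow> G = F \<or> G = insert w (F - {v})"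
proof -
  let ?\<tau> = "F - {v}"
  have vF: "v \<in> F" using r[OF F] v by blast
  have card1: "\<exists>w. G = insert w ?\<tau> \<and> w \<notin> ?\<tau>" if "G \<in> Fs" "?\<tau> \<subseteq> G" for G
  proof -
    have "card (G - ?\<tau>) = card G - card ?\<tau>" using that facet_finite[OF F] by (intro card_Diff_subset) auto
    moreover have "0 < d" using card_facet[OF F] vF facet_finite[OF F] by (auto simp: card_gt_0_iff)
    ultimately have "card (G - ?\<tau>) = 1"
      using that card_facet[OF that(1)] card_facet[OF F] vF facet_finite[OF F] by (simp add: card_Diff_singleton)
    then obtain w where "G - ?\<tau> = {w}" by (auto simp: card_1_singleton_iff)
    then show ?thesis using that by blast
  qed
  have "?\<tau> \<in> \<Delta>" using F Fs down_closedD[OF \<Delta>(2)] by blast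
  then obtain F' where F': "F' \<in> Fs" "r F' \<subseteq> ?\<tau>" "?\<tau> \<subseteq> F'" using cover by blast
  obtain w where w: "F' = insert w ?\<tau>" "w \<notin> ?\<tau>" using card1 F' by blast
  have ne: "F' \<noteq> F" using F' v by blast
  have lt: "\<kappa> F' < \<kappa> F" using less[OF F'(1) F] F'(2) ne by blast
  have top: "F - r F \<subseteq> ?\<tau>" using v by blast
  have two: "G = F \<or> G = F'" if G: "G \<in> Fs" "?\<tau> \<subseteq> G" for G
  proof (rule ccontr)
    assume *: "\<not> (G = F \<or> G = F')"
    then have 1: "\<kappa> F' < \<kappa> G" using less[OF F'(1) G(1)] F'(2) G(2) by blast
    have 2: "\<kappa> G < \<kappa> F" using less_dual[OF F G(1)] top G(2) * by blast
    obtain x where x: "G = insert x ?\<tau>" "x \<notin> ?\<tau>" using card1 G by blast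
    show False
    proof (cases "x \<in> r G")
      case True
      then have "G - r G \<subseteq> F" using x by blast
      then show ?thesis using less_dual[OF G(1) F] 2 * by auto
    next
      case False
      then have "r G \<subseteq> F'" using r[OF G(1)] x F'(3) by blast
      then show ?thesis using less[OF G(1) F'(1)] 1 * by auto
    qed
  qed
  have "w \<notin> F" using w ne vF by blast
  then show ?thesis using that[of w] F'(1) lt two unfolding w(1) by blast
qed

text \<open>The linear form dual to v on F is multiplied by the monomial of the wall. The other
  vertices of F have coefficient 0, those outside both facets give nonfaces, and by
  \<open>wall\<close> what remains is the difference of the two facet monomials. The wall contains
  \<open>F - r F\<close>, so it is inner and the product is in \<theta> J.\<close>

lemma facet_monomials_congruent:
  assumes F: "F \<in> Fs" and v: "v \<in> r F" and w: "insert w (F - {v}) \<in> Fs" "w \<notin> F"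
    and two: "\<And>G. G \<in> Fs \<Longrightarrow> F - {v} \<subseteq> G \<Longrightarrow> G = F \<or> G = insert w (F - {v})"
  shows "mono_poly (indicator_mon F) - mono_poly (indicator_mon (insert w (F - {v}))) \<in> modulo d J"
proof -
  let ?\<tau> = "F - {v}"
  let ?x = "mono_poly (indicator_mon ?\<tau>) :: ('v, 'k) mpoly"
  have vF: "v \<in> F" using r[OF F] v by blast
  have fin: "finite ?\<tau>" using facet_finite[OF F] by simp
  have ins: "insert v ?\<tau> = F" using vF by blast
  obtain b where b: "dual_bases t d F b" using dual[OF F] ..
  define L where "L x = (\<Sum>k<d. b k v * t k x)" for x
  have LF: "L x = of_bool (v = x)" if "x \<in> F" for x
  proof -
    have "L x = (\<Sum>k<d. t k x * b k v)" unfolding L_def by (simp add: mult.commute)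
    then show ?thesis using b that vF unfolding dual_bases_def by simp
  qed
  have "L v + L w = 0" unfolding L_def
    by (rule wall[of v ?\<tau> w]) (use ins F w vF LF in \<open>auto simp: L_def\<close>)
  then have Lw: "L w = -1" using LF[OF vF] by (simp add: eq_neg_iff_add_eq_0 add.commute)
  have "F - r F \<subseteq> ?\<tau>" using v by blast
  then have "inner ?\<tau>" using inner F by blast
  then have J: "?x * q \<in> J" if "q \<in> polys V" for q
    using inner_monomial_in_J facet_subset[OF F] that by blast
  have "linear_form V L * ?x = (\<Sum>k<d. \<theta> k * (?x * const (b k v)))"
  proof -
    have "linear_form V L = (\<Sum>x\<in>V. (\<Sum>k<d. const (b k v * t k x)) * var x)"
    proof -
      show ?thesis unfolding linear_form_def L_def const_sum ..
    qed
    also have "\<dots> = (\<Sum>k<d. const (b k v) * \<theta> k)"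
      unfolding \<theta>_def linear_form_def sum_distrib_right sum_distrib_left
      by (subst sum.swap) (simp only: const_mult mult.assoc)
    finally show ?thesis by (simp only: sum_distrib_left sum_distrib_right mult_ac)
  qed
  also have "\<dots> \<in> combinations \<theta> d J" by (intro combinationsI J polys_const)
  finally have comb: "linear_form V L * ?x \<in> combinations \<theta> d J" .
  have mem: "v \<in> V" "w \<in> V" using vF facet_subset[OF F] facet_subset[OF w(1)] by auto
  have vx: "var x * ?x = mono_poly (indicator_mon (insert x ?\<tau>))" if "x \<notin> ?\<tau>" for x
    using that fin by (simp add: indicator_mon_insert mono_poly_mult var_def)
  have "linear_form V L * ?x = (\<Sum>x\<in>V. const (L x) * (var x * ?x))"
    unfolding linear_form_def sum_distrib_right by (simp add: mult.assoc)
  also have "\<dots> = (const (L v) * (var v * ?x) + const (L w) * (var w * ?x)) + (\<Sum>x\<in>V - {v} - {w}. const (L x) * (var x * ?x))"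
    using mem vF w(2) finV
    by (subst sum.remove[of V v], simp, simp, subst sum.remove[of "V - {v}" w]) (auto simp: add.assoc)
  also have "const (L v) * (var v * ?x) + const (L w) * (var w * ?x) =
      mono_poly (indicator_mon F) - mono_poly (indicator_mon (insert w ?\<tau>))"
    using LF[OF vF] Lw vx[of v] vx[of w] w(2) vF
    by (simp add: ins insert_absorb single_uminus)
  finally have eq: "mono_poly (indicator_mon F) - mono_poly (indicator_mon (insert w ?\<tau>)) - linear_form V L * ?x =
      - (\<Sum>x\<in>V - {v} - {w}. const (L x) * (var x * ?x))" by simp
  have "const (L x) * (var x * ?x) \<in> I" if x: "x \<in> V - {v} - {w}" for x
  proof (cases "x \<in> F")
    case True
    then show ?thesis using LF x I_zero by auto
  next
    case False
    have "insert x ?\<tau> \<notin> \<Delta>"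
    proof
      assume "insert x ?\<tau> \<in> \<Delta>"
      then obtain G where G: "G \<in> Fs" "insert x ?\<tau> \<subseteq> G" using cover by blast
      then have "G = F \<or> G = insert w ?\<tau>" using two by blast
      then show False using G(2) False x by blast
    qed
    then have "mono_poly (indicator_mon (insert x ?\<tau>)) * const (L x) \<in> I"
      using x fin facet_subset[OF F] by (intro nonface_monomial_in_I) auto
    then show ?thesis using vx[of x] False by (simp add: mult.commute)
  qed
  then have "(\<Sum>x\<in>V - {v} - {w}. const (L x) * (var x * ?x)) \<in> I"
    unfolding I_def by (rule nonface_polys_sum)
  then show ?thesis using I_uminus comb eq unfolding modulo_def by force
qed

text \<open>Crossing a wall at a vertex of the restriction set replaces the monomial by a congruent
  one of smaller weight, until the restriction set is empty.\<close>

lemma facet_monomial_not_zero: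
  assumes "F \<in> Fs" shows "mono_poly (indicator_mon F) \<notin> modulo d J"
  using assms
proof (induction "\<kappa> F" arbitrary: F rule: less_induct)
  case less
  show ?case
  proof (cases "r F = {}")
    case True
    then show ?thesis using facet_monomial_not_in_modulo less.prems by blast
  next
    case False
    then obtain v where v: "v \<in> r F" by blast
    obtain w where w: "insert w (F - {v}) \<in> Fs" "w \<notin> F" "\<kappa> (insert w (F - {v})) < \<kappa> F"
      "\<And>G. G \<in> Fs \<Longrightarrow> F - {v} \<subseteq> G \<Longrightarrow> G = F \<or> G = insert w (F - {v})"
      using adjacent_facet[OF less.prems v] by blast
    let ?y = "mono_poly (indicator_mon (insert w (F - {v}))) :: ('v, 'k) mpoly"
    show ?thesis
    proof
      assume a: "mono_poly (indicator_mon F) \<in> modulo d J"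
      have "const (-1) * (mono_poly (indicator_mon F) - ?y) \<in> modulo d J"
        by (intro modulo_mult[OF _ facet_monomials_congruent[OF less.prems v w(1,2,4)]] J_mult polys_const)
      from modulo_add[OF J_add a this] have "?y \<in> modulo d J"
        by (simp add: single_uminus)
      then show False using less.hyps[OF w(3,1)] by blast
    qed
  qed
qed

lemma component_modulo:
  assumes "f \<in> modulo k J" shows "component n f \<in> modulo k J"
proof -
  obtain s where s: "s \<in> combinations \<theta> k J" "f - s \<in> I" using assms unfolding modulo_def by blast
  have "component n f - component n s \<in> I"
    using component_nonface[of "f - s" V \<Delta> n] s(2) unfolding I_def component_diff by simp
  moreover have "component n s \<in> combinations \<theta> k J"
    using component_combinations[of \<theta> V t, OF \<theta>_def] s(1) unfolding J_def by blast
  ultimately show ?thesis unfolding modulo_def by blast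
qed

text \<open>Multiplying a socle element \<open>f\<close> with the monomial of \<open>F - r F\<close> isolates the coefficient of
  \<open>r F\<close> in front of the monomial of \<open>F\<close>, provided that \<open>F\<close> is minimal; the product vanishes if a
  variable can be split off without leaving \<open>J\<close>.\<close>

lemma socle_degree:
  assumes f: "f \<in> polys V" and socle: "\<And>v. v \<in> V \<Longrightarrow> var v * f \<in> modulo d (polys V)"
  obtains g where "g \<in> polys V" "\<And>u. u \<in> Poly_Mapping.keys g \<Longrightarrow> mon_deg u = e" "f - g \<in> modulo d (polys V)"
proof -
  let ?x = "\<lambda>\<sigma>. mono_poly (indicator_mon \<sigma>) :: ('v, 'k) mpoly"
  obtain c s where cs: "s \<in> combinations \<theta> d (polys V)" "f - (\<Sum>F\<in>Fs. const (c F) * ?x (r F)) - s \<in> I"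
    using span[OF f] .
  define S where "S = {F \<in> Fs. c F \<noteq> 0 \<and> card (r F) < e}"
  have rV: "r F \<subseteq> V" "finite (r F)" if "F \<in> Fs" for F
    using r[OF that] facet_subset[OF that] facet_finite[OF that] by (auto intro: finite_subset)
  have "S = {}"
  proof (rule ccontr)
    assume "S \<noteq> {}"
    \<comment> \<open>Minimality of the weight makes \<open>F - r F\<close> together with
      \<open>r G\<close> a nonface for every other G of the same degree: a facet containing both
      would weigh at most as much as F and at least as much as G, with equality only for F =
      G.\<close>
    then obtain F where F: "F \<in> S" "\<And>G. G \<in> S \<Longrightarrow> \<kappa> F \<le> \<kappa> G"
      using ex_has_least_nat[of "\<lambda>F. F \<in> S" _ \<kappa>] by blast
    have FF: "F \<in> Fs" "c F \<noteq> 0" "card (r F) < e" using F unfolding S_def by auto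
    let ?T = "F - r F"
    have TV: "?T \<subseteq> V" "finite ?T" using facet_subset[OF FF(1)] facet_finite[OF FF(1)] by auto
    \<comment> \<open>Since \<open>F - r F\<close> remains inner without v, the variable of v can be
      given to f, which it sends into the ideal of \<theta>, while the other factor carries the
      result into J.\<close>
    obtain v where v: "v \<in> ?T" "inner (?T - {v})" using card_r_less[OF FF(1,3)] by blast
    have "?x ?T = ?x (?T - {v}) * var v"
      using v TV indicator_mon_insert[of "?T - {v}" v]
      by (simp add: insert_absorb var_def mono_poly_mult mult.commute)
    moreover have "?x (?T - {v}) * (var v * f) \<in> modulo d J"
      by (rule modulo_mult[OF _ socle]) (use v TV inner_monomial_in_J in \<open>auto intro!: polys_mono\<close>)
    ultimately have 1: "?x ?T * f \<in> modulo d J" by (simp add: mult.assoc)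
    have xT: "?x ?T \<in> polys V" using TV by (intro polys_mono) simp
    have "?x ?T * (f - (\<Sum>F\<in>Fs. const (c F) * ?x (r F)) - s) \<in> I" using I_mult[OF xT cs(2)] .
    then have 2: "?x ?T * (f - (\<Sum>F\<in>Fs. const (c F) * ?x (r F)) - s) \<in> modulo d J"
      by (rule I_subset_modulo[OF J_zero])
    have "?x ?T * s \<in> combinations \<theta> d J"
      by (rule combinations_mult[OF _ cs(1)]) (rule inner_monomial_in_J[OF inner(2)[OF FF(1)] TV(1)])
    then have 3: "?x ?T * s \<in> modulo d J" by (rule combinations_subset_modulo)
    have neg: "- p \<in> modulo d J" if "p \<in> modulo d J" for p
      using modulo_mult[OF J_mult[OF polys_uminus[OF polys_one]] that polys_uminus[OF polys_one]] by simp
    have "?x ?T * f + - (?x ?T * (f - (\<Sum>F\<in>Fs. const (c F) * ?x (r F)) - s)) + - (?x ?T * s) \<in> modulo d J"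
      by (intro modulo_add[OF J_add] neg 1 2 3)
    then have "?x ?T * (\<Sum>F\<in>Fs. const (c F) * ?x (r F)) \<in> modulo d J" by (simp add: algebra_simps)
    \<comment> \<open>In degree d only those G remain whose restriction set has the same size as
      that of F.\<close>
    then have "component d (?x ?T * (\<Sum>F\<in>Fs. const (c F) * ?x (r F))) \<in> modulo d J"
      by (rule component_modulo)
    moreover have "component d (?x ?T * (\<Sum>F\<in>Fs. const (c F) * ?x (r F))) =
        (\<Sum>G\<in>Fs. component d (const (c G) * mono_poly (indicator_mon ?T + indicator_mon (r G))))"
      unfolding sum_distrib_left component_sum by (simp add: mono_poly_mult mult_ac)
    moreover have deg: "mon_deg (indicator_mon ?T + indicator_mon (r G)) = d - card (r F) + card (r G)"
      "card (r F) \<le> d" if "G \<in> Fs" for G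
      using TV rV[OF that] rV[OF FF(1)] card_facet[OF FF(1)] r[OF FF(1)] facet_finite[OF FF(1)]
      by (auto simp: mon_deg_add card_Diff_subset card_mono)
    have others: "component d (const (c G) * mono_poly (indicator_mon ?T + indicator_mon (r G))) \<in> modulo d J"
      if G: "G \<in> Fs - {F}" for G
    proof (cases "c G = 0 \<or> card (r G) \<noteq> card (r F)")
      case True
      then have "component d (const (c G) * mono_poly (indicator_mon ?T + indicator_mon (r G))) = 0"
        using deg[of G] G by (auto simp: component_mono)
      then show ?thesis using I_subset_modulo[OF J_zero I_zero] by simp
    next
      case False
      then have "\<kappa> F \<le> \<kappa> G" using F G FF unfolding S_def by auto
      have "?T \<union> r G \<notin> \<Delta>"
      proof
        assume "?T \<union> r G \<in> \<Delta>"
        then obtain H where H: "H \<in> Fs" "?T \<union> r G \<subseteq> H" using cover by blast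
        have "H = F \<or> \<kappa> H < \<kappa> F" using less_dual[OF FF(1) H(1)] H(2) by blast
        moreover have "G = H \<or> \<kappa> G < \<kappa> H" using less[of G H] G H by blast
        ultimately show False using G \<open>\<kappa> F \<le> \<kappa> G\<close> by auto
      qed
      then have "mono_poly (indicator_mon ?T + indicator_mon (r G)) * const (c G) \<in> I"
        using TV rV[of G] G by (intro nonface_monomial_in_I) (auto simp: keys_mon_add)
      then show ?thesis
        using I_subset_modulo[OF J_zero] component_modulo by (simp add: mult.commute)
    qed
    have sum_mod: "sum g A \<in> modulo d J" if "\<And>x. x \<in> A \<Longrightarrow> g x \<in> modulo d J" for g and A :: "'v set set"
      using that by (induction A rule: infinite_finite_induct)
        (auto intro!: modulo_add[OF J_add] I_subset_modulo[OF J_zero I_zero])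
    ultimately have 4: "(\<Sum>G\<in>Fs. component d (const (c G) * mono_poly (indicator_mon ?T + indicator_mon (r G)))) \<in> modulo d J"
      by simp
    have "indicator_mon ?T + indicator_mon (r F) = indicator_mon F"
      using indicator_mon_Un[of ?T "r F"] TV rV[OF FF(1)] r[OF FF(1)]
      by (simp add: Un_absorb2 Diff_disjoint Int_commute)
    then have "component d (const (c F) * mono_poly (indicator_mon ?T + indicator_mon (r F))) = const (c F) * ?x F"
      using card_facet[OF FF(1)] facet_finite[OF FF(1)] by (simp add: component_mono)
    then have 5: "(\<Sum>G\<in>Fs. component d (const (c G) * mono_poly (indicator_mon ?T + indicator_mon (r G)))) =
      const (c F) * ?x F + (\<Sum>G\<in>Fs - {F}. component d (const (c G) * mono_poly (indicator_mon ?T + indicator_mon (r G))))"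
      using up.finite_Fs FF(1) by (simp add: sum.remove)
    have "const (c F) * ?x F \<in> modulo d J"
      using modulo_add[OF J_add 4 neg[OF sum_mod[of "Fs - {F}"
            "\<lambda>G. component d (const (c G) * mono_poly (indicator_mon ?T + indicator_mon (r G)))", OF others]]]
      unfolding 5 by simp
    then have "const (inverse (c F)) * (const (c F) * ?x F) \<in> modulo d J"
      by (rule modulo_mult[rotated]) (auto intro: J_mult)
    then have "?x F \<in> modulo d J" using FF(2) by (simp add: mult.assoc[symmetric] mult_single)
    then show False using facet_monomial_not_zero[OF FF(1)] by simp
  qed
  define g where "g = (\<Sum>F\<in>{F \<in> Fs. card (r F) = e}. const (c F) * ?x (r F))"
  have "(\<Sum>F\<in>Fs. const (c F) * ?x (r F)) = g" unfolding g_def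
  proof (intro sum.mono_neutral_right up.finite_Fs ballI)
    fix F assume F: "F \<in> Fs - {F \<in> Fs. card (r F) = e}"
    then have "card (r F) < e" using card_r[of F] by auto
    then have "c F = 0" using F \<open>S = {}\<close> unfolding S_def by blast
    then show "const (c F) * ?x (r F) = 0" by simp
  qed auto
  then have "f - g \<in> modulo d (polys V)" using cs unfolding modulo_def by auto
  moreover have "g \<in> polys V" unfolding g_def using rV
    by (intro polys_sum polys_mult polys_const polys_mono) auto
  moreover have "mon_deg u = e" if "u \<in> Poly_Mapping.keys g" for u
  proof -
    have "u \<in> (\<Union>F\<in>{F \<in> Fs. card (r F) = e}. Poly_Mapping.keys (const (c F) * ?x (r F)))"
      using that unfolding g_def by (rule subsetD[OF keys_sum])
    then obtain F where "F \<in> Fs" "card (r F) = e" "u \<in> Poly_Mapping.keys (const (c F) * ?x (r F))"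
      by blast
    then show ?thesis using keys_mult_const[of "c F" "?x (r F)"] rV by auto
  qed
  ultimately show ?thesis using that by blast
qed

lemma one_not_in_modulo: "1 \<notin> modulo k (polys V)"
proof
  assume "1 \<in> modulo k (polys V)"
  then obtain s where s: "s \<in> combinations \<theta> k (polys V)" "1 - s \<in> I" unfolding modulo_def by blast
  obtain h where h: "\<And>l. h l \<in> polys V" "s = (\<Sum>l<k. \<theta> l * h l)" using s(1) by (rule combinationsE) blast
  have "Poly_Mapping.lookup (var v * p) 0 = 0" for v and p :: "('v, 'k) mpoly"
  proof (rule ccontr)
    assume "\<not> ?thesis"
    then have "0 \<in> Poly_Mapping.keys (var v * p)" by (simp add: in_keys_iff)
    then have "0 \<in> (+) (Poly_Mapping.single v 1) ` Poly_Mapping.keys p"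
      unfolding var_def keys_mono_mult .
    then obtain u :: "'v mon" where "0 = Poly_Mapping.single v 1 + u" by (elim imageE) (rule that)
    then show False by (metis lookup_add lookup_single_eq lookup_zero add_is_0 one_neq_zero)
  qed
  then have "Poly_Mapping.lookup s 0 = 0"
    unfolding h(2) \<theta>_def linear_form_def
    by (simp add: sum_distrib_right lookup_sum mult.assoc lookup_const_mult)
  moreover have "Poly_Mapping.keys (0 :: 'v mon) \<in> \<Delta>" using \<Delta>(3) by simp
  then have "0 \<notin> Poly_Mapping.keys (1 - s)" using s(2) unfolding I_def nonface_polys_def by blast
  then have "Poly_Mapping.lookup (1 - s) 0 = 0" by (simp add: in_keys_iff)
  ultimately show False by (simp add: lookup_minus)
qed

end

section \<open>Bounding depth and dimension by counting monomials\<close>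

section \<open>Algebraic dependence and chains of ideals\<close>

lemma homogeneous_system_solution:
  fixes g :: "'e \<Rightarrow> 't \<Rightarrow> 'k::field"
  assumes "finite T" "finite E" "card T < card E"
  shows "\<exists>a. (\<exists>x\<in>E. a x \<noteq> 0) \<and> (\<forall>y\<in>T. (\<Sum>x\<in>E. a x * g x y) = 0)"
  using assms
proof (induction T arbitrary: E g rule: finite_induct)
  case empty
  then have "E \<noteq> {}" by auto
  then show ?case by (intro exI[of _ "\<lambda>_. 1"]) auto
next
  case (insert z T)
  show ?case
  proof (cases "\<forall>x\<in>E. g x z = 0")
    case True
    have "card T < card E" using insert by simp
    from insert.IH[OF insert.prems(1) this, of g] True show ?thesis by auto
  next
    case False
    then obtain w where w: "w \<in> E" "g w z \<noteq> 0" by blast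
    define E' where "E' = E - {w}"
    have E': "finite E'" "card T < card E'" using insert w unfolding E'_def by auto
    obtain a where a: "\<exists>x\<in>E'. a x \<noteq> 0"
      "\<forall>y\<in>T. (\<Sum>x\<in>E'. a x * (g x y - g x z / g w z * g w y)) = 0"
      using insert.IH[OF E', of "\<lambda>x y. g x y - g x z / g w z * g w y"] by blast
    define b where "b x = (if x = w then - (\<Sum>x\<in>E'. a x * g x z) / g w z else a x)" for x
    have b: "(\<Sum>x\<in>E. b x * g x y) = b w * g w y + (\<Sum>x\<in>E'. a x * g x y)" for y
    proof -
      have "(\<Sum>x\<in>E. b x * g x y) = b w * g w y + (\<Sum>x\<in>E'. b x * g x y)"
        unfolding E'_def using w insert.prems by (simp add: sum.remove)
      also have "(\<Sum>x\<in>E'. b x * g x y) = (\<Sum>x\<in>E'. a x * g x y)"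
        by (intro sum.cong) (auto simp: b_def E'_def)
      finally show ?thesis .
    qed
    have "(\<Sum>x\<in>E. b x * g x z) = 0" unfolding b using w by (simp add: b_def)
    moreover have "(\<Sum>x\<in>E. b x * g x y) = 0" if "y \<in> T" for y
    proof -
      have "(\<Sum>x\<in>E'. a x * (g x y - g x z / g w z * g w y)) =
          (\<Sum>x\<in>E'. a x * g x y) - (\<Sum>x\<in>E'. a x * g x z) / g w z * g w y"
        by (simp add: right_diff_distrib sum_subtractf sum_distrib_right sum_divide_distrib mult.assoc)
      then show ?thesis unfolding b using a(2) that by (simp add: b_def)
    qed
    moreover have "\<exists>x\<in>E. b x \<noteq> 0"
    proof -
      obtain x where x: "x \<in> E'" "a x \<noteq> 0" using a(1) by blast
      then have "b x = a x" "x \<in> E" unfolding b_def E'_def by auto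
      then show ?thesis using x(2) by metis
    qed
    ultimately show ?thesis by blast
  qed
qed

fun power_product :: "'a::comm_monoid_mult list \<Rightarrow> nat list \<Rightarrow> 'a" where
  "power_product (f # fs) (k # ks) = f ^ k * power_product fs ks"
| "power_product _ _ = 1"

definition poly_ideal :: "'v set \<Rightarrow> ('v, 'k::field) mpoly set \<Rightarrow> bool" where
  "poly_ideal V N \<longleftrightarrow> N \<subseteq> polys V \<and> 0 \<in> N \<and> (\<forall>p\<in>N. \<forall>q\<in>N. p + q \<in> N) \<and>
     (\<forall>c\<in>polys V. \<forall>p\<in>N. c * p \<in> N)"

lemma poly_idealD:
  assumes "poly_ideal V N"
  shows "N \<subseteq> polys V" "0 \<in> N" "p \<in> N \<Longrightarrow> q \<in> N \<Longrightarrow> p + q \<in> N" "c \<in> polys V \<Longrightarrow> p \<in> N \<Longrightarrow> c * p \<in> N"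
  using assms unfolding poly_ideal_def by blast+

lemma poly_ideal_diff:
  assumes "poly_ideal V N" "p \<in> N" "q \<in> N" shows "p - q \<in> N"
  using poly_idealD(3)[OF assms(1,2)] poly_idealD(4)[OF assms(1) polys_uminus[OF polys_one] assms(3)] by fastforce

lemma poly_ideal_sum:
  assumes "poly_ideal V N" "\<And>x. x \<in> A \<Longrightarrow> f x \<in> N" shows "sum f A \<in> N"
  using assms(2) by (induction A rule: infinite_finite_induct)
    (auto intro: poly_idealD(2)[OF assms(1)] poly_idealD(3)[OF assms(1)])

lemma poly_ideal_const_one:
  assumes "poly_ideal V N" "const c \<in> N" "c \<noteq> 0" shows "1 \<in> N"
proof -
  have "const (inverse c) * const c \<in> N" by (rule poly_idealD(4)[OF assms(1) polys_const assms(2)])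
  then show ?thesis using assms(3) by (simp add: mult_single)
qed

lemma power_product_polys:
  assumes "set fs \<subseteq> polys V" shows "power_product fs ks \<in> polys V"
  using assms by (induction fs ks rule: power_product.induct) (auto intro: polys_mult polys_power)

text \<open>Factoring out successively the smallest powers of the elements of \<open>fs\<close> shows that they
  satisfy no algebraic relation modulo \<open>Q 0\<close>: what remains is a unit in the last ideal.\<close>

lemma no_relation_along_chain:
  fixes Q :: "nat \<Rightarrow> ('v, 'k::field) mpoly set"
  assumes "\<And>i. i \<le> length fs \<Longrightarrow> poly_ideal V (Q i)"
    and "\<And>i. i < length fs \<Longrightarrow> Q i \<subseteq> Q (Suc i)"
    and "\<And>i. i < length fs \<Longrightarrow> fs ! i \<in> Q (Suc i)"
    and "\<And>i g. i < length fs \<Longrightarrow> g \<in> polys V \<Longrightarrow> fs ! i * g \<in> Q i \<Longrightarrow> g \<in> Q i"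
    and "1 \<notin> Q (length fs)"
    and "finite E" "E \<noteq> {}" "\<And>ks. ks \<in> E \<Longrightarrow> length ks = length fs" "\<And>ks. ks \<in> E \<Longrightarrow> a ks \<noteq> 0"
    and "(\<Sum>ks\<in>E. const (a ks) * power_product fs ks) \<in> Q 0"
  shows False
  using assms
proof (induction fs arbitrary: Q E a)
  case Nil
  then have "E = {[]}" by auto
  then have "const (a []) \<in> Q 0" using Nil.prems(10) by simp
  then show False using poly_ideal_const_one[of V "Q 0"] Nil.prems(1)[of 0] Nil.prems(5) Nil.prems(9)[of "[]"] \<open>E = {[]}\<close>
    by simp
next
  case (Cons f fs)
  have Q0: "poly_ideal V (Q 0)" and Q1: "poly_ideal V (Q 1)"
    using Cons.prems(1)[of 0] Cons.prems(1)[of 1] by auto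
  have f: "f \<in> Q 1" using Cons.prems(3)[of 0] by simp
  then have fV: "f \<in> polys V" using poly_idealD(1)[OF Q1] by blast
  have nth_polys: "(f # fs) ! i \<in> polys V" if "i < length (f # fs)" for i
    using Cons.prems(3)[OF that] poly_idealD(1)[OF Cons.prems(1)[of "Suc i"]] that by auto
  then have fsV: "set fs \<subseteq> polys V" by (force simp: in_set_conv_nth)
  define m where "m = Min (hd ` E)"
  have m_le: "m \<le> hd ks" if "ks \<in> E" for ks unfolding m_def using that Cons.prems(6) by simp
  have "m \<in> hd ` E" unfolding m_def using Cons.prems(6,7) by simp
  have ks: "ks = hd ks # tl ks" "length (tl ks) = length fs" if "ks \<in> E" for ks
    using Cons.prems(8)[OF that] by (cases ks; simp)+
  define g where "g ks = const (a ks) * (f ^ (hd ks - m) * power_product fs (tl ks))" for ks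
  have g: "g ks \<in> polys V" for ks
    unfolding g_def using fV fsV by (intro polys_mult polys_const polys_power power_product_polys)
  have "const (a ks) * power_product (f # fs) ks = f ^ m * g ks" if "ks \<in> E" for ks
  proof -
    have "power_product (f # fs) ks = f ^ hd ks * power_product fs (tl ks)"
      by (subst ks(1)[OF that]) simp
    also have "f ^ hd ks = f ^ m * f ^ (hd ks - m)" using m_le[OF that] by (simp add: power_add[symmetric])
    finally show ?thesis unfolding g_def by (simp add: mult_ac)
  qed
  then have "f ^ m * sum g E \<in> Q 0" using Cons.prems(10) by (simp add: sum_distrib_left)
  moreover have "x \<in> polys V \<Longrightarrow> f ^ j * x \<in> Q 0 \<Longrightarrow> x \<in> Q 0" for j x
  proof (induction j arbitrary: x)
    case (Suc j)
    have "f * (f ^ j * x) \<in> Q 0" using Suc.prems(2) by (simp add: mult.assoc)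
    then have "f ^ j * x \<in> Q 0"
      using Cons.prems(4)[of 0 "f ^ j * x"] polys_mult[OF polys_power[OF fV] Suc.prems(1)] by simp
    then show ?case using Suc by blast
  qed simp
  ultimately have "sum g E \<in> Q 0" using polys_sum[of E g V] g by blast
  then have sumQ1: "sum g E \<in> Q 1" using Cons.prems(2)[of 0] by auto
  define E0 where "E0 = {ks \<in> E. hd ks = m}"
  have "g ks \<in> Q 1" if "ks \<in> E - E0" for ks
  proof -
    have "hd ks - m = Suc (hd ks - m - 1)" using m_le[of ks] that unfolding E0_def by force
    then have "g ks = (const (a ks) * (f ^ (hd ks - m - 1) * power_product fs (tl ks))) * f"
      unfolding g_def by (metis (no_types, lifting) power_Suc mult.assoc mult.commute)
    then show ?thesis
      using poly_idealD(4)[OF Q1 _ f] fV fsV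
      by (metis polys_mult polys_const polys_power power_product_polys)
  qed
  then have "sum g (E - E0) \<in> Q 1" by (rule poly_ideal_sum[OF Q1])
  moreover have "sum g E0 = sum g E - sum g (E - E0)"
    using sum.subset_diff[of E0 E g] Cons.prems(6) unfolding E0_def by auto
  ultimately have "sum g E0 \<in> Q 1" using poly_ideal_diff[OF Q1 sumQ1] by simp
  moreover have inj: "inj_on tl E0"
    by (rule inj_onI) (metis (mono_tags, lifting) E0_def ks(1) mem_Collect_eq)
  have "sum g E0 = (\<Sum>ks\<in>tl ` E0. const (a (m # ks)) * power_product fs ks)"
    unfolding sum.reindex[OF inj] comp_def
  proof (rule sum.cong[OF refl])
    fix ks assume k: "ks \<in> E0"
    then have "ks = m # tl ks" using ks(1)[of ks] unfolding E0_def by auto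
    then show "g ks = const (a (m # tl ks)) * power_product fs (tl ks)"
      unfolding g_def using k by (simp add: E0_def)
  qed
  ultimately have *: "(\<Sum>ks\<in>tl ` E0. const (a (m # ks)) * power_product fs ks) \<in> Q 1" by simp
  have tlE0: "m # ks \<in> E" if "ks \<in> tl ` E0" for ks using that ks(1) unfolding E0_def by force
  show False
  proof (rule Cons.IH[of "\<lambda>i. Q (Suc i)" "tl ` E0" "\<lambda>ks. a (m # ks)"])
    show "finite (tl ` E0)" "tl ` E0 \<noteq> {}"
      using Cons.prems(6) \<open>m \<in> hd ` E\<close> unfolding E0_def by auto
    show "length ks = length fs" if "ks \<in> tl ` E0" for ks using Cons.prems(8)[OF tlE0[OF that]] by simp
    show "a (m # ks) \<noteq> 0" if "ks \<in> tl ` E0" for ks using Cons.prems(9)[OF tlE0[OF that]] .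
    show "(\<Sum>ks\<in>tl ` E0. const (a (m # ks)) * power_product fs ks) \<in> Q (Suc 0)" using * by simp
    show "poly_ideal V (Q (Suc i))" if "i \<le> length fs" for i using Cons.prems(1)[of "Suc i"] that by simp
    show "Q (Suc i) \<subseteq> Q (Suc (Suc i))" if "i < length fs" for i using Cons.prems(2)[of "Suc i"] that by simp
    show "fs ! i \<in> Q (Suc (Suc i))" if "i < length fs" for i using Cons.prems(3)[of "Suc i"] that by simp
    show "g \<in> Q (Suc i)" if "i < length fs" "g \<in> polys V" "fs ! i * g \<in> Q (Suc i)" for i g
      using Cons.prems(4)[of "Suc i" g] that by simp
    show "1 \<notin> Q (Suc (length fs))" using Cons.prems(5) by simp
  qed
qed

lemma mon_deg_keys_mult:
  assumes "\<And>u. u \<in> Poly_Mapping.keys p \<Longrightarrow> mon_deg u \<le> i" "\<And>u. u \<in> Poly_Mapping.keys q \<Longrightarrow> mon_deg u \<le> j"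
    and "u \<in> Poly_Mapping.keys (p * q)"
  shows "mon_deg u \<le> i + j"
proof -
  have "u \<in> {a + b |a b. a \<in> Poly_Mapping.keys p \<and> b \<in> Poly_Mapping.keys q}"
    using assms(3) keys_mult by (rule rev_subsetD)
  then obtain a b where "u = a + b" "a \<in> Poly_Mapping.keys p" "b \<in> Poly_Mapping.keys q" by blast
  then show ?thesis using assms(1)[of a] assms(2)[of b] by (simp add: mon_deg_add)
qed

lemma mon_deg_power_product:
  fixes fs :: "('v, 'k::field) mpoly list"
  assumes "\<And>f u. f \<in> set fs \<Longrightarrow> u \<in> Poly_Mapping.keys f \<Longrightarrow> mon_deg u \<le> D"
    and "u \<in> Poly_Mapping.keys (power_product fs ks)"
  shows "mon_deg u \<le> D * sum_list ks"
  using assms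
proof (induction fs ks arbitrary: u rule: power_product.induct)
  case (1 f fs k ks)
  have "mon_deg w \<le> D * j" if "w \<in> Poly_Mapping.keys (f ^ j)" for j w
    using that
  proof (induction j arbitrary: w)
    case (Suc j)
    have "mon_deg w \<le> D + D * j"
      by (rule mon_deg_keys_mult[of f D "f ^ j" "D * j"]) (use Suc 1 in auto)
    then show ?case by simp
  qed simp
  then have "mon_deg u \<le> D * k + D * sum_list ks"
    by (rule mon_deg_keys_mult[of "f ^ k" _ "power_product fs ks"]) (use 1 in auto)
  then show ?case by (simp add: distrib_left)
qed auto

lemma card_bounded_monomials:
  assumes "finite F"
  shows "finite {u. Poly_Mapping.keys u \<subseteq> F \<and> mon_deg u \<le> N}"
    and "card {u. Poly_Mapping.keys u \<subseteq> F \<and> mon_deg u \<le> N} \<le> Suc N ^ card F"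
proof -
  let ?S = "{u. Poly_Mapping.keys u \<subseteq> F \<and> mon_deg u \<le> N}"
  let ?h = "\<lambda>g. \<Sum>x\<in>F. Poly_Mapping.single x (g x)"
  have fin: "finite (F \<rightarrow>\<^sub>E {..N})" using assms by (intro finite_PiE) auto
  have sub: "?S \<subseteq> ?h ` (F \<rightarrow>\<^sub>E {..N})"
  proof
    fix u assume u: "u \<in> ?S"
    have le: "Poly_Mapping.lookup u x \<le> N" for x
    proof -
      have "Poly_Mapping.lookup u x \<le> mon_deg u"
      proof (cases "x \<in> Poly_Mapping.keys u")
        case True
        then show ?thesis unfolding mon_deg_def by (intro member_le_sum) auto
      qed (simp add: in_keys_iff)
      then show ?thesis using u by auto
    qed
    have "?h (restrict (Poly_Mapping.lookup u) F) = u"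
    proof (rule poly_mapping_eqI)
      fix x
      have "Poly_Mapping.lookup (?h (restrict (Poly_Mapping.lookup u) F)) x =
          (\<Sum>y\<in>F. if y = x then Poly_Mapping.lookup u x else 0)"
        unfolding lookup_sum by (intro sum.cong) (auto simp: lookup_single)
      then show "Poly_Mapping.lookup (?h (restrict (Poly_Mapping.lookup u) F)) x = Poly_Mapping.lookup u x"
        using u assms by (auto simp: in_keys_iff subset_iff)
    qed
    then show "u \<in> ?h ` (F \<rightarrow>\<^sub>E {..N})"
      using le by (intro image_eqI[of _ _ "restrict (Poly_Mapping.lookup u) F"]) auto
  qed
  show "finite ?S" by (rule finite_subset[OF sub finite_imageI[OF fin]])
  have "card ?S \<le> card (?h ` (F \<rightarrow>\<^sub>E {..N}))" by (rule card_mono[OF finite_imageI[OF fin] sub])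
  also have "\<dots> \<le> card (F \<rightarrow>\<^sub>E {..N})" by (rule card_image_le[OF fin])
  also have "\<dots> = Suc N ^ card F" using assms by (simp add: card_PiE)
  finally show "card ?S \<le> Suc N ^ card F" .
qed

text \<open>There are M^(d+1) products with exponents below M, but the monomials supported on faces
  that they can involve number at most a constant times M^d, since a face has at most d vertices. So
  for large M the products are linearly dependent modulo the nonfaces.\<close>

lemma algebraic_relation_exists:
  fixes fs :: "('v, 'k::field) mpoly list"
  assumes fs: "set fs \<subseteq> polys V" and Fs: "finite Fs" "\<And>F. F \<in> Fs \<Longrightarrow> finite F \<and> card F \<le> d"
    and cover: "\<And>\<tau>. \<tau> \<in> \<Delta> \<Longrightarrow> \<exists>F\<in>Fs. \<tau> \<subseteq> F" and len: "length fs = Suc d"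
  obtains E a where "finite E" "E \<noteq> {}" "\<forall>ks\<in>E. length ks = length fs \<and> a ks \<noteq> 0"
    "(\<Sum>ks\<in>E. const (a ks) * power_product fs ks) \<in> nonface_polys V \<Delta>"
proof -
  \<comment> \<open>A common degree bound for the polynomials; inserting 1 makes the set
    nonempty.\<close>
  define D where "D = Max (insert 1 (\<Union>f\<in>set fs. mon_deg ` Poly_Mapping.keys f))"
  have D: "mon_deg u \<le> D" if "f \<in> set fs" "u \<in> Poly_Mapping.keys f" for f u
    unfolding D_def using that by (intro Max_ge) auto
  define B where "B = D * Suc d"
  \<comment> \<open>One more than the constant in the bound of the number of monomials by a multiple
    of M^d.\<close>
  define M where "M = Suc (card Fs * (2 * B + 1) ^ d)"
  define L where "L = {ks. set ks \<subseteq> {..<M} \<and> length ks = Suc d}"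
  define T where "T = {u. Poly_Mapping.keys u \<in> \<Delta> \<and> mon_deg u \<le> B * M}"
  have L: "finite L" "card L = M ^ Suc d" unfolding L_def
    by (simp_all add: finite_lists_length_eq card_lists_length_eq)
  have sub: "T \<subseteq> (\<Union>F\<in>Fs. {u. Poly_Mapping.keys u \<subseteq> F \<and> mon_deg u \<le> B * M})"
    unfolding T_def using cover by blast
  have finU: "finite (\<Union>F\<in>Fs. {u. Poly_Mapping.keys u \<subseteq> F \<and> mon_deg u \<le> B * M})"
    using Fs card_bounded_monomials(1) by blast
  have "M > 0" unfolding M_def by simp
  have "card T \<le> card (\<Union>F\<in>Fs. {u. Poly_Mapping.keys u \<subseteq> F \<and> mon_deg u \<le> B * M})"
    by (rule card_mono[OF finU sub])
  also have "\<dots> \<le> (\<Sum>F\<in>Fs. card {u. Poly_Mapping.keys u \<subseteq> F \<and> mon_deg u \<le> B * M})"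
    by (rule card_UN_le[OF Fs(1)])
  also have "\<dots> \<le> (\<Sum>F\<in>Fs. Suc (B * M) ^ d)"
  proof (rule sum_mono)
    fix F assume F: "F \<in> Fs"
    have "card {u. Poly_Mapping.keys u \<subseteq> F \<and> mon_deg u \<le> B * M} \<le> Suc (B * M) ^ card F"
      using card_bounded_monomials(2) Fs(2)[OF F] by blast
    also have "\<dots> \<le> Suc (B * M) ^ d" using Fs(2)[OF F] by (intro power_increasing) auto
    finally show "card {u. Poly_Mapping.keys u \<subseteq> F \<and> mon_deg u \<le> B * M} \<le> Suc (B * M) ^ d" .
  qed
  also have "\<dots> = card Fs * Suc (B * M) ^ d" by simp
  also have "\<dots> \<le> card Fs * ((2 * B + 1) * M) ^ d"
    using \<open>M > 0\<close> by (intro mult_left_mono power_mono) (auto simp: distrib_right)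
  also have "\<dots> = (card Fs * (2 * B + 1) ^ d) * M ^ d" by (simp only: power_mult_distrib mult.assoc)
  also have "\<dots> < M * M ^ d" using \<open>M > 0\<close> unfolding M_def by (intro mult_strict_right_mono) auto
  finally have "card T < card L" using L by simp
  moreover have "finite T" by (rule finite_subset[OF sub finU])
  ultimately obtain a where a: "\<exists>ks\<in>L. a ks \<noteq> 0"
    "\<forall>u\<in>T. (\<Sum>ks\<in>L. a ks * Poly_Mapping.lookup (power_product fs ks) u) = 0"
    using homogeneous_system_solution[of T L "\<lambda>ks. Poly_Mapping.lookup (power_product fs ks)"] L(1) by blast
  define E where "E = {ks \<in> L. a ks \<noteq> 0}"
  let ?s = "\<Sum>ks\<in>E. const (a ks) * power_product fs ks"
  have "?s = (\<Sum>ks\<in>L. const (a ks) * power_product fs ks)"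
    unfolding E_def using L(1) by (intro sum.mono_neutral_left) auto
  then have lookup: "Poly_Mapping.lookup ?s u = (\<Sum>ks\<in>L. a ks * Poly_Mapping.lookup (power_product fs ks) u)" for u
    by (simp add: lookup_sum lookup_const_mult)
  have "Poly_Mapping.lookup ?s u = 0" if u: "Poly_Mapping.keys u \<in> \<Delta>" for u
  proof (cases "u \<in> T")
    case True
    then show ?thesis using a(2) lookup by simp
  next
    case False
    have "Poly_Mapping.lookup (power_product fs ks) u = 0" if ks: "ks \<in> L" for ks
    proof (rule ccontr)
      assume "Poly_Mapping.lookup (power_product fs ks) u \<noteq> 0"
      then have "mon_deg u \<le> D * sum_list ks"
        by (intro mon_deg_power_product[OF D]) (auto simp: in_keys_iff)
      also have "\<dots> \<le> D * (length ks * M)"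
      proof (rule mult_left_mono)
        have "\<forall>k\<in>set ks. k \<le> M" using ks unfolding L_def by auto
        then show "sum_list ks \<le> length ks * M" by (induction ks) auto
      qed simp
      also have "\<dots> = B * M" using ks unfolding L_def B_def by (simp add: algebra_simps)
      finally show False using False u unfolding T_def by simp
    qed
    then show ?thesis unfolding lookup by simp
  qed
  moreover have "?s \<in> polys V" using fs by (intro polys_sum polys_mult polys_const power_product_polys)
  ultimately have "?s \<in> nonface_polys V \<Delta>" unfolding nonface_polys_def by (auto simp: in_keys_iff)
  moreover have "finite E" "E \<noteq> {}" using L(1) a(1) unfolding E_def by auto
  moreover have "\<forall>ks\<in>E. length ks = length fs \<and> a ks \<noteq> 0" using len unfolding E_def L_def by auto
  ultimately show ?thesis by (intro that)
qed

text \<open>One bound for two purposes. The partial ideals of a regular sequence form such a chain,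
  and so do prime ideals, with \<open>f i\<close> any element of the next prime that is not in the
  previous one. Thus depth and Krull dimension are bounded together.\<close>

lemma chain_length_le:
  fixes Q :: "nat \<Rightarrow> ('v, 'k::field) mpoly set"
  assumes Fs: "finite Fs" "\<And>F. F \<in> Fs \<Longrightarrow> finite F \<and> card F \<le> d"
    and cover: "\<And>\<tau>. \<tau> \<in> \<Delta> \<Longrightarrow> \<exists>F\<in>Fs. \<tau> \<subseteq> F"
    and Q: "\<And>i. i \<le> l \<Longrightarrow> poly_ideal V (Q i)" "nonface_polys V \<Delta> \<subseteq> Q 0" "\<And>i. i < l \<Longrightarrow> Q i \<subseteq> Q (Suc i)"
    and f: "\<And>i. i < l \<Longrightarrow> f i \<in> Q (Suc i)"
      "\<And>i g. i < l \<Longrightarrow> g \<in> polys V \<Longrightarrow> f i * g \<in> Q i \<Longrightarrow> g \<in> Q i"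
    and proper: "1 \<notin> Q l"
  shows "l \<le> d"
proof (rule ccontr)
  assume "\<not> l \<le> d"
  then have l: "Suc d \<le> l" by simp
  define fs where "fs = map f [0..<Suc d]"
  have len: "length fs = Suc d" unfolding fs_def by simp
  have nth: "fs ! i = f i" if "i < Suc d" for i
    using that unfolding fs_def by (auto simp del: upt_Suc)
  have "f i \<in> polys V" if "i < Suc d" for i
    using f(1)[of i] poly_idealD(1)[OF Q(1)[of "Suc i"]] that l by auto
  then have fsV: "set fs \<subseteq> polys V" unfolding fs_def by auto
  obtain E a where Ea: "finite E" "E \<noteq> {}" "\<forall>ks\<in>E. length ks = length fs \<and> a ks \<noteq> 0"
    "(\<Sum>ks\<in>E. const (a ks) * power_product fs ks) \<in> nonface_polys V \<Delta>"
    using algebraic_relation_exists[OF fsV Fs cover len] .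
  have mono: "i \<le> j \<Longrightarrow> j \<le> l \<Longrightarrow> Q i \<subseteq> Q j" for i j
  proof (induction j)
    case (Suc j)
    then show ?case using Q(3)[of j] by (cases "i = Suc j") auto
  qed simp
  show False
  proof (rule no_relation_along_chain[of fs V Q E a])
    show "1 \<notin> Q (length fs)" using proper mono[of "Suc d" l] l len by auto
    show "(\<Sum>ks\<in>E. const (a ks) * power_product fs ks) \<in> Q 0" using Ea(4) Q(2) by blast
    show "poly_ideal V (Q i)" if "i \<le> length fs" for i using Q(1)[of i] that l len by simp
    show "Q i \<subseteq> Q (Suc i)" if "i < length fs" for i using Q(3)[of i] that l len by simp
    show "fs ! i \<in> Q (Suc i)" if "i < length fs" for i using f(1)[of i] nth[of i] that l len by simp
    show "g \<in> Q i" if "i < length fs" "g \<in> polys V" "fs ! i * g \<in> Q i" for i g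
      using f(2)[of i g] nth[of i] that l len by simp
  qed (use Ea(1-3) in auto)
qed

section \<open>Descending chains of subspaces of finite codimension\<close>

definition poly_subspace :: "('v, 'k::field) mpoly set \<Rightarrow> bool" where
  "poly_subspace N \<longleftrightarrow> (\<forall>p\<in>N. \<forall>q\<in>N. p + q \<in> N) \<and> (\<forall>c. \<forall>p\<in>N. const c * p \<in> N)"

lemma poly_subspaceD:
  assumes "poly_subspace N"
  shows "p \<in> N \<Longrightarrow> q \<in> N \<Longrightarrow> p + q \<in> N" "p \<in> N \<Longrightarrow> const c * p \<in> N" "p \<in> N \<Longrightarrow> q \<in> N \<Longrightarrow> p - q \<in> N"
proof -
  show *: "p \<in> N \<Longrightarrow> q \<in> N \<Longrightarrow> p + q \<in> N" "p \<in> N \<Longrightarrow> const c * p \<in> N" for p q c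
    using assms unfolding poly_subspace_def by blast+
  show "p - q \<in> N" if "p \<in> N" "q \<in> N"
    using *(1)[OF that(1) *(2)[OF that(2), of "-1"]] by (simp add: single_uminus)
qed

text \<open>The intersections with the span without x stabilize by induction. Each space exceeds its
  intersection by at most one dimension: either some space of the chain has no such excess and the
  chain follows the intersections from there on, or all have it, and equal intersections mean equal
  spaces.\<close>

lemma finite_codimension_stabilizes:
  fixes K :: "nat \<Rightarrow> ('v, 'k::field) mpoly set"
  defines "U W m A \<equiv> {f. \<exists>c. f - (\<Sum>b\<in>A. const (c b) * m b) \<in> W}"
  assumes "finite B" and W: "poly_subspace W"
    and "\<And>n. poly_subspace (K n)" "\<And>n. K (Suc n) \<subseteq> K n" "K 0 \<subseteq> U W m B" "\<And>n. W \<subseteq> K n"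
  shows "\<exists>N. \<forall>n\<ge>N. K n = K N"
  using assms(2,4-)
proof (induction B arbitrary: K rule: finite_induct)
  case empty
  have "K n \<subseteq> K 0" for n by (induction n) (use empty in auto)
  moreover have "K 0 \<subseteq> W" using empty.prems(3) unfolding U_def by auto
  ultimately have "K n = W" for n using empty.prems(4)[of n] by blast
  then show ?case by blast
next
  case (insert x B)
  have mono: "n \<le> k \<Longrightarrow> K k \<subseteq> K n" for n k
    by (rule lift_Suc_antimono_le[of K, OF insert.prems(2)])
  have subU: "poly_subspace (U W m B)"
    unfolding poly_subspace_def
  proof (intro conjI allI ballI)
    fix p q assume "p \<in> U W m B" "q \<in> U W m B"
    then obtain c d where "p - (\<Sum>b\<in>B. const (c b) * m b) \<in> W" "q - (\<Sum>b\<in>B. const (d b) * m b) \<in> W"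
      unfolding U_def by blast
    from poly_subspaceD(1)[OF W this]
    have "p + q - (\<Sum>b\<in>B. const (c b + d b) * m b) \<in> W"
      by (simp add: single_add distrib_right sum.distrib algebra_simps)
    then show "p + q \<in> U W m B" unfolding U_def by (intro CollectI exI[of _ "\<lambda>b. c b + d b"])
  next
    fix a p assume "p \<in> U W m B"
    then obtain c where "p - (\<Sum>b\<in>B. const (c b) * m b) \<in> W" unfolding U_def by blast
    from poly_subspaceD(2)[OF W this, of a]
    have "const a * p - (\<Sum>b\<in>B. const (a * c b) * m b) \<in> W"
      by (simp only: const_mult right_diff_distrib sum_distrib_left mult.assoc)
    then show "const a * p \<in> U W m B" unfolding U_def by (intro CollectI exI[of _ "\<lambda>b. a * c b"])
  qed
  define K' where "K' n = K n \<inter> U W m B" for n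
  have WU: "W \<subseteq> U W m B" unfolding U_def
    by (intro subsetI CollectI exI[of _ "\<lambda>_. 0"]) simp
  have "\<exists>N. \<forall>n\<ge>N. K' n = K' N"
  proof (rule insert.IH)
    show "poly_subspace (K' n)" for n
      using insert.prems(1)[of n] subU unfolding K'_def poly_subspace_def by blast
    show "K' (Suc n) \<subseteq> K' n" for n using insert.prems(2)[of n] unfolding K'_def by blast
    show "K' 0 \<subseteq> U W m B" "W \<subseteq> K' n" for n using insert.prems(4)[of n] WU unfolding K'_def by blast+
  qed
  then obtain N where N: "\<And>n. n \<ge> N \<Longrightarrow> K' n = K' N" by blast
  show ?case
  proof (cases "\<exists>M. K M \<subseteq> U W m B")
    case True
    then obtain M where M: "K M \<subseteq> U W m B" by blast
    have "K n = K' n" if "n \<ge> M" for n using mono[OF that] M unfolding K'_def by blast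
    then have "K n = K (max M N)" if "n \<ge> max M N" for n using N[of n] N[of "max M N"] that by simp
    then show ?thesis by blast
  next
    case False
    have decomp: "\<exists>c u. f = const c * m x + u \<and> u \<in> U W m B" if "f \<in> K n" for f n
    proof -
      have "f \<in> U W m (insert x B)" using mono[of 0 n] that insert.prems(3) by blast
      then obtain c where c: "f - (\<Sum>b\<in>insert x B. const (c b) * m b) \<in> W" unfolding U_def by blast
      then have "f - const (c x) * m x - (\<Sum>b\<in>B. const (c b) * m b) \<in> W"
        using insert.hyps by (simp add: diff_diff_eq)
      then have "f - const (c x) * m x \<in> U W m B" unfolding U_def by blast
      then show ?thesis by (intro exI[of _ "c x"] exI[of _ "f - const (c x) * m x"]) simp
    qed
    have "K n = K N" if n: "n \<ge> N" for n
    proof (intro equalityI mono[OF n] subsetI)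
      fix g assume g: "g \<in> K N"
      \<comment> \<open>An element of the smaller space outside the span has a nonzero coefficient
        at x; a multiple of it moves g into the intersection.\<close>
      obtain f where f: "f \<in> K n" "f \<notin> U W m B" using False by blast
      obtain c u where cu: "f = const c * m x + u" "u \<in> U W m B" using decomp[OF f(1)] by blast
      obtain c' u' where cu': "g = const c' * m x + u'" "u' \<in> U W m B" using decomp[OF g] by blast
      have "c \<noteq> 0" using f(2) cu by auto
      define a where "a = c' / c"
      have "const a * (const c * m x) = const c' * m x"
        using \<open>c \<noteq> 0\<close> by (simp only: mult.assoc[symmetric] const_mult[symmetric]) (simp add: a_def)
      then have "g - const a * f = u' - const a * u" unfolding cu(1) cu'(1) by (simp add: distrib_left)
      then have "g - const a * f \<in> U W m B" using poly_subspaceD[OF subU] cu(2) cu'(2) by metis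
      moreover have "const a * f \<in> K n" by (rule poly_subspaceD(2)[OF insert.prems(1) f(1)])
      moreover have "const a * f \<in> K N" using calculation(2) mono[OF n] by blast
      then have "g - const a * f \<in> K N" using poly_subspaceD(3)[OF insert.prems(1) g] by blast
      ultimately have "g - const a * f \<in> K' N" unfolding K'_def by blast
      then have "g - const a * f \<in> K n" using N[OF n] unfolding K'_def by blast
      then have "g - const a * f + const a * f \<in> K n"
        using poly_subspaceD(1)[OF insert.prems(1)] \<open>const a * f \<in> K n\<close> by blast
      then show "g \<in> K n" by simp
    qed
    then show ?thesis by blast
  qed
qed

section \<open>Translation to ideals and quotients of ring records\<close>

section \<open>Ideals of polynomial rings and their quotients\<close>

lemma poly_ring_simps [simp]:
  "carrier (poly_ring K V) = polys V" "monoid.mult (poly_ring K V) = (*)" "one (poly_ring K V) = 1"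
  "zero (poly_ring K V) = 0" "add (poly_ring K V) = (+)"
  by (simp_all add: poly_ring_def polys_def)

lemma cring_poly_ring: "cring (poly_ring TYPE('k::field) (V :: 'v set))"
proof (rule cringI)
  show "abelian_group (poly_ring TYPE('k) V)"
  proof (rule abelian_groupI)
    fix p :: "('v, 'k) mpoly" assume "p \<in> carrier (poly_ring TYPE('k) V)"
    then show "\<exists>q\<in>carrier (poly_ring TYPE('k) V). q \<oplus>\<^bsub>poly_ring TYPE('k) V\<^esub> p = \<zero>\<^bsub>poly_ring TYPE('k) V\<^esub>"
      by (intro bexI[of _ "- p"]) (auto intro: polys_uminus)
  qed (simp_all add: polys_add add_ac)
  show "comm_monoid (poly_ring TYPE('k) V)"
    by (rule comm_monoidI) (simp_all add: polys_mult mult_ac)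
qed (simp add: distrib_right)

lemma minus_poly_ring:
  assumes "p \<in> polys V" shows "\<ominus>\<^bsub>poly_ring TYPE('k::field) V\<^esub> p = - (p :: ('v, 'k) mpoly)"
proof -
  interpret cring "poly_ring TYPE('k) V" by (rule cring_poly_ring)
  show ?thesis using assms polys_uminus[OF assms] by (intro minus_equality) simp_all
qed

lemma ideal_poly_ring: "ideal N (poly_ring TYPE('k::field) V) \<longleftrightarrow> poly_ideal V (N :: ('v, 'k) mpoly set)"
proof
  assume "ideal N (poly_ring TYPE('k) V)"
  then interpret ideal N "poly_ring TYPE('k) V" .
  show "poly_ideal V N"
    unfolding poly_ideal_def
    using a_subset additive_subgroup.zero_closed[OF additive_subgroup_axioms]
      additive_subgroup.a_closed[OF additive_subgroup_axioms] I_l_closed by auto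
next
  assume N: "poly_ideal V N"
  interpret cring "poly_ring TYPE('k) V" by (rule cring_poly_ring)
  show "ideal N (poly_ring TYPE('k) V)"
  proof (rule idealI)
    show "subgroup N (add_monoid (poly_ring TYPE('k) V))"
    proof (rule subgroup.intro)
      fix p assume p: "p \<in> N"
      have "inv\<^bsub>add_monoid (poly_ring TYPE('k) V)\<^esub> p = - p"
        using minus_poly_ring[of p V] p poly_idealD(1)[OF N] unfolding a_inv_def by blast
      then show "inv\<^bsub>add_monoid (poly_ring TYPE('k) V)\<^esub> p \<in> N"
        using poly_ideal_diff[OF N poly_idealD(2)[OF N] p] by simp
    qed (use poly_idealD[OF N] in auto)
    fix p c assume "p \<in> N" "c \<in> carrier (poly_ring TYPE('k) V)"
    then show "c \<otimes>\<^bsub>poly_ring TYPE('k) V\<^esub> p \<in> N" "p \<otimes>\<^bsub>poly_ring TYPE('k) V\<^esub> c \<in> N"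
      using poly_idealD(4)[OF N, of c p] by (simp_all add: mult.commute)
  qed (rule ring_axioms)
qed

lemma genideal_poly_ring_subset:
  assumes "poly_ideal V N" "S \<subseteq> N"
  shows "Idl\<^bsub>poly_ring TYPE('k::field) V\<^esub> S \<subseteq> (N :: ('v, 'k) mpoly set)"
proof -
  interpret cring "poly_ring TYPE('k) V" by (rule cring_poly_ring)
  show ?thesis by (rule genideal_minimal) (use assms ideal_poly_ring in auto)
qed

lemma poly_ideal_genideal:
  assumes "S \<subseteq> polys V"
  shows "poly_ideal V (Idl\<^bsub>poly_ring TYPE('k::field) V\<^esub> (S :: ('v, 'k) mpoly set))"
    and "S \<subseteq> Idl\<^bsub>poly_ring TYPE('k::field) V\<^esub> S"
proof -
  interpret cring "poly_ring TYPE('k) V" by (rule cring_poly_ring)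
  show "poly_ideal V (Idl\<^bsub>poly_ring TYPE('k::field) V\<^esub> S)"
    unfolding ideal_poly_ring[symmetric] by (rule genideal_ideal) (simp add: assms)
  show "S \<subseteq> Idl\<^bsub>poly_ring TYPE('k::field) V\<^esub> S" by (rule genideal_self) (simp add: assms)
qed

text \<open>Every monomial is divisible by the squarefree monomial of its support.\<close>

lemma sr_ideal_eq:
  fixes V :: "'v set"
  assumes V: "finite V" and \<Delta>: "down_closed \<Delta>"
  shows "sr_ideal TYPE('k::field) V \<Delta> = nonface_polys V \<Delta>"
proof -
  let ?S = "{(\<Prod>x\<in>\<sigma>. var x) |\<sigma>. \<sigma> \<subseteq> V \<and> \<sigma> \<notin> \<Delta>} :: ('v, 'k) mpoly set"
  have S: "?S \<subseteq> nonface_polys V \<Delta>"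
  proof
    fix p assume "p \<in> ?S"
    then obtain \<sigma> where \<sigma>: "p = mono_poly (indicator_mon \<sigma>)" "\<sigma> \<subseteq> V" "\<sigma> \<notin> \<Delta>" unfolding prod_var by blast
    moreover have "finite \<sigma>" using \<sigma>(2) V by (rule finite_subset)
    ultimately show "p \<in> nonface_polys V \<Delta>" unfolding nonface_polys_def polys_def by simp
  qed
  have I: "poly_ideal V (nonface_polys V \<Delta> :: ('v, 'k) mpoly set)"
    unfolding poly_ideal_def
    by (simp add: nonface_polys_subset nonface_polys_add nonface_polys_mult[OF \<Delta>])
  have SV: "?S \<subseteq> polys V" using S nonface_polys_subset by blast
  show ?thesis unfolding sr_ideal_def
  proof (intro equalityI genideal_poly_ring_subset I S subsetI)
    fix f assume f: "f \<in> (nonface_polys V \<Delta> :: ('v, 'k) mpoly set)"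
    let ?I = "Idl\<^bsub>poly_ring TYPE('k::field) V\<^esub> ?S"
    show "f \<in> ?I"
    proof (induction f rule: poly_induct)
      case zero
      show ?case by (rule poly_idealD(2)[OF poly_ideal_genideal(1)[OF SV]])
    next
      case (single u c)
      then have u: "Poly_Mapping.keys u \<subseteq> V" "Poly_Mapping.keys u \<notin> \<Delta>"
        using f unfolding nonface_polys_def polys_def by auto
      have "finite (Poly_Mapping.keys u)" by simp
      then obtain w where w: "u = indicator_mon (Poly_Mapping.keys u) + w" "Poly_Mapping.keys w \<subseteq> Poly_Mapping.keys u"
        using mon_split[of "Poly_Mapping.keys u" u] by (metis in_keys_iff)
      have "mono_poly (indicator_mon (Poly_Mapping.keys u)) \<in> ?I"
        using u poly_ideal_genideal(2)[OF SV] unfolding prod_var[symmetric] by blast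
      then have "(const c * mono_poly w) * mono_poly (indicator_mon (Poly_Mapping.keys u)) \<in> ?I"
        using w(2) u(1) by (intro poly_idealD(4)[OF poly_ideal_genideal(1)[OF SV]] polys_mult polys_const polys_mono) auto
      also have "(const c * mono_poly w) * mono_poly (indicator_mon (Poly_Mapping.keys u)) = const c * mono_poly u"
      proof -
        have "mono_poly u = (mono_poly (indicator_mon (Poly_Mapping.keys u)) * mono_poly w :: ('v, 'k) mpoly)"
          unfolding mono_poly_mult[symmetric] w(1)[symmetric] ..
        then show ?thesis by (simp add: mult_ac)
      qed
      finally show ?case .
    qed (rule poly_idealD(3)[OF poly_ideal_genideal(1)[OF SV]])
  qed
qed

context ring begin

lemma coset_in_image_iff:
  assumes "ideal I R" "ideal K R" "I \<subseteq> K" "f \<in> carrier R"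
  shows "I +> f \<in> (+>) I ` K \<longleftrightarrow> f \<in> K"
proof -
  have "(\<Union>j\<in>K. I +> j) = K" using ideal_incl_iff[OF assms(1,2)] assms(3) by simp
  then show ?thesis
    using canonical_proj_vimage_mem_iff[OF assms(1)
      additive_subgroup.a_subset[OF ideal.axioms(1)[OF ring_ideal_imp_quot_ideal[OF assms(1,2)]]] assms(4)]
    by simp
qed

lemma coset_eq_zero_iff:
  assumes "ideal I R" "f \<in> carrier R" shows "I +> f = \<zero>\<^bsub>R Quot I\<^esub> \<longleftrightarrow> f \<in> I"
proof -
  interpret ideal I R by fact
  have "\<zero>\<^bsub>R Quot I\<^esub> = I" by (simp add: FactRing_def)
  then show ?thesis using a_rcos_const a_rcos_self[OF assms(2)] by auto
qed

lemma quot_carrier: "carrier (R Quot I) = (+>) I ` carrier R"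
  by (auto simp: FactRing_def A_RCOSETS_def')

end

section \<open>Depth, dimension and Artinian reduction of the Stanley-Reisner ring\<close>

context level_shelling begin

abbreviation P :: "('v, 'k) mpoly ring" where "P \<equiv> poly_ring TYPE('k) V"

definition \<pi> :: "('v, 'k) mpoly \<Rightarrow> ('v, 'k) mpoly set" where "\<pi> = a_r_coset P I"

definition R :: "('v, 'k) mpoly set ring" where "R = P Quot I"

interpretation P: cring P by (rule cring_poly_ring)

lemma poly_ideal_I: "poly_ideal V I"
  unfolding poly_ideal_def using I_subset I_zero I_add I_mult by blast

lemma ideal_I: "ideal I P" using poly_ideal_I ideal_poly_ring by blast

lemma cring_R: "cring R"
  unfolding R_def by (rule ideal.quotient_is_cring[OF ideal_I cring_poly_ring])

interpretation R: cring R by (rule cring_R)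

lemma pi_hom: "ring_hom_ring P R \<pi>"
  unfolding R_def \<pi>_def by (rule ideal.rcos_ring_hom_ring[OF ideal_I])

interpretation pi: ring_hom_ring P R \<pi> by (rule pi_hom)

lemma carrier_R: "carrier R = \<pi> ` polys V"
  unfolding R_def \<pi>_def P.quot_carrier by simp

lemma pi_closed: "f \<in> polys V \<Longrightarrow> \<pi> f \<in> carrier R" unfolding carrier_R by blast

lemma pi_mult: "f \<in> polys V \<Longrightarrow> g \<in> polys V \<Longrightarrow> \<pi> (f * g) = \<pi> f \<otimes>\<^bsub>R\<^esub> \<pi> g"
  using pi.hom_mult[of f g] by simp

lemma pi_zero_iff: "f \<in> polys V \<Longrightarrow> \<pi> f = \<zero>\<^bsub>R\<^esub> \<longleftrightarrow> f \<in> I"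
  unfolding R_def \<pi>_def using P.coset_eq_zero_iff[OF ideal_I, of f] by simp

lemma pi_image_iff: "poly_ideal V K \<Longrightarrow> I \<subseteq> K \<Longrightarrow> f \<in> polys V \<Longrightarrow> \<pi> f \<in> \<pi> ` K \<longleftrightarrow> f \<in> K"
  unfolding \<pi>_def using P.coset_in_image_iff[OF ideal_I, of K f] by (simp add: ideal_poly_ring)

lemma ideal_pi_image: "poly_ideal V K \<Longrightarrow> ideal (\<pi> ` K) R"
  unfolding \<pi>_def R_def using P.ring_ideal_imp_quot_ideal[OF ideal_I, of K] by (simp add: ideal_poly_ring)

lemma poly_ideal_vimage: "ideal K R \<Longrightarrow> poly_ideal V {f \<in> polys V. \<pi> f \<in> K}"
  using pi.ideal_vimage[of K] by (simp add: ideal_poly_ring)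

lemma I_subset_vimage: "ideal K R \<Longrightarrow> I \<subseteq> {f \<in> polys V. \<pi> f \<in> K}"
  using pi_zero_iff I_subset additive_subgroup.zero_closed[OF ideal.axioms(1)] by fastforce

abbreviation W :: "nat \<Rightarrow> ('v, 'k) mpoly set" where "W k \<equiv> modulo k (polys V)"

lemma poly_ideal_W: "poly_ideal V (W k)"
proof -
  have "W k \<subseteq> polys V"
  proof
    fix f assume "f \<in> W k"
    then obtain s where s: "s \<in> combinations \<theta> k (polys V)" "f - s \<in> I" unfolding modulo_def by blast
    obtain h where "\<And>l. h l \<in> polys V" "s = (\<Sum>l<k. \<theta> l * h l)" using s(1) by (rule combinationsE) blast
    then have "s \<in> polys V" by (simp add: polys_sum polys_mult theta_in_polys)
    then have "f - s + s \<in> polys V" using s(2) I_subset by (intro polys_add) auto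
    then show "f \<in> polys V" by simp
  qed
  then show ?thesis unfolding poly_ideal_def
    using modulo_add[OF polys_add] modulo_mult[OF polys_mult] I_subset_modulo[OF polys_zero I_zero] by blast
qed

lemma I_subset_W: "I \<subseteq> W k"
  using I_subset_modulo[OF polys_zero] by blast

lemma theta_in_W: assumes "l < k" shows "\<theta> l \<in> W k"
proof -
  have "(\<Sum>i<k. \<theta> i * of_bool (i = l)) \<in> combinations \<theta> k (polys V)"
    by (intro combinationsI) (simp add: of_bool_def)
  also have "(\<Sum>i<k. \<theta> i * of_bool (i = l)) = \<theta> l"
    using assms by (simp add: of_bool_def if_distrib[of "(*) _"] cong: if_cong)
  finally show ?thesis by (rule combinations_subset_modulo)
qed

lemma W_minimal:
  assumes "poly_ideal V K" "I \<subseteq> K" "\<And>l. l < k \<Longrightarrow> \<theta> l \<in> K" shows "W k \<subseteq> K"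
proof
  fix f assume "f \<in> W k"
  then obtain s where s: "s \<in> combinations \<theta> k (polys V)" "f - s \<in> I" unfolding modulo_def by blast
  obtain h where h: "\<And>l. h l \<in> polys V" "s = (\<Sum>l<k. \<theta> l * h l)" using s(1) by (rule combinationsE) blast
  have "\<theta> l * h l \<in> K" if "l < k" for l
    using poly_idealD(4)[OF assms(1) h(1) assms(3)[OF that]] by (simp add: mult.commute)
  then have "s \<in> K" unfolding h(2) by (intro poly_ideal_sum[OF assms(1)]) auto
  then have "f - s + s \<in> K" using s(2) assms(2) by (intro poly_idealD(3)[OF assms(1)]) auto
  then show "f \<in> K" by simp
qed

lemma genideal_theta: "Idl\<^bsub>R\<^esub> (\<pi> ` \<theta> ` {..<k}) = \<pi> ` W k"
proof
  have sub: "\<pi> ` \<theta> ` {..<k} \<subseteq> carrier R" using pi_closed theta_in_polys by blast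
  show "Idl\<^bsub>R\<^esub> (\<pi> ` \<theta> ` {..<k}) \<subseteq> \<pi> ` W k"
    using theta_in_W by (intro R.genideal_minimal ideal_pi_image poly_ideal_W) auto
  have id: "ideal (Idl\<^bsub>R\<^esub> (\<pi> ` \<theta> ` {..<k})) R" by (rule R.genideal_ideal[OF sub])
  have "W k \<subseteq> {f \<in> polys V. \<pi> f \<in> Idl\<^bsub>R\<^esub> (\<pi> ` \<theta> ` {..<k})}"
    using R.genideal_self[OF sub] theta_in_polys
    by (intro W_minimal poly_ideal_vimage[OF id] I_subset_vimage[OF id]) auto
  then show "\<pi> ` W k \<subseteq> Idl\<^bsub>R\<^esub> (\<pi> ` \<theta> ` {..<k})" by blast
qed

definition xs :: "('v, 'k) mpoly set list" where "xs = map (\<lambda>k. \<pi> (\<theta> k)) [0..<d]"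

lemma set_take_xs: "i \<le> d \<Longrightarrow> set (take i xs) = \<pi> ` \<theta> ` {..<i}"
  unfolding xs_def by (auto simp: take_map image_image atLeast0LessThan)

lemma length_xs: "length xs = d" unfolding xs_def by simp

lemma regular_sequence_xs: "regular_sequence R xs"
  unfolding regular_sequence_def length_xs
proof (intro conjI allI impI ballI)
  show "set xs \<subseteq> carrier R" using pi_closed theta_in_polys unfolding xs_def by auto
  have "set xs = \<pi> ` \<theta> ` {..<d}" using set_take_xs[of d] length_xs by simp
  moreover have "\<pi> 1 \<notin> \<pi> ` W d"
    using pi_image_iff[OF poly_ideal_W I_subset_W polys_one, of d] one_not_in_modulo by simp
  ultimately show "Idl\<^bsub>R\<^esub> set xs \<noteq> carrier R"
    using genideal_theta[of d] pi_closed[OF polys_one] by metis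
  fix i r assume i: "i < d" and r: "r \<in> carrier R"
    and eq: "xs ! i \<otimes>\<^bsub>R\<^esub> r \<in> Idl\<^bsub>R\<^esub> set (take i xs)"
  obtain f where f: "f \<in> polys V" "r = \<pi> f" using r unfolding carrier_R by blast
  have "\<pi> (\<theta> i * f) \<in> \<pi> ` W i"
    using eq i unfolding set_take_xs[OF less_imp_le[OF i]] genideal_theta f(2)
    by (simp add: xs_def pi_mult[OF theta_in_polys f(1)])
  then have "\<theta> i * f \<in> W i"
    using pi_image_iff[OF poly_ideal_W I_subset_W] polys_mult[OF theta_in_polys f(1)] by blast
  then have "f \<in> W i" using regular i f(1) unfolding regular_on_def modulo_def by blast
  then show "r \<in> Idl\<^bsub>R\<^esub> set (take i xs)"
    unfolding set_take_xs[OF less_imp_le[OF i]] genideal_theta f(2) by blast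
qed

lemma chain_bound:
  assumes "\<And>i. i \<le> l \<Longrightarrow> poly_ideal V (Q i)" "I \<subseteq> Q 0" "\<And>i. i < l \<Longrightarrow> Q i \<subseteq> Q (Suc i)"
    and "\<And>i. i < l \<Longrightarrow> f i \<in> Q (Suc i)"
    and "\<And>i g. i < l \<Longrightarrow> g \<in> polys V \<Longrightarrow> f i * g \<in> Q i \<Longrightarrow> g \<in> Q i"
    and "1 \<notin> Q l"
  shows "l \<le> d"
proof (rule chain_length_le[of Fs d \<Delta> l V Q f])
  show "\<exists>F\<in>Fs. \<tau> \<subseteq> F" if "\<tau> \<in> \<Delta>" for \<tau> using cover[OF that] by blast
  show "nonface_polys V \<Delta> \<subseteq> Q 0" using assms(2) unfolding I_def .
qed (use assms up.finite_Fs facet_finite card_facet in auto)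

lemma regular_sequence_length_le:
  assumes "regular_sequence R ys" shows "length ys \<le> d"
proof -
  have ys: "set ys \<subseteq> carrier R"
    "\<And>i r. i < length ys \<Longrightarrow> r \<in> carrier R \<Longrightarrow> ys ! i \<otimes>\<^bsub>R\<^esub> r \<in> Idl\<^bsub>R\<^esub> set (take i ys) \<Longrightarrow> r \<in> Idl\<^bsub>R\<^esub> set (take i ys)"
    "Idl\<^bsub>R\<^esub> set ys \<noteq> carrier R"
    using assms unfolding regular_sequence_def by blast+
  define K where "K i = Idl\<^bsub>R\<^esub> set (take i ys)" for i
  have sub: "set (take i ys) \<subseteq> carrier R" for i by (rule subset_trans[OF set_take_subset ys(1)])
  have K: "ideal (K i) R" for i unfolding K_def by (rule R.genideal_ideal[OF sub])
  define Q where "Q i = {f \<in> polys V. \<pi> f \<in> K i}" for i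
  have "\<exists>f. f \<in> polys V \<and> \<pi> f = ys ! i" if "i < length ys" for i
  proof -
    have "ys ! i \<in> \<pi> ` polys V" using ys(1) that nth_mem unfolding carrier_R by blast
    then show ?thesis by auto
  qed
  then obtain f where f: "\<And>i. i < length ys \<Longrightarrow> f i \<in> polys V \<and> \<pi> (f i) = ys ! i" by metis
  show ?thesis
  proof (rule chain_bound[of "length ys" Q f])
    show "poly_ideal V (Q i)" for i unfolding Q_def by (rule poly_ideal_vimage[OF K])
    show "I \<subseteq> Q 0" unfolding Q_def by (rule I_subset_vimage[OF K])
    show "Q i \<subseteq> Q (Suc i)" if "i < length ys" for i
    proof -
      have "set (take i ys) \<subseteq> set (take (Suc i) ys)" by (rule set_take_subset_set_take) simp
      then have "K i \<subseteq> K (Suc i)" unfolding K_def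
        using R.genideal_self[OF sub, of "Suc i"] by (intro R.genideal_minimal R.genideal_ideal sub) blast
      then show ?thesis unfolding Q_def by blast
    qed
    show "f i \<in> Q (Suc i)" if "i < length ys" for i
    proof -
      have "ys ! i \<in> set (take (Suc i) ys)" using that by (simp add: take_Suc_conv_app_nth)
      then have "ys ! i \<in> K (Suc i)" unfolding K_def using R.genideal_self[OF sub] by blast
      then show ?thesis using f[OF that] unfolding Q_def by simp
    qed
    show "g \<in> Q i" if "i < length ys" "g \<in> polys V" "f i * g \<in> Q i" for i g
      using that f[OF that(1)] ys(2)[OF that(1) pi_closed[OF that(2)]] pi_mult[of "f i" g]
      unfolding Q_def K_def by simp
    show "1 \<notin> Q (length ys)"
    proof
      assume "1 \<in> Q (length ys)"
      then have "\<one>\<^bsub>R\<^esub> \<in> K (length ys)" unfolding Q_def using pi.hom_one by simp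
      then have "K (length ys) = carrier R" by (rule ideal.one_imp_carrier[OF K])
      then show False using ys(3) unfolding K_def by simp
    qed
  qed
qed

definition A :: "nat \<Rightarrow> ('v, 'k) mpoly set set" where
  "A = quot_grading P (poly_grading TYPE('k) V) I"

lemma A_eq: "A n = \<pi> ` poly_grading TYPE('k) V n"
  unfolding A_def quot_grading_def \<pi>_def ..

lemma poly_grading_eq: "poly_grading TYPE('k) V n = {p \<in> polys V. \<forall>u\<in>Poly_Mapping.keys p. mon_deg u = n}"
  unfolding poly_grading_def by simp

lemma keys_linear_form: "u \<in> Poly_Mapping.keys (linear_form V s) \<Longrightarrow> mon_deg u = 1"
proof -
  assume "u \<in> Poly_Mapping.keys (linear_form V s)"
  then have "u \<in> (\<Union>v\<in>V. Poly_Mapping.keys (const (s v) * var v))"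
    unfolding linear_form_def by (rule subsetD[OF keys_sum])
  then show ?thesis using keys_mult_const unfolding var_def by fastforce
qed

lemma theta_in_A: "\<pi> (\<theta> k) \<in> A 1"
  unfolding A_eq poly_grading_eq using theta_in_polys keys_linear_form unfolding \<theta>_def by blast

lemma A_subset: "A n \<subseteq> carrier R"
  unfolding A_eq poly_grading_eq using pi_closed by blast

lemma A_irrelevant: "1 \<le> n \<Longrightarrow> A n \<subseteq> irrelevant_ideal R A"
proof -
  assume "1 \<le> n"
  then have "A n \<subseteq> (\<Union>d\<in>{1..}. A d)" by auto
  also have "\<dots> \<subseteq> Idl\<^bsub>R\<^esub> (\<Union>d\<in>{1..}. A d)" using A_subset by (intro R.genideal_self) blast
  finally show ?thesis unfolding irrelevant_ideal_def .
qed

lemma graded_depth_R: "graded_depth R A = enat d"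
  unfolding graded_depth_def
proof (rule antisym)
  show "Sup {enat (length xs) |xs. regular_sequence R xs \<and> set xs \<subseteq> irrelevant_ideal R A} \<le> enat d"
    by (intro Sup_least) (auto intro: regular_sequence_length_le)
  have "set xs \<subseteq> irrelevant_ideal R A"
    using theta_in_A A_irrelevant[of 1] unfolding xs_def by auto
  then show "enat d \<le> Sup {enat (length xs) |xs. regular_sequence R xs \<and> set xs \<subseteq> irrelevant_ideal R A}"
    using regular_sequence_xs length_xs by (intro Sup_upper) (metis (mono_tags, lifting) mem_Collect_eq)
qed

lemma prime_chain_length_le:
  assumes P: "\<And>i. i \<le> l \<Longrightarrow> primeideal (p i) R" and less: "\<And>i. i < l \<Longrightarrow> p i \<subset> p (Suc i)"
  shows "l \<le> d"
proof -
  define Q where "Q i = {f \<in> polys V. \<pi> f \<in> p i}" for i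
  have id: "ideal (p i) R" if "i \<le> l" for i using P[OF that] by (rule primeideal.axioms(1))
  have "\<exists>f. f \<in> polys V \<and> \<pi> f \<in> p (Suc i) - p i" if "i < l" for i
  proof -
    obtain y where y: "y \<in> p (Suc i)" "y \<notin> p i" using less \<open>i < l\<close> by blast
    then have "y \<in> carrier R" using ideal.Icarr[OF id[of "Suc i"]] that by simp
    then show ?thesis using y unfolding carrier_R by blast
  qed
  then obtain f where f: "\<And>i. i < l \<Longrightarrow> f i \<in> polys V \<and> \<pi> (f i) \<in> p (Suc i) - p i" by metis
  show ?thesis
  proof (rule chain_bound[of l Q f])
    show "poly_ideal V (Q i)" if "i \<le> l" for i unfolding Q_def by (rule poly_ideal_vimage[OF id[OF that]])
    show "I \<subseteq> Q 0" unfolding Q_def by (rule I_subset_vimage[OF id]) simp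
    show "Q i \<subseteq> Q (Suc i)" if "i < l" for i using less[OF that] unfolding Q_def by blast
    show "f i \<in> Q (Suc i)" if "i < l" for i using f[OF that] unfolding Q_def by blast
    show "g \<in> Q i" if "i < l" "g \<in> polys V" "f i * g \<in> Q i" for i g
      using that f[OF that(1)] pi_mult[of "f i" g] pi_closed[of "f i"] pi_closed[OF that(2)]
        primeideal.I_prime[OF P[of i], of "\<pi> (f i)" "\<pi> g"]
      unfolding Q_def by auto
    show "1 \<notin> Q l"
    proof
      assume "1 \<in> Q l"
      then have "\<one>\<^bsub>R\<^esub> \<in> p l" unfolding Q_def using pi.hom_one by simp
      then have "carrier R = p l" by (metis ideal.one_imp_carrier id order_refl)
      then show False using primeideal.I_notcarr[OF P[of l]] by simp
    qed
  qed
qed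

text \<open>A facet F gives the chain: the substitutions \<open>\<alpha> i\<close> kill the
  variables outside F and the first i vertices of F. They map into a polynomial ring, so their
  kernels are prime, and the variable of the next vertex shows that each inclusion is
  strict.\<close>

lemma prime_chain_exists:
  obtains p where "\<And>i. i \<le> d \<Longrightarrow> primeideal (p i) R" "\<And>i. i < d \<Longrightarrow> p i \<subset> p (Suc i)"
proof -
  obtain F where F: "F \<in> Fs" using cover[OF \<Delta>(3)] by blast
  obtain h where h: "bij_betw h {..<d} F"
    using ex_bij_betw_nat_finite[OF facet_finite[OF F]] card_facet[OF F] by (metis atLeast0LessThan)
  define g where "g = inv_into {..<d} h"
  have g: "g (h i) = i" "h i \<in> F" if "i < d" for i
    using that h unfolding g_def by (auto simp: bij_betw_def inv_into_f_f)
  define \<alpha> :: "nat \<Rightarrow> ('v, 'k) mpoly \<Rightarrow> (nat, 'k) mpoly"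
    where "\<alpha> i = subst (\<lambda>x. if x \<in> F \<and> i \<le> g x then var (g x) else 0)" for i
  define Q where "Q i = {f \<in> polys V. \<alpha> i f = 0}" for i
  have Q: "poly_ideal V (Q i)" for i
    unfolding poly_ideal_def Q_def \<alpha>_def
    by (auto intro: polys_add polys_mult simp: subst_add subst_mult)
  have IQ: "I \<subseteq> Q i" for i
  proof
    fix f assume f: "f \<in> I"
    have "\<alpha> i f = 0" unfolding \<alpha>_def
    proof (rule subst_eq_zero)
      fix u assume "u \<in> Poly_Mapping.keys f"
      then have "Poly_Mapping.keys u \<notin> \<Delta>" using f unfolding I_def nonface_polys_def by blast
      then have "\<not> Poly_Mapping.keys u \<subseteq> F" using F Fs down_closedD[OF \<Delta>(2)] by blast
      then show "\<exists>x\<in>Poly_Mapping.keys u. (if x \<in> F \<and> i \<le> g x then var (g x) else 0) = (0 :: (nat, 'k) mpoly)"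
        by auto
    qed
    then show "f \<in> Q i" using f I_subset unfolding Q_def by blast
  qed
  show ?thesis
  proof (rule that[of "\<lambda>i. \<pi> ` Q i"])
    show "primeideal (\<pi> ` Q i) R" for i
    proof (rule primeidealI)
      show "ideal (\<pi> ` Q i) R" by (rule ideal_pi_image[OF Q])
      show "cring R" by (rule cring_R)
      have "1 \<notin> Q i" unfolding Q_def \<alpha>_def by simp
      then have "\<pi> 1 \<notin> \<pi> ` Q i" using pi_image_iff[OF Q IQ polys_one] by simp
      then show "carrier R \<noteq> \<pi> ` Q i" using pi_closed[OF polys_one] by blast
      fix a b assume "a \<in> carrier R" "b \<in> carrier R" and ab: "a \<otimes>\<^bsub>R\<^esub> b \<in> \<pi> ` Q i"
      then obtain p q where pq: "p \<in> polys V" "q \<in> polys V" "a = \<pi> p" "b = \<pi> q" unfolding carrier_R by blast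
      then have "p * q \<in> Q i"
        using ab pi_mult[of p q] pi_image_iff[OF Q IQ polys_mult[OF pq(1,2)], of i] by simp
      then have "\<alpha> i p * \<alpha> i q = 0" unfolding Q_def \<alpha>_def by (simp add: subst_mult)
      then have "\<alpha> i p = 0 \<or> \<alpha> i q = 0" by simp
      then show "a \<in> \<pi> ` Q i \<or> b \<in> \<pi> ` Q i" using pq unfolding Q_def by blast
    qed
    show "\<pi> ` Q i \<subset> \<pi> ` Q (Suc i)" if i: "i < d" for i
    proof -
      have "\<alpha> (Suc i) f = subst (\<lambda>k. if Suc i \<le> k then var k else 0) (\<alpha> i f)" for f
        unfolding \<alpha>_def subst_subst by (rule subst_cong) auto
      then have "Q i \<subseteq> Q (Suc i)" unfolding Q_def by auto
      moreover have "h i \<in> V" using g[OF i] facet_subset[OF F] by blast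
      then have hV: "var (h i) \<in> polys V" by (rule polys_var)
      have "Poly_Mapping.keys (var i :: (nat, 'k) mpoly) \<noteq> {}" unfolding var_def by simp
      then have "(var i :: (nat, 'k) mpoly) \<noteq> 0" by auto
      then have "var (h i) \<notin> Q i" "var (h i) \<in> Q (Suc i)"
        using g[OF i] hV unfolding Q_def \<alpha>_def by auto
      then have "\<pi> (var (h i)) \<notin> \<pi> ` Q i" "\<pi> (var (h i)) \<in> \<pi> ` Q (Suc i)"
        using pi_image_iff[OF Q IQ hV, of i] by auto
      ultimately show ?thesis by blast
    qed
  qed
qed

lemma krull_dim_R: "krull_dim R = enat d"
  unfolding krull_dim_def
proof (rule antisym)
  show "Sup {enat l |l. \<exists>P :: nat \<Rightarrow> _. (\<forall>i\<le>l. primeideal (P i) R) \<and> (\<forall>i<l. P i \<subset> P (Suc i))} \<le> enat d"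
  proof (rule Sup_least)
    fix x assume "x \<in> {enat l |l. \<exists>P :: nat \<Rightarrow> _. (\<forall>i\<le>l. primeideal (P i) R) \<and> (\<forall>i<l. P i \<subset> P (Suc i))}"
    then obtain l p where "x = enat l" "\<forall>i\<le>l. primeideal (p i) R" "\<forall>i<l. p i \<subset> p (Suc i)" by blast
    then show "x \<le> enat d" using prime_chain_length_le[of l p] by simp
  qed
  show "enat d \<le> Sup {enat l |l. \<exists>P :: nat \<Rightarrow> _. (\<forall>i\<le>l. primeideal (P i) R) \<and> (\<forall>i<l. P i \<subset> P (Suc i))}"
  proof (rule Sup_upper, rule CollectI)
    obtain p where "\<And>i. i \<le> d \<Longrightarrow> primeideal (p i) R" "\<And>i. i < d \<Longrightarrow> p i \<subset> p (Suc i)"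
      by (rule prime_chain_exists) blast
    then show "\<exists>l. enat d = enat l \<and> (\<exists>P :: nat \<Rightarrow> _. (\<forall>i\<le>l. primeideal (P i) R) \<and> (\<forall>i<l. P i \<subset> P (Suc i)))"
      by (intro exI[of _ d] conjI refl exI[of _ p]) simp_all
  qed
qed

lemma cohen_macaulay_R: "cohen_macaulay R A"
  unfolding cohen_macaulay_def graded_depth_R krull_dim_R ..

definition JR :: "('v, 'k) mpoly set set" where "JR = Idl\<^bsub>R\<^esub> set xs"

lemma JR_eq: "JR = \<pi> ` W d"
  using set_take_xs[of d] length_xs genideal_theta[of d] unfolding JR_def by simp

lemma ideal_JR: "ideal JR R" unfolding JR_eq by (rule ideal_pi_image[OF poly_ideal_W])

definition \<psi> :: "('v, 'k) mpoly \<Rightarrow> ('v, 'k) mpoly set set" where "\<psi> f = JR +>\<^bsub>R\<^esub> \<pi> f"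

lemma psi_hom: "ring_hom_ring P (R Quot JR) \<psi>"
proof -
  interpret J: ring_hom_ring R "R Quot JR" "(+>\<^bsub>R\<^esub>) JR" by (rule ideal.rcos_ring_hom_ring[OF ideal_JR])
  have "(+>\<^bsub>R\<^esub>) JR \<circ> \<pi> \<in> Ring.ring_hom P (R Quot JR)"
    using ring_hom_trans pi.homh J.homh by blast
  then show ?thesis
    unfolding \<psi>_def comp_def using P.ring_axioms J.S.ring_axioms by (intro ring_hom_ringI2)
qed

lemma psi_zero_iff: "f \<in> polys V \<Longrightarrow> \<psi> f = \<zero>\<^bsub>R Quot JR\<^esub> \<longleftrightarrow> f \<in> W d"
  unfolding \<psi>_def using R.coset_eq_zero_iff[OF ideal_JR pi_closed[of f]]
    pi_image_iff[OF poly_ideal_W I_subset_W, of f d] by (simp add: JR_eq)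

lemma carrier_quot_JR: "carrier (R Quot JR) = \<psi> ` polys V"
  unfolding R.quot_carrier carrier_R \<psi>_def by auto

text \<open>By \<open>span\<close>, the quotient is a vector space spanned by the finitely many
  restriction monomials; a chain of ideals is pulled back to a chain of subspaces of
  polynomials.\<close>

lemma artinian_quotient: "artinian (R Quot JR)"
  unfolding artinian_def
proof (intro allI impI)
  fix K :: "nat \<Rightarrow> _" assume K: "\<forall>i. ideal (K i) (R Quot JR) \<and> K (Suc i) \<subseteq> K i"
  interpret psi: ring_hom_ring P "R Quot JR" \<psi> by (rule psi_hom)
  define L where "L i = {f \<in> polys V. \<psi> f \<in> K i}" for i
  have L: "poly_ideal V (L i)" for i
    unfolding L_def ideal_poly_ring[symmetric] using psi.ideal_vimage[of "K i"] K by simp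
  have WL: "W d \<subseteq> L i" for i
  proof
    fix f assume f: "f \<in> W d"
    then have fV: "f \<in> polys V" using poly_idealD(1)[OF poly_ideal_W] by blast
    then have "\<psi> f = \<zero>\<^bsub>R Quot JR\<^esub>" using psi_zero_iff f by simp
    moreover have "\<zero>\<^bsub>R Quot JR\<^esub> \<in> K i"
      using K additive_subgroup.zero_closed[OF ideal.axioms(1)] by blast
    ultimately show "f \<in> L i" using fV unfolding L_def by simp
  qed
  have sub: "poly_subspace N" if "poly_ideal V N" for N :: "('v, 'k) mpoly set"
    unfolding poly_subspace_def using poly_idealD(3,4)[OF that] polys_const by blast
  have "\<exists>N. \<forall>n\<ge>N. L n = L N"
  proof (rule finite_codimension_stabilizes[OF up.finite_Fs sub[OF poly_ideal_W] sub[OF L] _ _ WL])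
    show "L (Suc n) \<subseteq> L n" for n using K unfolding L_def by blast
    show "L 0 \<subseteq> {f. \<exists>c. f - (\<Sum>F\<in>Fs. const (c F) * mono_poly (indicator_mon (r F))) \<in> W d}"
    proof
      fix f assume "f \<in> L 0"
      then have "f \<in> polys V" unfolding L_def by simp
      then obtain c s where "s \<in> combinations \<theta> d (polys V)"
        "f - (\<Sum>F\<in>Fs. const (c F) * mono_poly (indicator_mon (r F))) - s \<in> I" by (rule span)
      then show "f \<in> {f. \<exists>c. f - (\<Sum>F\<in>Fs. const (c F) * mono_poly (indicator_mon (r F))) \<in> W d}"
        unfolding modulo_def by blast
    qed
  qed
  then obtain N where N: "\<And>n. n \<ge> N \<Longrightarrow> L n = L N" by blast
  have "K i = \<psi> ` L i" for i
  proof -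
    have "ideal (K i) (R Quot JR)" using K by blast
    then have "K i \<subseteq> \<psi> ` polys V" unfolding carrier_quot_JR[symmetric] by (intro subsetI) (rule ideal.Icarr)
    then show ?thesis unfolding L_def by auto
  qed
  then have "K n = K N" if "n \<ge> N" for n using N[OF that] by metis
  then show "\<exists>N. \<forall>i\<ge>N. K i = K N" by blast
qed

lemma homogeneous_sop_xs: "homogeneous_sop R A xs"
  unfolding homogeneous_sop_def length_xs krull_dim_R JR_def[symmetric]
  using artinian_quotient theta_in_A unfolding xs_def by (auto intro!: exI[of _ 1])

lemma socle_concentrated: "socle (R Quot JR) (quot_grading R A JR) \<subseteq> quot_grading R A JR e"
proof
  interpret psi: ring_hom_ring P "R Quot JR" \<psi> by (rule psi_hom)
  have grading: "quot_grading R A JR n = \<psi> ` poly_grading TYPE('k) V n" for n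
    unfolding quot_grading_def A_eq \<psi>_def by auto
  fix s assume s: "s \<in> socle (R Quot JR) (quot_grading R A JR)"
  then have "s \<in> carrier (R Quot JR)" unfolding socle_def by blast
  then obtain f where f: "f \<in> polys V" "s = \<psi> f" unfolding carrier_quot_JR by blast
  have var: "var v * f \<in> W d" if v: "v \<in> V" for v
  proof -
    have vV: "var v \<in> polys V" using v by (rule polys_var)
    have "var v \<in> poly_grading TYPE('k) V 1" using vV unfolding poly_grading_eq var_def by simp
    then have "\<psi> (var v) \<in> quot_grading R A JR 1" unfolding grading by blast
    moreover have "quot_grading R A JR n \<subseteq> carrier (R Quot JR)" for n
      unfolding grading carrier_quot_JR poly_grading_eq by blast
    ultimately have "\<psi> (var v) \<in> irrelevant_ideal (R Quot JR) (quot_grading R A JR)"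
      unfolding irrelevant_ideal_def using psi.S.genideal_self[of "\<Union>d\<in>{1..}. quot_grading R A JR d"] by force
    then have "\<psi> (var v) \<otimes>\<^bsub>R Quot JR\<^esub> s = \<zero>\<^bsub>R Quot JR\<^esub>" using s unfolding socle_def by blast
    then have "\<psi> (var v * f) = \<zero>\<^bsub>R Quot JR\<^esub>" using psi.hom_mult[of "var v" f] vV f by simp
    then show ?thesis using psi_zero_iff[OF polys_mult[OF vV f(1)]] by simp
  qed
  obtain g where g: "g \<in> polys V" "\<And>u. u \<in> Poly_Mapping.keys g \<Longrightarrow> mon_deg u = e" "f - g \<in> W d"
    using socle_degree[OF f(1) var] by blast
  have "\<psi> (f - g) = \<zero>\<^bsub>R Quot JR\<^esub>" using psi_zero_iff[OF polys_diff[OF f(1) g(1)]] g(3) by simp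
  moreover have "\<psi> (f - g + g) = \<psi> (f - g) \<oplus>\<^bsub>R Quot JR\<^esub> \<psi> g"
    using psi.hom_add[of "f - g" g] polys_diff[OF f(1) g(1)] g(1) by simp
  moreover have "\<psi> g \<in> carrier (R Quot JR)" unfolding carrier_quot_JR using g(1) by blast
  ultimately have "\<psi> f = \<psi> g" by simp
  moreover have "g \<in> poly_grading TYPE('k) V e" unfolding poly_grading_eq using g by blast
  ultimately show "s \<in> quot_grading R A JR e" unfolding grading f(2) by blast
qed

theorem level: "level_complex TYPE('k) V \<Delta>"
proof -
  have "sr_ideal TYPE('k) V \<Delta> = I" unfolding I_def by (rule sr_ideal_eq[OF finV \<Delta>(2)])
  then have "sr_ring TYPE('k) V \<Delta> = R" unfolding sr_ring_def R_def by simp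
  then show ?thesis
    unfolding level_complex_def level_algebra_def \<open>sr_ideal TYPE('k) V \<Delta> = I\<close> A_def[symmetric]
    using cohen_macaulay_R homogeneous_sop_xs socle_concentrated
    unfolding JR_def Let_def by auto
qed

end

section \<open>The parametrization by row and column variables, and initial monomials\<close>

section \<open>The initial ideal of the 2-minors\<close>

definition margins :: "(nat \<times> nat) mon \<Rightarrow> (nat + nat) mon" where
  "margins w = (\<Sum>v\<in>Poly_Mapping.keys w. Poly_Mapping.single (Inl (fst v)) (Poly_Mapping.lookup w v) +
     Poly_Mapping.single (Inr (snd v)) (Poly_Mapping.lookup w v))"

text \<open>The Segre parametrization, sending the variable of a cell to a row variable times a
  column variable. The exponents of the image of a monomial are its row sums and column
  sums.\<close>

definition margin_var :: "nat \<times> nat \<Rightarrow> (nat + nat, 'k::field) mpoly" where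
  "margin_var v = var (Inl (fst v)) * var (Inr (snd v))"

lemma mono_poly_sum: "mono_poly (\<Sum>x\<in>A. f x) = (\<Prod>x\<in>A. mono_poly (f x) :: ('v, 'k::field) mpoly)"
  by (induction A rule: infinite_finite_induct) (simp_all add: mono_poly_mult)

lemma mon_subst_margin: "mon_subst margin_var w = (mono_poly (margins w) :: (nat + nat, 'k::field) mpoly)"
proof -
  have "margin_var v ^ k = (mono_poly (Poly_Mapping.single (Inl (fst v)) k + Poly_Mapping.single (Inr (snd v)) k) :: (nat + nat, 'k) mpoly)"
    for v k
  proof (induction k)
    case (Suc k)
    have "margin_var v = (mono_poly (Poly_Mapping.single (Inl (fst v)) 1 + Poly_Mapping.single (Inr (snd v)) 1) :: (nat + nat, 'k) mpoly)"
      by (simp add: margin_var_def var_def mono_poly_mult)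
    moreover have "Poly_Mapping.single x (Suc k) = Poly_Mapping.single x 1 + Poly_Mapping.single x k" for x :: "nat + nat"
      by (simp add: single_add[symmetric])
    ultimately show ?case using Suc by (simp only: power_Suc mono_poly_mult mult_ac)
  qed simp
  then show ?thesis unfolding mon_subst_def margins_def mono_poly_sum by simp
qed

lemma lookup_margins:
  assumes "Poly_Mapping.keys w \<subseteq> grid m n"
  shows "i \<in> {1..m} \<Longrightarrow> Poly_Mapping.lookup (margins w) (Inl i) = (\<Sum>j\<in>{1..n}. Poly_Mapping.lookup w (i, j))"
    and "j \<in> {1..n} \<Longrightarrow> Poly_Mapping.lookup (margins w) (Inr j) = (\<Sum>i\<in>{1..m}. Poly_Mapping.lookup w (i, j))"
proof -
  have fin: "finite (grid m n)" by (simp add: grid_def)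
  have "Poly_Mapping.lookup (margins w) (Inl i) =
      (\<Sum>v\<in>Poly_Mapping.keys w. if fst v = i then Poly_Mapping.lookup w v else 0)" for i
    unfolding margins_def by (simp add: lookup_sum lookup_add lookup_single when_def)
  also have "\<dots> i = (\<Sum>v\<in>grid m n. if fst v = i then Poly_Mapping.lookup w v else 0)" for i
    using assms fin by (intro sum.mono_neutral_left) (auto simp: in_keys_iff)
  also have "\<dots> i = (\<Sum>a\<in>{1..m}. \<Sum>j\<in>{1..n}. if a = i then Poly_Mapping.lookup w (a, j) else 0)" for i
    unfolding grid_def sum.cartesian_product by (intro sum.cong) auto
  finally have *: "Poly_Mapping.lookup (margins w) (Inl i) =
    (\<Sum>a\<in>{1..m}. \<Sum>j\<in>{1..n}. if a = i then Poly_Mapping.lookup w (a, j) else 0)" for i .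
  show "Poly_Mapping.lookup (margins w) (Inl i) = (\<Sum>j\<in>{1..n}. Poly_Mapping.lookup w (i, j))" if "i \<in> {1..m}"
    unfolding * using that by (subst sum.swap) simp
  have "Poly_Mapping.lookup (margins w) (Inr j) =
      (\<Sum>v\<in>Poly_Mapping.keys w. if snd v = j then Poly_Mapping.lookup w v else 0)" for j
    unfolding margins_def by (simp add: lookup_sum lookup_add lookup_single when_def)
  also have "\<dots> j = (\<Sum>v\<in>grid m n. if snd v = j then Poly_Mapping.lookup w v else 0)" for j
    using assms fin by (intro sum.mono_neutral_left) (auto simp: in_keys_iff)
  also have "\<dots> j = (\<Sum>i\<in>{1..m}. \<Sum>b\<in>{1..n}. if b = j then Poly_Mapping.lookup w (i, b) else 0)" for j
    unfolding grid_def sum.cartesian_product by (intro sum.cong) auto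
  finally show "Poly_Mapping.lookup (margins w) (Inr j) = (\<Sum>i\<in>{1..m}. Poly_Mapping.lookup w (i, j))"
    if "j \<in> {1..n}" using that by simp
qed

lemma mon_deg_margins:
  assumes "Poly_Mapping.keys w \<subseteq> grid m n"
  shows "mon_deg w = (\<Sum>i\<in>{1..m}. Poly_Mapping.lookup (margins w) (Inl i))"
proof -
  have "mon_deg w = (\<Sum>v\<in>grid m n. Poly_Mapping.lookup w v)"
    by (rule mon_deg_sum) (use assms in \<open>auto simp: grid_def\<close>)
  also have "\<dots> = (\<Sum>i\<in>{1..m}. \<Sum>j\<in>{1..n}. Poly_Mapping.lookup w (i, j))"
    unfolding grid_def sum.cartesian_product by (intro sum.cong) auto
  finally show ?thesis by (simp add: lookup_margins(1)[OF assms])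
qed

lemma subst_margin_minors_ideal:
  assumes "f \<in> minors_ideal TYPE('k::field) m n"
  shows "subst margin_var f = 0"
proof -
  have "poly_ideal (grid m n) {f \<in> polys (grid m n). subst margin_var f = (0 :: (nat + nat, 'k) mpoly)}"
    unfolding poly_ideal_def by (auto intro: polys_add polys_mult simp: subst_add subst_mult)
  moreover have "var (i, j) * var (k, l) - var (i, l) * var (k, j) \<in>
      {f \<in> polys (grid m n). subst margin_var f = (0 :: (nat + nat, 'k) mpoly)}"
    if "i \<in> {1..m}" "k \<in> {1..m}" "j \<in> {1..n}" "l \<in> {1..n}" for i j k l
    using that by (auto intro!: polys_diff polys_mult polys_var
        simp: grid_def subst_diff subst_mult margin_var_def mult_ac)
  ultimately have "minors_ideal TYPE('k) m n \<subseteq>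
      {f \<in> polys (grid m n). subst margin_var f = (0 :: (nat + nat, 'k) mpoly)}"
    unfolding minors_ideal_def by (intro genideal_poly_ring_subset) blast+
  then show ?thesis using assms by blast
qed

text \<open>The Segre parametrization kills f, so the coefficients of f on monomials with equal
  margins sum to 0, and u cannot be alone among them.\<close>

lemma minors_ideal_same_margins:
  fixes f :: "(nat \<times> nat, 'k::field) mpoly"
  assumes f: "f \<in> minors_ideal TYPE('k) m n" and u: "u \<in> Poly_Mapping.keys f"
  obtains w where "w \<in> Poly_Mapping.keys f" "w \<noteq> u" "margins w = margins u"
proof (rule ccontr)
  assume "\<not> thesis"
  then have other: "margins w \<noteq> margins u" if "w \<in> Poly_Mapping.keys f - {u}" for w
    using \<open>\<not> thesis\<close> that \<open>\<And>w. w \<in> Poly_Mapping.keys f \<Longrightarrow> w \<noteq> u \<Longrightarrow> margins w = margins u \<Longrightarrow> thesis\<close> by blast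
  have "0 = Poly_Mapping.lookup (subst margin_var f :: (nat + nat, 'k) mpoly) (margins u)"
    using subst_margin_minors_ideal[OF f] by simp
  also have "\<dots> = (\<Sum>w\<in>Poly_Mapping.keys f. if margins w = margins u then Poly_Mapping.lookup f w else 0)"
    unfolding subst_def mon_subst_margin lookup_sum lookup_const_mult
    by (intro sum.cong) (auto simp: mono_poly_def lookup_single)
  also have "\<dots> = (\<Sum>w\<in>Poly_Mapping.keys f. if w = u then Poly_Mapping.lookup f u else 0)"
    using other by (intro sum.cong) auto
  also have "\<dots> = Poly_Mapping.lookup f u" using u by simp
  finally show False using u by (simp add: in_keys_iff)
qed

lemma minors_ideal_subset: "minors_ideal TYPE('k::field) m n \<subseteq> polys (grid m n)"
proof -
  have "poly_ideal (grid m n) (polys (grid m n) :: (nat \<times> nat, 'k) mpoly set)"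
    unfolding poly_ideal_def by (auto intro: polys_add polys_mult)
  then show ?thesis unfolding minors_ideal_def
    by (rule genideal_poly_ring_subset)
      (auto intro!: polys_diff polys_mult polys_var simp: grid_def)
qed

lemma poly_ideal_minors_ideal: "poly_ideal (grid m n) (minors_ideal TYPE('k::field) m n)"
  unfolding minors_ideal_def
  by (rule poly_ideal_genideal) (auto intro!: polys_diff polys_mult polys_var simp: grid_def)

text \<open>Another monomial of f with the same margins would be smaller, hence would have the
  larger exponent at the smallest variable where the two differ. If this variable is (i, i), then i
  is both a row and a column of u. If it is off the diagonal, everything to its right and below it
  agrees, because such variables are smaller, and \<open>margins_contradiction\<close>
  applies.\<close>

lemma staircase_not_initial:
  fixes f :: "(nat \<times> nat, 'k::field) mpoly"
  assumes f: "f \<in> minors_ideal TYPE('k) m n" and stair: "Poly_Mapping.keys u \<in> staircases n"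
  shows "\<not> is_initial_mon (degrevlex_less var_gt) f u"
proof
  assume init: "is_initial_mon (degrevlex_less var_gt) f u"
  then have u: "u \<in> Poly_Mapping.keys f" unfolding is_initial_mon_def by blast
  obtain w where w: "w \<in> Poly_Mapping.keys f" "w \<noteq> u" "margins w = margins u"
    using minors_ideal_same_margins[OF f u] .
  have grid: "Poly_Mapping.keys u \<subseteq> grid m n" "Poly_Mapping.keys w \<subseteq> grid m n"
    using f minors_ideal_subset u w unfolding polys_def by blast+
  have lt: "degrevlex_less var_gt w u" using init w unfolding is_initial_mon_def by blast
  have "mon_deg w = mon_deg u" unfolding mon_deg_margins[OF grid(1)] mon_deg_margins[OF grid(2)] w(3) ..
  then obtain x where x: "Poly_Mapping.lookup w x > Poly_Mapping.lookup u x"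
    "\<forall>y. var_gt x y \<longrightarrow> Poly_Mapping.lookup w y = Poly_Mapping.lookup u y"
    using lt unfolding degrevlex_less_def by (metis less_irrefl)
  obtain i j where xij: "x = (i, j)" by force
  have ij: "Poly_Mapping.lookup w (i, j) > Poly_Mapping.lookup u (i, j)"
    "\<And>y. var_gt (i, j) y \<Longrightarrow> Poly_Mapping.lookup w y = Poly_Mapping.lookup u y"
    using x unfolding xij by blast+
  then have "(i, j) \<in> Poly_Mapping.keys w" unfolding in_keys_iff by linarith
  then have "(i, j) \<in> grid m n" using grid(2) by blast
  then have mem: "i \<in> {1..m}" "j \<in> {1..n}" by (auto simp: grid_def)
  have rows: "(\<Sum>j\<in>{1..n}. Poly_Mapping.lookup u (i, j)) = (\<Sum>j\<in>{1..n}. Poly_Mapping.lookup w (i, j))"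
    if "i \<in> {1..m}" for i
    unfolding lookup_margins(1)[OF grid(1) that, symmetric] lookup_margins(1)[OF grid(2) that, symmetric] w(3) ..
  have cols: "(\<Sum>i\<in>{1..m}. Poly_Mapping.lookup u (i, j)) = (\<Sum>i\<in>{1..m}. Poly_Mapping.lookup w (i, j))"
    if "j \<in> {1..n}" for j
    unfolding lookup_margins(2)[OF grid(1) that, symmetric] lookup_margins(2)[OF grid(2) that, symmetric] w(3) ..
  have key: "0 < Poly_Mapping.lookup u v \<longleftrightarrow> v \<in> Poly_Mapping.keys u" for v by (auto simp: in_keys_iff)
  show False
  proof (cases "i = j")
    case True
    have "0 < (\<Sum>j\<in>{1..n}. Poly_Mapping.lookup u (i, j))"
      unfolding rows[OF mem(1)] using mem ij(1) by (intro sum_pos2[of _ j]) auto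
    then obtain b where "Poly_Mapping.lookup u (i, b) \<noteq> 0" by (metis less_numeral_extra(3) sum.neutral)
    moreover have "0 < (\<Sum>i\<in>{1..m}. Poly_Mapping.lookup u (i, j))"
      unfolding cols[OF mem(2)] using mem ij(1) by (intro sum_pos2[of _ i]) auto
    then obtain a where "Poly_Mapping.lookup u (a, j) \<noteq> 0" by (metis less_numeral_extra(3) sum.neutral)
    ultimately show False using staircases_neq[OF stair, of i b a j] True by (simp add: in_keys_iff)
  next
    case False
    show False
    proof (rule margins_contradiction[OF _ _ mem rows[OF mem(1)] cols[OF mem(2)] _ ij(1)])
      show "j \<le> b" if "0 < Poly_Mapping.lookup u (a, j)" "0 < Poly_Mapping.lookup u (i, b)" "a < i" for a b
        using staircases_le[OF stair, of a j i b] that unfolding key by blast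
      show "Poly_Mapping.lookup u (i, b) = Poly_Mapping.lookup w (i, b)" if "j < b" for b
        using ij(2)[of "(i, b)"] False that by auto
      show "Poly_Mapping.lookup u (a, j) = Poly_Mapping.lookup w (a, j)" if "i < a" for a
        using ij(2)[of "(a, j)"] False that by auto
    qed auto
  qed
qed

lemma squarefree_divisor:
  assumes "finite \<sigma>" "indicator_mon \<sigma> = u + w"
  shows "Poly_Mapping.keys u \<subseteq> \<sigma>"
  using keys_mon_add[of u w] assms by (metis Un_upper1 keys_indicator_mon)

lemma staircase_monomial_not_initial:
  assumes "\<sigma> \<in> staircases n" "\<sigma> \<subseteq> grid m n"
  shows "(\<Prod>x\<in>\<sigma>. var x) \<notin> initial_minors_ideal TYPE('k::field) m n"
proof
  let ?lt = "degrevlex_less var_gt" and ?J = "minors_ideal TYPE('k) m n"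
  \<comment> \<open>The polynomials all of whose monomials are divisible by an initial monomial: an
    ideal that contains the initial ideal.\<close>
  let ?N = "{p \<in> polys (grid m n) :: (nat \<times> nat, 'k) mpoly set. \<forall>w\<in>Poly_Mapping.keys p. \<exists>u v. w = u + v \<and> (\<exists>f\<in>?J. is_initial_mon ?lt f u)}"
  have fin: "finite \<sigma>" by (rule staircases_finite[OF assms(1)])
  have "poly_ideal (grid m n) ?N" unfolding poly_ideal_def
  proof (intro conjI ballI)
    fix p q :: "(nat \<times> nat, 'k) mpoly" assume p: "p \<in> ?N" and q: "q \<in> ?N"
    show "p + q \<in> ?N" using p q keys_add[of p q] by (auto intro: polys_add)
  next
    fix c p :: "(nat \<times> nat, 'k) mpoly" assume c: "c \<in> polys (grid m n)" and p: "p \<in> ?N"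
    have "\<exists>u v. w = u + v \<and> (\<exists>f\<in>?J. is_initial_mon ?lt f u)" if w: "w \<in> Poly_Mapping.keys (c * p)" for w
    proof -
      have "w \<in> {a + b |a b. a \<in> Poly_Mapping.keys c \<and> b \<in> Poly_Mapping.keys p}"
        using w keys_mult by (rule rev_subsetD)
      then obtain a b where ab: "w = a + b" "b \<in> Poly_Mapping.keys p" by blast
      then obtain u v where uv: "b = u + v" "\<exists>f\<in>?J. is_initial_mon ?lt f u" using p by blast
      have "w = u + (a + v)" unfolding ab(1) uv(1) by (simp add: add_ac)
      then show ?thesis using uv(2) by blast
    qed
    then show "c * p \<in> ?N" using c p polys_mult by blast
  qed auto
  moreover have "{mono_poly u |u. \<exists>f\<in>?J. is_initial_mon ?lt f u} \<subseteq> ?N"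
  proof
    fix p :: "(nat \<times> nat, 'k) mpoly"
    assume "p \<in> {mono_poly u |u. \<exists>f\<in>?J. is_initial_mon ?lt f u}"
    then obtain u f where uf: "p = mono_poly u" "f \<in> ?J" "is_initial_mon ?lt f u" by blast
    then have "u \<in> Poly_Mapping.keys f" unfolding is_initial_mon_def by blast
    then have "Poly_Mapping.keys u \<subseteq> grid m n" using uf(2) minors_ideal_subset unfolding polys_def by blast
    moreover have "u = u + 0" by simp
    ultimately have "\<forall>w\<in>Poly_Mapping.keys p. \<exists>u v. w = u + v \<and> (\<exists>f\<in>?J. is_initial_mon ?lt f u)"
      using uf(2,3) unfolding uf(1) keys_mono_poly by blast
    then show "p \<in> ?N" using polys_mono[OF \<open>Poly_Mapping.keys u \<subseteq> grid m n\<close>] unfolding uf(1) by simp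
  qed
  ultimately have sub: "initial_minors_ideal TYPE('k) m n \<subseteq> ?N"
    unfolding initial_minors_ideal_def initial_ideal_def by (rule genideal_poly_ring_subset)
  assume "(\<Prod>x\<in>\<sigma>. var x) \<in> initial_minors_ideal TYPE('k) m n"
  then have "mono_poly (indicator_mon \<sigma>) \<in> ?N" unfolding prod_var using sub by blast
  then obtain u v f where u: "indicator_mon \<sigma> = u + v" "f \<in> ?J" "is_initial_mon ?lt f u" by auto
  then have "Poly_Mapping.keys u \<in> staircases n"
    using staircases_mono[OF assms(1)] squarefree_divisor[OF fin] by blast
  then show False using staircase_not_initial u by blast
qed

lemma minor_in_ideal:
  assumes "i \<in> {1..m}" "k \<in> {1..m}" "j \<in> {1..n}" "l \<in> {1..n}" "i \<noteq> k" "j \<noteq> l"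
  shows "var (i, j) * var (k, l) - var (i, l) * var (k, j) \<in> minors_ideal TYPE('k::field) m n"
proof -
  let ?J = "minors_ideal TYPE('k) m n"
  have gen: "var (i, j) * var (k, l) - var (i, l) * var (k, j) \<in> ?J"
    if "i \<in> {1..m}" "k \<in> {1..m}" "j \<in> {1..n}" "l \<in> {1..n}" "i < k" "j < l" for i j k l
  proof -
    let ?S = "{var (i, j) * var (k, l) - var (i, l) * var (k, j) |i j k l.
        i \<in> {1..m} \<and> k \<in> {1..m} \<and> j \<in> {1..n} \<and> l \<in> {1..n} \<and> i < k \<and> j < l} :: (nat \<times> nat, 'k) mpoly set"
    have "?S \<subseteq> polys (grid m n)" by (auto intro!: polys_diff polys_mult polys_var simp: grid_def)
    then have "?S \<subseteq> ?J" unfolding minors_ideal_def by (rule poly_ideal_genideal(2))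
    then show ?thesis using that by blast
  qed
  have neg: "- f \<in> ?J" if "f \<in> ?J" for f
    using poly_idealD(4)[OF poly_ideal_minors_ideal polys_uminus[OF polys_one] that] by simp
  consider "i < k" "j < l" | "i < k" "l < j" | "k < i" "j < l" | "k < i" "l < j" using assms by linarith
  then show ?thesis
  proof cases
    case 1 then show ?thesis using gen assms by blast
  next
    case 2 then show ?thesis using neg[OF gen[of i k l j]] assms by (simp add: mult_ac)
  next
    case 3 then show ?thesis using neg[OF gen[of k i j l]] assms by (simp add: mult_ac)
  next
    case 4 then show ?thesis using gen[of k i l j] assms by (simp add: mult_ac)
  qed
qed

text \<open>In a 2-minor, the term with the smallest of the four variables is the smaller term, so
  the product of the opposite pair of corners is initial.\<close>

lemma square_monomial_initial:
  assumes ik: "i \<in> {1..m}" "k \<in> {1..m}" "j \<in> {1..n}" "l \<in> {1..n}" "i \<noteq> k" "j \<noteq> l"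
    and x: "x = (i, l) \<or> x = (k, j)"
    and last: "\<not> var_gt x (i, j)" "\<not> var_gt x (k, l)" "\<not> var_gt x (i, l)" "\<not> var_gt x (k, j)"
    and \<sigma>: "\<sigma> \<subseteq> grid m n" "(i, j) \<in> \<sigma>" "(k, l) \<in> \<sigma>"
  shows "(\<Prod>x\<in>\<sigma>. var x) \<in> initial_minors_ideal TYPE('k::field) m n"
proof -
  let ?lt = "degrevlex_less var_gt" and ?J = "minors_ideal TYPE('k) m n"
  let ?I = "initial_minors_ideal TYPE('k) m n"
  define a b :: "(nat \<times> nat) mon"
    where "a = indicator_mon {(i, l), (k, j)}" and "b = indicator_mon {(i, j), (k, l)}"
  have la: "Poly_Mapping.lookup a y = of_bool (y = (i, l) \<or> y = (k, j))"
    and lb: "Poly_Mapping.lookup b y = of_bool (y = (i, j) \<or> y = (k, l))" for y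
    unfolding a_def b_def by (simp_all add: lookup_indicator_mon)
  have ab: "a \<noteq> b" using la[of "(i, j)"] lb[of "(i, j)"] ik by auto
  have "mon_deg a = mon_deg b" unfolding a_def b_def using ik by simp
  moreover have "Poly_Mapping.lookup a x > Poly_Mapping.lookup b x" using x ik unfolding la lb by auto
  moreover have "\<forall>y. var_gt x y \<longrightarrow> Poly_Mapping.lookup a y = Poly_Mapping.lookup b y"
    using last unfolding la lb by auto
  ultimately have lt: "?lt a b" unfolding degrevlex_less_def by blast
  define f :: "(nat \<times> nat, 'k) mpoly" where "f = mono_poly b - mono_poly a"
  have two: "mono_poly (indicator_mon {v, w}) = (var v * var w :: (nat \<times> nat, 'k) mpoly)" if "v \<noteq> w" for v w
    unfolding prod_var[symmetric] using that by simp
  have f: "f \<in> ?J" unfolding f_def a_def b_def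
    using minor_in_ideal[OF ik] ik two[of "(i, j)" "(k, l)"] two[of "(i, l)" "(k, j)"] by simp
  have "Poly_Mapping.keys f = {a, b}"
    unfolding f_def using ab by (auto simp: in_keys_iff lookup_minus mono_poly_def lookup_single when_def split: if_splits)
  then have init: "is_initial_mon ?lt f b" unfolding is_initial_mon_def using lt by auto
  let ?S = "{mono_poly u |u. \<exists>f\<in>?J. is_initial_mon ?lt f u} :: (nat \<times> nat, 'k) mpoly set"
  have "?S \<subseteq> polys (grid m n)"
  proof
    fix p assume "p \<in> ?S"
    then obtain u f where uf: "p = mono_poly u" "f \<in> ?J" "u \<in> Poly_Mapping.keys f" unfolding is_initial_mon_def by blast
    then have "Poly_Mapping.keys u \<subseteq> grid m n" using minors_ideal_subset unfolding polys_def by blast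
    then show "p \<in> polys (grid m n)" unfolding uf(1) by (rule polys_mono)
  qed
  note I = poly_ideal_genideal[OF this]
  have fin: "finite \<sigma>" using \<sigma>(1) by (rule finite_subset) (simp add: grid_def)
  have eq: "indicator_mon \<sigma> = indicator_mon (\<sigma> - {(i, j), (k, l)}) + b"
  proof -
    have "\<sigma> - {(i, j), (k, l)} \<union> {(i, j), (k, l)} = \<sigma>" using \<sigma> by blast
    then show ?thesis
      using indicator_mon_Un[of "\<sigma> - {(i, j), (k, l)}" "{(i, j), (k, l)}"] fin
      unfolding b_def by (metis Diff_disjoint Int_commute finite.emptyI finite.insertI finite_Diff)
  qed
  have "mono_poly (indicator_mon (\<sigma> - {(i, j), (k, l)})) * mono_poly b \<in> ?I"
    unfolding initial_minors_ideal_def initial_ideal_def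
  proof (rule poly_idealD(4)[OF I(1)])
    show "mono_poly (indicator_mon (\<sigma> - {(i, j), (k, l)})) \<in> polys (grid m n)"
      using fin \<sigma> by (intro polys_mono) auto
    show "mono_poly b \<in> Idl\<^bsub>poly_ring TYPE('k) (grid m n)\<^esub> ?S" using I(2) init f by blast
  qed
  then show ?thesis unfolding prod_var eq mono_poly_mult .
qed

theorem Delta_eq:
  assumes "m \<le> n"
  shows "Delta TYPE('k::field) m n = {\<sigma> \<in> staircases n. fst ` \<sigma> \<subseteq> {1..m}}"
proof (intro equalityI subsetI)
  fix \<sigma> assume "\<sigma> \<in> {\<sigma> \<in> staircases n. fst ` \<sigma> \<subseteq> {1..m}}"
  then have \<sigma>: "\<sigma> \<in> staircases n" "fst ` \<sigma> \<subseteq> {1..m}" by auto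
  have sub: "\<sigma> \<subseteq> grid m n" using \<sigma> staircases_subset[OF \<sigma>(1)] unfolding grid_def by fastforce
  moreover have "\<sigma> \<subseteq> offdiag m n"
    unfolding offdiag_def using sub staircases_neq[OF \<sigma>(1)] by blast
  ultimately show "\<sigma> \<in> Delta TYPE('k) m n"
    using staircase_monomial_not_initial[OF \<sigma>(1) sub] unfolding Delta_def complex_of_ideal_def by blast
next
  fix \<sigma> assume "\<sigma> \<in> Delta TYPE('k) m n"
  then have \<sigma>: "\<sigma> \<subseteq> grid m n" "\<sigma> \<subseteq> offdiag m n"
    and not_initial: "(\<Prod>x\<in>\<sigma>. var x) \<notin> initial_minors_ideal TYPE('k) m n"
    unfolding Delta_def complex_of_ideal_def by auto
  have range: "i \<in> {1..m}" "j \<in> {1..n}" "i \<noteq> j" if "(i, j) \<in> \<sigma>" for i j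
    using that \<sigma> unfolding offdiag_def grid_def by auto
  have "j \<le> l" if a: "(i, j) \<in> \<sigma>" "(k, l) \<in> \<sigma>" "i < k" for i j k l
  proof (rule ccontr)
    assume "\<not> j \<le> l"
    then have "l < j" by simp
    note R = range[OF a(1)] range[OF a(2)]
    have "(\<Prod>x\<in>\<sigma>. var x) \<in> initial_minors_ideal TYPE('k) m n"
    \<comment> \<open>The cells of \<sigma> are off the diagonal, so the smallest corner is (i, l)
      or (k, j). It is (i, l) if this is the only diagonal corner, and (k, j) otherwise, being
      further down.\<close>
    proof (cases "k \<noteq> j \<and> i = l")
      case True
      show ?thesis
        by (rule square_monomial_initial[of i m k j n l "(i, l)"])
          (use R a \<open>l < j\<close> True \<sigma>(1) in auto)
    next
      case False
      show ?thesis
        by (rule square_monomial_initial[of i m k j n l "(k, j)"])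
          (use R a \<open>l < j\<close> False \<sigma>(1) in auto)
    qed
    then show False using not_initial by blast
  qed
  moreover have "fst ` \<sigma> \<inter> snd ` \<sigma> = {}"
  proof (rule ccontr)
    assume "fst ` \<sigma> \<inter> snd ` \<sigma> \<noteq> {}"
    then obtain i j k where a: "(i, j) \<in> \<sigma>" "(k, i) \<in> \<sigma>" by force
    note R = range[OF a(1)] range[OF a(2)]
    have "(\<Prod>x\<in>\<sigma>. var x) \<in> initial_minors_ideal TYPE('k) m n"
    \<comment> \<open>The common index makes (i, i) a corner of the square; only a diagonal corner
      (k, k) with i < k is smaller.\<close>
    proof (cases "k = j \<and> i < k")
      case True
      show ?thesis
        by (rule square_monomial_initial[of i m k j n i "(k, j)"])
          (use R a True \<sigma>(1) in auto)
    next
      case False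
      show ?thesis
        by (rule square_monomial_initial[of i m k j n i "(i, i)"])
          (use R a False \<sigma>(1) in auto)
    qed
    then show False using not_initial by blast
  qed
  moreover have "\<sigma> \<subseteq> {1..n} \<times> {1..n}" "fst ` \<sigma> \<subseteq> {1..m}"
    using range assms by force+
  ultimately show "\<sigma> \<in> {\<sigma> \<in> staircases n. fst ` \<sigma> \<subseteq> {1..m}}"
    unfolding staircases_def by blast
qed

text \<open>All staircases together triangulate the sphere of directions with coordinate sum 0.
  Bounding the rows by m cuts out the directions with nonnegative coordinates beyond m: a
  half-sphere for n = m + 1, in general a ball.\<close>

definition half_sphere :: "nat \<Rightarrow> nat \<Rightarrow> (nat \<times> nat) set set" where
  "half_sphere m n = {\<sigma> \<in> staircases n. fst ` \<sigma> \<subseteq> {1..m}}"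

definition half_facets :: "nat \<Rightarrow> nat \<Rightarrow> (nat \<times> nat) set set" where
  "half_facets m n = {F \<in> facets n. fst ` F \<subseteq> {1..m}}"

text \<open>The boundary consists of the cones on which some coordinate beyond m vanishes. With rows
  up to m, such a coordinate is the sum of the coefficients in its column, so it vanishes on a cone
  iff the column is empty.\<close>

definition interior_face :: "nat \<Rightarrow> nat \<Rightarrow> (nat \<times> nat) set \<Rightarrow> bool" where
  "interior_face m n \<sigma> \<longleftrightarrow> {m + 1..n} \<subseteq> snd ` \<sigma>"

text \<open>Coordinates 2 to n, counted from 0 as the forms \<open>\<theta> k\<close> are; the first
  one is determined by the others.\<close>

definition cell_coord :: "nat \<Rightarrow> nat \<times> nat \<Rightarrow> 'k::field" where
  "cell_coord k v = of_int (cell_vec v (k + 2))"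

section \<open>The ball as an instance of the abstract shelling\<close>

lemma sum_shift2: "(\<Sum>k\<in>{2..n}. f k) = (\<Sum>k<n - 1. f (k + 2))" for n :: nat
  by (rule sum.reindex_bij_witness[of _ "\<lambda>k. k + 2" "\<lambda>k. k - 2"]) (auto simp: numeral_2_eq_2 Suc_diff_Suc)

lemma facet_dual_bases:
  assumes "1 \<le> n" "F \<in> facets n"
  shows "\<exists>b. dual_bases (cell_coord :: nat \<Rightarrow> nat \<times> nat \<Rightarrow> 'k::field) (n - 1) F b"
proof -
  obtain b where b: "\<And>k l. k \<in> {2..n} \<Longrightarrow> l \<in> {2..n} \<Longrightarrow> (\<Sum>v\<in>F. b k v * cell_vec v l) = of_bool (k = l)"
    "\<And>v w. v \<in> F \<Longrightarrow> w \<in> F \<Longrightarrow> (\<Sum>k\<in>{2..n}. cell_vec w k * b k v) = of_bool (v = w)"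
    by (rule facet_dual_basis[OF assms]) blast
  have "(\<Sum>v\<in>F. of_int (b (k + 2) v) * cell_coord l v) = (of_bool (k = l) :: 'k)"
    if "k < n - 1" "l < n - 1" for k l
  proof -
    have "(\<Sum>v\<in>F. of_int (b (k + 2) v) * cell_coord l v) =
        (of_int (\<Sum>v\<in>F. b (k + 2) v * cell_vec v (l + 2)) :: 'k)"
      by (simp add: cell_coord_def)
    also have "\<dots> = of_bool (k = l)" using b(1)[of "k + 2" "l + 2"] that by simp
    finally show ?thesis .
  qed
  moreover have "(\<Sum>k<n - 1. cell_coord k w * of_int (b (k + 2) v)) = (of_bool (v = w) :: 'k)"
    if "v \<in> F" "w \<in> F" for v w
  proof -
    have "(\<Sum>k<n - 1. cell_coord k w * of_int (b (k + 2) v)) =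
        (of_int (\<Sum>k\<in>{2..n}. cell_vec w k * b k v) :: 'k)"
      unfolding sum_shift2 by (simp add: cell_coord_def)
    also have "\<dots> = of_bool (v = w)" using b(2)[OF that] by simp
    finally show ?thesis .
  qed
  ultimately have "dual_bases (cell_coord :: nat \<Rightarrow> nat \<times> nat \<Rightarrow> 'k) (n - 1) F (\<lambda>k v. of_int (b (k + 2) v))"
    unfolding dual_bases_def by blast
  then show ?thesis by blast
qed

lemma wall_cell_coord:
  fixes y :: "nat \<Rightarrow> 'k::field"
  assumes n: "1 \<le> n" and F: "insert v \<tau> \<in> facets n" and G: "insert w \<tau> \<in> facets n"
    and v: "v \<notin> \<tau>" and w: "w \<notin> \<tau>" and vw: "v \<noteq> w"
    and zero: "\<And>x. x \<in> \<tau> \<Longrightarrow> (\<Sum>k<n - 1. y k * cell_coord k x) = 0"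
  shows "(\<Sum>k<n - 1. y k * cell_coord k v) + (\<Sum>k<n - 1. y k * cell_coord k w) = 0"
proof -
  obtain a where a: "\<forall>k\<in>{1..n}. cell_vec v k + cell_vec w k = (\<Sum>x\<in>\<tau>. a x * cell_vec x k)"
    using wall_relation[OF n F G v w vw] unfolding in_cell_span_def by blast
  have "cell_coord k v + cell_coord k w = (\<Sum>x\<in>\<tau>. of_int (a x) * cell_coord k x :: 'k)" if "k < n - 1" for k
  proof -
    have "k + 2 \<in> {1..n}" using that by auto
    then have "(of_int (cell_vec v (k + 2) + cell_vec w (k + 2)) :: 'k) = of_int (\<Sum>x\<in>\<tau>. a x * cell_vec x (k + 2))"
      using a by simp
    then show ?thesis by (simp add: cell_coord_def)
  qed
  then have "(\<Sum>k<n - 1. y k * (cell_coord k v + cell_coord k w)) =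
      (\<Sum>k<n - 1. \<Sum>x\<in>\<tau>. y k * (of_int (a x) * cell_coord k x))"
    by (simp add: sum_distrib_left)
  also have "\<dots> = (\<Sum>x\<in>\<tau>. of_int (a x) * (\<Sum>k<n - 1. y k * cell_coord k x))"
    unfolding sum_distrib_left by (subst sum.swap) (simp add: mult_ac)
  also have "\<dots> = 0" using zero by simp
  finally show ?thesis by (simp add: distrib_left sum.distrib)
qed

lemma half_sphere_subset: "half_sphere m n \<subseteq> Pow (offdiag m n)"
proof (intro subsetI PowI)
  fix \<sigma> v assume \<sigma>: "\<sigma> \<in> half_sphere m n" and v: "v \<in> \<sigma>"
  then have s: "\<sigma> \<in> staircases n" "fst ` \<sigma> \<subseteq> {1..m}" unfolding half_sphere_def by auto
  obtain i j where ij: "v = (i, j)" by force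
  have "i \<in> {1..m}" "j \<in> {1..n}" using s(2) v staircases_range[OF s(1), of i j] unfolding ij by force+
  moreover have "i \<noteq> j" using staircases_neq[OF s(1)] v unfolding ij by blast
  ultimately show "v \<in> offdiag m n" unfolding ij offdiag_def grid_def by auto
qed

text \<open>The rows other than 1 are among 2, ..., m, whence the socle degree m - 1. If some j
  among them is not a row, it is a column, and dropping its head from the column heads loses no
  column beyond m, so the rest is still interior.\<close>

lemma level_shelling_half_sphere:
  assumes "2 \<le> m" "m < n"
  shows "level_shelling (offdiag m n) (half_sphere m n) (half_facets m n) row_heads (shell_weight n)
    (interior_face m n) (cell_coord :: nat \<Rightarrow> nat \<times> nat \<Rightarrow> 'k::field) (n - 1) (m - 1)"
proof
  have n: "1 \<le> n" using assms by simp
  show "finite (offdiag m n)" by (simp add: offdiag_def grid_def)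
  show "half_sphere m n \<subseteq> Pow (offdiag m n)" by (rule half_sphere_subset)
  show "down_closed (half_sphere m n)"
    unfolding down_closed_def half_sphere_def using staircases_mono by blast
  show "{} \<in> half_sphere m n" by (simp add: half_sphere_def staircases_def)
  show "half_facets m n \<subseteq> half_sphere m n"
    unfolding half_facets_def half_sphere_def using facets_staircases by blast
  show "interior_face m n \<tau>" if "interior_face m n \<sigma>" "\<sigma> \<subseteq> \<tau>" for \<sigma> \<tau>
    using that unfolding interior_face_def by blast
  fix F assume "F \<in> half_facets m n"
  then have F: "F \<in> facets n" "fst ` F \<subseteq> {1..m}" unfolding half_facets_def by auto
  note heads = facet_col_heads[OF n F(1), symmetric]
  have finF: "finite F" by (rule facets_finite[OF F(1)])
  show "card F = n - 1" by (rule facets_card[OF F(1)])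
  show "row_heads F \<subseteq> F" by (rule heads_subset)
  show "\<exists>b. dual_bases (cell_coord :: nat \<Rightarrow> nat \<times> nat \<Rightarrow> 'k) (n - 1) F b"
    by (rule facet_dual_bases[OF n F(1)])
  have card_rows: "card (row_heads F) = card (fst ` F - {1})" by (rule card_row_heads)
  have rows: "fst ` F - {1} \<subseteq> {2..m}" using F(2) by (auto simp: subset_iff)
  show "card (row_heads F) \<le> m - 1"
    using card_mono[OF _ rows] unfolding card_rows by simp
  have cols: "{1..n} - fst ` F - {1} \<subseteq> snd ` col_heads F"
    using facet_cols[OF n F(1)] unfolding snd_col_heads by blast
  show "interior_face m n (F - row_heads F)"
    unfolding interior_face_def heads using F(2) assms by (intro subset_trans[OF _ cols]) auto
  show "\<exists>v\<in>F - row_heads F. interior_face m n (F - row_heads F - {v})" if "card (row_heads F) < m - 1"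
  proof -
    have "fst ` F - {1} \<noteq> {2..m}" using that unfolding card_rows by force
    then obtain j where j: "j \<in> {2..m}" "j \<notin> fst ` F" using rows by force
    then have "j \<in> snd ` col_heads F" using cols assms by auto
    then obtain v where v: "v \<in> col_heads F" "snd v = j" by auto
    have "{m + 1..n} \<subseteq> snd ` (col_heads F - {v})"
    proof
      fix l assume l: "l \<in> {m + 1..n}"
      then have "l \<in> snd ` col_heads F" using cols F(2) assms by force
      then obtain w where "w \<in> col_heads F" "snd w = l" by auto
      then show "l \<in> snd ` (col_heads F - {v})" using v j l by force
    qed
    then show ?thesis using v(1) unfolding heads interior_face_def by blast
  qed
  fix G assume "G \<in> half_facets m n"
  then have G: "G \<in> facets n" unfolding half_facets_def by auto
  show "F = G \<or> shell_weight n F < shell_weight n G" if "row_heads F \<subseteq> G"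
    using row_heads_subset_less[OF n F(1) G that] .
  show "G = F \<or> shell_weight n G < shell_weight n F" if "F - row_heads F \<subseteq> G"
    using col_heads_subset_less[OF n F(1) G] that unfolding heads by blast
next
  have n: "1 \<le> n" using assms by simp
  show "(\<Sum>k<n - 1. y k * cell_coord k v) + (\<Sum>k<n - 1. y k * cell_coord k w) = 0"
    if "insert v \<tau> \<in> half_facets m n" "insert w \<tau> \<in> half_facets m n" "v \<notin> \<tau>" "w \<notin> \<tau>" "v \<noteq> w"
      "\<And>x. x \<in> \<tau> \<Longrightarrow> (\<Sum>k<n - 1. y k * cell_coord k x) = 0" for v w \<tau> and y :: "nat \<Rightarrow> 'k"
    using that unfolding half_facets_def by (intro wall_cell_coord[OF n]) auto
  fix \<tau> assume "\<tau> \<in> half_sphere m n"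
  then have \<tau>: "\<tau> \<in> staircases n" "fst ` \<tau> \<subseteq> {1..m}" unfolding half_sphere_def by auto
  show "\<exists>F\<in>half_facets m n. row_heads F \<subseteq> \<tau> \<and> \<tau> \<subseteq> F"
  proof (rule bexI[of _ "completion n (row_heads \<tau>)"])
    show "row_heads (completion n (row_heads \<tau>)) \<subseteq> \<tau> \<and> \<tau> \<subseteq> completion n (row_heads \<tau>)"
      using row_heads_completion[OF n \<tau>(1)] subset_completion[OF n \<tau>(1)] heads_subset by simp
    show "completion n (row_heads \<tau>) \<in> half_facets m n"
      using completion_facet[OF n \<tau>(1)] fst_completion_subset[OF n \<tau>(1)] \<tau>(2) assms
      unfolding half_facets_def by force
  qed
  show "\<exists>F\<in>half_facets m n. F - row_heads F \<subseteq> \<tau> \<and> \<tau> \<subseteq> F" if inner: "interior_face m n \<tau>"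
  proof (rule bexI[of _ "dual_completion n (col_heads \<tau>)"])
    note D = dual_completion_facet[OF n \<tau>(1)]
    show "dual_completion n (col_heads \<tau>) - row_heads (dual_completion n (col_heads \<tau>)) \<subseteq> \<tau> \<and>
        \<tau> \<subseteq> dual_completion n (col_heads \<tau>)"
      unfolding facet_col_heads[OF n D(1), symmetric] D(3) using D(2) heads_subset(2) by blast
    have "{1..n} - (snd ` \<tau> - {1}) \<subseteq> {1..m}"
    proof
      fix j assume j: "j \<in> {1..n} - (snd ` \<tau> - {1})"
      then have "j = 1 \<or> j \<notin> {m + 1..n}" using inner unfolding interior_face_def by blast
      then show "j \<in> {1..m}" using j assms by auto
    qed
    then show "dual_completion n (col_heads \<tau>) \<in> half_facets m n"
      using D(1,4) unfolding half_facets_def by blast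
  qed
qed

section \<open>Coherent orientation of the facets by determinants\<close>

section \<open>Relative homology in top degree\<close>

lemma var_gt_linear:
  shows "\<not> var_gt x x" and "var_gt x y \<Longrightarrow> var_gt y z \<Longrightarrow> var_gt x z"
    and "x \<noteq> y \<Longrightarrow> var_gt x y \<or> var_gt y x"
proof -
  obtain i j where x: "x = (i, j)" by (rule prod.exhaust)
  obtain k l where y: "y = (k, l)" by (rule prod.exhaust)
  obtain a b where z: "z = (a, b)" by (rule prod.exhaust)
  show "\<not> var_gt x x" unfolding x by simp
  show "var_gt x z" if "var_gt x y" "var_gt y z"
    using that unfolding x y z by (cases "i = j"; cases "k = l"; cases "a = b"; simp; linarith)
  show "var_gt x y \<or> var_gt y x" if "x \<noteq> y"
    using that unfolding x y by (cases "i = j"; cases "k = l"; simp; linarith)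
qed

text \<open>The exponent of the sign in \<open>simplicial_boundary\<close>: the place of x, counted
  from 0, when F is listed decreasingly.\<close>

definition position :: "(nat \<times> nat) set \<Rightarrow> nat \<times> nat \<Rightarrow> nat" where
  "position F x = card {y \<in> F. var_gt y x}"

definition nth_cell :: "(nat \<times> nat) set \<Rightarrow> nat \<Rightarrow> nat \<times> nat" where
  "nth_cell F b = inv_into F (position F) b"

lemma position_less:
  assumes "finite F" "y \<in> F" "var_gt y x" shows "position F y < position F x"
proof -
  have "{z \<in> F. var_gt z y} \<subset> {z \<in> F. var_gt z x}" using assms var_gt_linear by blast
  then show ?thesis unfolding position_def using assms by (intro psubset_card_mono) auto
qed

lemma position_bij:
  assumes "finite F" shows "bij_betw (position F) F {..<card F}"
proof -
  have inj: "inj_on (position F) F"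
  proof (rule inj_onI, rule ccontr)
    fix x y assume "x \<in> F" "y \<in> F" "position F x = position F y" "x \<noteq> y"
    then show False using var_gt_linear(3)[of x y] position_less[OF assms] by fastforce
  qed
  have "position F x < card F" if "x \<in> F" for x
  proof -
    have "{y \<in> F. var_gt y x} \<subset> F" using that var_gt_linear(1)[of x] by blast
    then show ?thesis unfolding position_def by (rule psubset_card_mono[OF assms])
  qed
  then have "position F ` F \<subseteq> {..<card F}" by auto
  then have "position F ` F = {..<card F}"
    using card_image[OF inj] by (intro card_subset_eq) auto
  then show ?thesis using inj unfolding bij_betw_def by simp
qed

lemma nth_cell:
  assumes "finite F"
  shows "b < card F \<Longrightarrow> nth_cell F b \<in> F" "b < card F \<Longrightarrow> position F (nth_cell F b) = b"
    "x \<in> F \<Longrightarrow> nth_cell F (position F x) = x" "x \<in> F \<Longrightarrow> position F x < card F"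
proof -
  note bij = position_bij[OF assms]
  show "b < card F \<Longrightarrow> nth_cell F b \<in> F" "b < card F \<Longrightarrow> position F (nth_cell F b) = b"
    unfolding nth_cell_def using bij inv_into_into[of b "position F" F] f_inv_into_f[of b "position F" F]
    unfolding bij_betw_def by auto
  show "x \<in> F \<Longrightarrow> nth_cell F (position F x) = x" unfolding nth_cell_def
    using bij unfolding bij_betw_def by (simp add: inv_into_f_f)
  show "x \<in> F \<Longrightarrow> position F x < card F" using bij unfolding bij_betw_def by blast
qed

lemma nth_cell_remove:
  assumes F: "finite F" "v \<in> F" and b: "b < card F - 1"
  shows "nth_cell F (if b < position F v then b else Suc b) = nth_cell (F - {v}) b"
proof -
  define c where "c = (if b < position F v then b else Suc b)"
  have c: "c < card F" "c \<noteq> position F v" using b unfolding c_def by auto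
  define x where "x = nth_cell F c"
  have x: "x \<in> F" "position F x = c" unfolding x_def using nth_cell[OF F(1)] c by auto
  then have xv: "x \<noteq> v" using c by auto
  have "{y \<in> F. var_gt y x} = {y \<in> F - {v}. var_gt y x} \<union> (if var_gt v x then {v} else {})"
    using F(2) by auto
  then have split: "position F x = position (F - {v}) x + (if var_gt v x then 1 else 0)"
    unfolding position_def using F(1) by (subst \<open>{y \<in> F. var_gt y x} = _\<close>) (simp add: card_Un_disjoint)
  have "var_gt v x \<longleftrightarrow> position F v < position F x"
    using position_less[OF F(1,2), of x] position_less[OF F(1) x(1), of v] var_gt_linear(3)[OF xv] by fastforce
  then have "position (F - {v}) x = b" using split x(2) c unfolding c_def by (auto split: if_splits)
  moreover have "nth_cell (F - {v}) (position (F - {v}) x) = x"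
    using nth_cell(3)[of "F - {v}" x] F(1) x(1) xv by simp
  ultimately show ?thesis unfolding x_def c_def by simp
qed

definition cell_matrix :: "nat \<Rightarrow> (nat \<times> nat) set \<Rightarrow> 'k::field mat" where
  "cell_matrix N F = mat N N (\<lambda>(a, b). cell_coord a (nth_cell F b))"

definition ridge_minor :: "nat \<Rightarrow> (nat \<times> nat) set \<Rightarrow> nat \<Rightarrow> 'k::field mat" where
  "ridge_minor N \<tau> a = mat (N - 1) (N - 1) (\<lambda>(i, j). cell_coord (if i < a then i else Suc i) (nth_cell \<tau> j))"

text \<open>The determinant of v followed by the cells of the ridge, expanded along its first
  column: a linear functional of v that depends only on the ridge.\<close>

definition ridge_form :: "nat \<Rightarrow> (nat \<times> nat) set \<Rightarrow> nat \<times> nat \<Rightarrow> 'k::field" where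
  "ridge_form N \<tau> v = (\<Sum>a<N. (-1) ^ a * det (ridge_minor N \<tau> a) * cell_coord a v)"

text \<open>Laplace expansion along the column of v. The boundary sign cancels the sign of the
  position of v in F, so the contribution of F to a ridge is the value of one functional, the same
  for all facets at that ridge.\<close>

lemma det_cell_matrix:
  assumes F: "finite F" "card F = N" and v: "v \<in> F"
  shows "(-1) ^ position F v * det (cell_matrix N F) = (ridge_form N (F - {v}) v :: 'k::field)"
proof -
  let ?M = "cell_matrix N F :: 'k mat" and ?p = "position F v"
  have p: "?p < N" using nth_cell(4)[OF F(1) v] F(2) by simp
  have M: "?M \<in> carrier_mat N N" unfolding cell_matrix_def by simp
  have del: "mat_delete ?M a ?p = ridge_minor N (F - {v}) a" for a
  proof (rule eq_matI)
    fix i j assume "i < dim_row (ridge_minor N (F - {v}) a)" "j < dim_col (ridge_minor N (F - {v}) a)"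
    then have ij: "i < N - 1" "j < N - 1" unfolding ridge_minor_def by auto
    have "nth_cell F (if j < ?p then j else Suc j) = nth_cell (F - {v}) j"
      using nth_cell_remove[OF F(1) v] ij F(2) by simp
    then show "mat_delete ?M a ?p $$ (i, j) = ridge_minor N (F - {v}) a $$ (i, j)"
      using ij unfolding mat_delete_def cell_matrix_def ridge_minor_def by auto
  qed (auto simp: mat_delete_def cell_matrix_def ridge_minor_def)
  have "det ?M = (\<Sum>a<N. ?M $$ (a, ?p) * cofactor ?M a ?p)" by (rule laplace_expansion_column[OF M p])
  also have "\<dots> = (\<Sum>a<N. (-1) ^ ?p * ((-1) ^ a * det (ridge_minor N (F - {v}) a) * cell_coord a v))"
  proof (intro sum.cong refl)
    fix a assume "a \<in> {..<N}"
    then have "?M $$ (a, ?p) = cell_coord a v"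
      using p nth_cell(3)[OF F(1) v] unfolding cell_matrix_def by simp
    then show "?M $$ (a, ?p) * cofactor ?M a ?p =
        (-1) ^ ?p * ((-1) ^ a * det (ridge_minor N (F - {v}) a) * cell_coord a v)"
      unfolding cofactor_def del by (simp add: power_add mult_ac)
  qed
  also have "\<dots> = (-1) ^ ?p * ridge_form N (F - {v}) v"
    unfolding ridge_form_def sum_distrib_left ..
  finally show ?thesis by (simp add: mult.assoc[symmetric] power_mult_distrib[symmetric])
qed

lemma ridge_form_zero:
  assumes \<tau>: "finite \<tau>" "card \<tau> = N - 1" and w: "w \<in> \<tau>"
  shows "ridge_form N \<tau> w = (0 :: 'k::field)"
proof -
  define B :: "'k mat" where "B = mat N N (\<lambda>(a, b). cell_coord a (if b = 0 then w else nth_cell \<tau> (b - 1)))"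
  have B: "B \<in> carrier_mat N N" unfolding B_def by simp
  have p: "position \<tau> w < N - 1" using nth_cell(4)[OF \<tau>(1) w] \<tau>(2) by simp
  then have N: "0 < N" by simp
  have "mat_delete B a 0 = ridge_minor N \<tau> a" for a
    by (rule eq_matI) (auto simp: mat_delete_def B_def ridge_minor_def)
  then have "det B = ridge_form N \<tau> w"
    unfolding laplace_expansion_column[OF B N] ridge_form_def cofactor_def
    using N by (intro sum.cong) (auto simp: B_def mult_ac)
  moreover have "det B = 0"
  proof (rule det_identical_columns[OF B])
    show "0 \<noteq> Suc (position \<tau> w)" "0 < N" "Suc (position \<tau> w) < N" using p by auto
    show "col B 0 = col B (Suc (position \<tau> w))"
      by (rule eq_vecI) (use p N nth_cell(3)[OF \<tau>(1) w] in \<open>auto simp: B_def\<close>)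
  qed
  ultimately show ?thesis by simp
qed

text \<open>The functional vanishes on the ridge because of a repeated column, so by the wall
  relation it takes opposite values on the two sides.\<close>

lemma ridge_form_opposite:
  assumes n: "1 \<le> n" and F: "insert v \<tau> \<in> facets n" and G: "insert w \<tau> \<in> facets n"
    and v: "v \<notin> \<tau>" and w: "w \<notin> \<tau>" and vw: "v \<noteq> w"
  shows "ridge_form (n - 1) \<tau> v + ridge_form (n - 1) \<tau> w = (0 :: 'k::field)"
  unfolding ridge_form_def
proof (rule wall_cell_coord[OF n F G v w vw])
  have "finite \<tau>" using facets_finite[OF F] by simp
  moreover have "card \<tau> = n - 1 - 1" using facets_card[OF F] v calculation by simp
  ultimately show "(\<Sum>k<n - 1. (-1) ^ k * det (ridge_minor (n - 1) \<tau> k) * cell_coord k x) = (0 :: 'k)" if "x \<in> \<tau>" for x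
    using ridge_form_zero[of \<tau> "n - 1" x] that unfolding ridge_form_def by simp
qed

lemma det_cell_matrix_nonzero:
  assumes n: "1 \<le> n" and F: "F \<in> facets n"
  shows "det (cell_matrix (n - 1) F) \<noteq> (0 :: 'k::field)"
proof -
  let ?N = "n - 1" and ?M = "cell_matrix (n - 1) F :: 'k mat"
  have fin: "finite F" and card: "card F = ?N" using facets_finite[OF F] facets_card[OF F] by auto
  obtain b :: "nat \<Rightarrow> nat \<times> nat \<Rightarrow> 'k" where b: "dual_bases cell_coord ?N F b" using facet_dual_bases[OF n F] by blast
  define B where "B = mat ?N ?N (\<lambda>(a, k). b k (nth_cell F a))"
  have M: "?M \<in> carrier_mat ?N ?N" and B: "B \<in> carrier_mat ?N ?N" unfolding cell_matrix_def B_def by auto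
  have "?M * B = 1\<^sub>m ?N"
  proof (rule eq_matI)
    fix l k assume "l < dim_row (1\<^sub>m ?N :: 'k mat)" "k < dim_col (1\<^sub>m ?N :: 'k mat)"
    then have lk: "l < ?N" "k < ?N" by auto
    have "(?M * B) $$ (l, k) = (\<Sum>a = 0..<?N. cell_coord l (nth_cell F a) * b k (nth_cell F a))"
      using lk unfolding cell_matrix_def B_def by (simp add: scalar_prod_def)
    also have "\<dots> = (\<Sum>v\<in>F. b k v * cell_coord l v)"
      by (rule sum.reindex_bij_witness[of _ "position F" "nth_cell F"])
        (use nth_cell[OF fin] card in \<open>auto simp: mult.commute\<close>)
    also have "\<dots> = (1\<^sub>m ?N :: 'k mat) $$ (l, k)"
      using b lk unfolding dual_bases_def by (auto simp: of_bool_def)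
    finally show "(?M * B) $$ (l, k) = (1\<^sub>m ?N :: 'k mat) $$ (l, k)" .
  qed (use M B in auto)
  then have "det ?M * det B = 1" using det_mult[OF M B] by simp
  then show ?thesis by auto
qed

section \<open>Relative cycles and boundaries in top degree\<close>

lemma lookup_simplicial_boundary:
  assumes "finite A" "Poly_Mapping.keys c \<subseteq> A"
  shows "Poly_Mapping.lookup (simplicial_boundary gt c) \<rho> =
    (\<Sum>\<tau>\<in>A. \<Sum>x\<in>\<tau>. if \<tau> - {x} = \<rho> then (-1) ^ card {y \<in> \<tau>. gt y x} * Poly_Mapping.lookup c \<tau> else 0)"
proof -
  have "Poly_Mapping.lookup (simplicial_boundary gt c) \<rho> =
    (\<Sum>\<tau>\<in>Poly_Mapping.keys c. \<Sum>x\<in>\<tau>. if \<tau> - {x} = \<rho> then (-1) ^ card {y \<in> \<tau>. gt y x} * Poly_Mapping.lookup c \<tau> else 0)"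
    unfolding simplicial_boundary_def lookup_sum
    by (intro sum.cong refl) (auto simp: lookup_single)
  also have "\<dots> = (\<Sum>\<tau>\<in>A. \<Sum>x\<in>\<tau>. if \<tau> - {x} = \<rho> then (-1) ^ card {y \<in> \<tau>. gt y x} * Poly_Mapping.lookup c \<tau> else 0)"
    using assms by (intro sum.mono_neutral_left) (auto simp: in_keys_iff intro!: sum.neutral)
  finally show ?thesis .
qed

lemma simplicial_boundary_add:
  "simplicial_boundary gt (c + c') = simplicial_boundary gt c + simplicial_boundary gt c'"
proof (rule poly_mapping_eqI)
  fix \<rho>
  let ?A = "Poly_Mapping.keys c \<union> Poly_Mapping.keys c'"
  have "Poly_Mapping.keys (c + c') \<subseteq> ?A" by (rule keys_add)
  then show "Poly_Mapping.lookup (simplicial_boundary gt (c + c')) \<rho> =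
      Poly_Mapping.lookup (simplicial_boundary gt c + simplicial_boundary gt c') \<rho>"
    by (simp add: lookup_simplicial_boundary[of ?A] lookup_add sum.distrib[symmetric] distrib_left
        if_distrib cong: if_cong)
qed

lemma simplicial_boundary_zero: "simplicial_boundary gt 0 = 0"
  by (simp add: simplicial_boundary_def)

lemma simplicial_boundary_uminus: "simplicial_boundary gt (- c) = - simplicial_boundary gt c"
  using simplicial_boundary_add[of gt c "- c"]
  by (simp add: simplicial_boundary_zero eq_neg_iff_add_eq_0 add.commute)

lemma simplicial_chains_add:
  "c \<in> simplicial_chains K \<Gamma> i \<Longrightarrow> c' \<in> simplicial_chains K \<Gamma> i \<Longrightarrow> c + c' \<in> simplicial_chains K \<Gamma> i"
  using keys_add[of c c'] unfolding simplicial_chains_def by blast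

lemma simplicial_chains_uminus: "c \<in> simplicial_chains K \<Gamma> i \<Longrightarrow> - c \<in> simplicial_chains K \<Gamma> i"
  unfolding simplicial_chains_def by (simp add: in_keys_iff)

lemma simplicial_chains_zero: "0 \<in> simplicial_chains K \<Gamma> i"
  unfolding simplicial_chains_def by simp

lemma group_relcycles:
  "comm_group \<lparr>carrier = simplicial_relcycles K gt i \<Gamma> \<Gamma>', monoid.mult = (+), one = 0\<rparr>"
proof (rule comm_groupI)
  let ?G = "\<lparr>carrier = simplicial_relcycles K gt i \<Gamma> \<Gamma>', monoid.mult = (+), one = 0\<rparr>"
  fix c assume "c \<in> carrier ?G"
  then have "- c \<in> carrier ?G"
    unfolding simplicial_relcycles_def by (simp add: simplicial_boundary_uminus simplicial_chains_uminus)
  then show "\<exists>c'\<in>carrier ?G. c' \<otimes>\<^bsub>?G\<^esub> c = \<one>\<^bsub>?G\<^esub>" by (intro bexI[of _ "- c"]) simp_all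
qed (auto simp: simplicial_relcycles_def simplicial_boundary_add simplicial_boundary_zero
    simplicial_chains_add simplicial_chains_zero add_ac)

lemma trivial_relative_homologyI:
  assumes "simplicial_relcycles K gt i \<Gamma> \<Gamma>' = simplicial_relboundaries K gt i \<Gamma> \<Gamma>'"
  shows "trivial_group (relative_simplicial_homology K gt i \<Gamma> \<Gamma>')"
proof -
  define G :: "('a set \<Rightarrow>\<^sub>0 'b::field) monoid"
    where "G = \<lparr>carrier = simplicial_relcycles K gt i \<Gamma> \<Gamma>', monoid.mult = (+), one = 0\<rparr>"
  interpret comm_group G unfolding G_def by (rule group_relcycles)
  have H: "simplicial_relboundaries K gt i \<Gamma> \<Gamma>' = carrier G" unfolding G_def using assms by simp
  have "subgroup (carrier G) G" by (rule subgroup_self)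
  then have n: "carrier G \<lhd> G" by (rule subgroup_imp_normal)
  have "group (G Mod carrier G)" by (rule normal.factorgroup_is_group[OF n])
  moreover have "carrier (G Mod carrier G) = {\<one>\<^bsub>G Mod carrier G\<^esub>}"
    unfolding FactGroup_def RCOSETS_def using coset_join2[OF _ subgroup_self] by auto
  ultimately show ?thesis
    unfolding relative_simplicial_homology_def G_def[symmetric] H trivial_group_def by blast
qed

lemma trivial_relative_homologyD:
  assumes "trivial_group (relative_simplicial_homology K gt i \<Gamma> \<Gamma>')"
    and c: "c \<in> simplicial_relcycles K gt i \<Gamma> \<Gamma>'"
  shows "c \<in> simplicial_relboundaries K gt i \<Gamma> \<Gamma>'"
proof -
  define G :: "('a set \<Rightarrow>\<^sub>0 'b::field) monoid"
    where "G = \<lparr>carrier = simplicial_relcycles K gt i \<Gamma> \<Gamma>', monoid.mult = (+), one = 0\<rparr>"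
  let ?H = "simplicial_relboundaries K gt i \<Gamma> \<Gamma>'"
  have "carrier (G Mod ?H) = {\<one>\<^bsub>G Mod ?H\<^esub>}"
    using assms(1) unfolding relative_simplicial_homology_def G_def[symmetric] trivial_group_def by blast
  moreover have "?H #>\<^bsub>G\<^esub> c \<in> carrier (G Mod ?H)"
    using c unfolding FactGroup_def RCOSETS_def G_def by auto
  ultimately have "?H #>\<^bsub>G\<^esub> c = ?H" unfolding FactGroup_def by simp
  moreover have "0 \<in> ?H"
    unfolding simplicial_relboundaries_def
    by (auto intro!: bexI[of _ 0] simp: simplicial_chains_zero simplicial_boundary_zero)
  then have "0 + c \<in> ?H #>\<^bsub>G\<^esub> c" unfolding r_coset_def G_def by auto
  ultimately show ?thesis by simp
qed

context
  fixes m n :: nat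
  assumes mn: "2 \<le> m" "m < n"
begin

text \<open>The rationals are a sample field: only combinatorial consequences such as
  \<open>adjacent_facet\<close> are taken from the locale, while the homology below has coefficients
  in an arbitrary field.\<close>

interpretation level_shelling "offdiag m n" "half_sphere m n" "half_facets m n" row_heads "shell_weight n"
    "interior_face m n" "cell_coord :: nat \<Rightarrow> nat \<times> nat \<Rightarrow> rat" "n - 1" "m - 1"
  by (rule level_shelling_half_sphere[OF mn])

abbreviation relcycles :: "'k::field itself \<Rightarrow> (nat \<times> nat) set \<Rightarrow> ((nat \<times> nat) set \<Rightarrow>\<^sub>0 'k) set" where
  "relcycles K \<sigma> \<equiv> simplicial_relcycles K var_gt (n - 2) (half_sphere m n) (contrastar (half_sphere m n) \<sigma>)"

abbreviation relboundaries :: "'k::field itself \<Rightarrow> (nat \<times> nat) set \<Rightarrow> ((nat \<times> nat) set \<Rightarrow>\<^sub>0 'k) set" where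
  "relboundaries K \<sigma> \<equiv> simplicial_relboundaries K var_gt (n - 2) (half_sphere m n) (contrastar (half_sphere m n) \<sigma>)"

lemma top_faces: "\<tau> \<in> half_sphere m n \<and> card \<tau> = n - 1 \<longleftrightarrow> \<tau> \<in> half_facets m n"
  unfolding half_sphere_def half_facets_def facets_def by auto

text \<open>No face has n cells, so there are no chains one degree higher, and the relative
  boundaries are the chains of the contrastar.\<close>

lemma relboundaries_eq:
  "relboundaries TYPE('k::field) \<sigma> = simplicial_chains TYPE('k) (contrastar (half_sphere m n) \<sigma>) (n - 1)"
proof -
  have S: "Suc (n - 2) = n - 1" "Suc (n - 1) = n" using mn by auto
  have zero: "simplicial_chains TYPE('k) (half_sphere m n) n = {0}"
  proof -
    have "card \<tau> \<noteq> n" if "\<tau> \<in> half_sphere m n" for \<tau>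
    proof -
      have "card \<tau> \<le> n - 1"
        using staircases_card[of n \<tau>] that mn unfolding half_sphere_def by simp
      then show ?thesis using mn by simp
    qed
    then have "Poly_Mapping.keys c = {}" if "c \<in> simplicial_chains TYPE('k) (half_sphere m n) n" for c
      using that unfolding simplicial_chains_def by blast
    then show ?thesis using simplicial_chains_zero by auto
  qed
  have "simplicial_chains TYPE('k) (contrastar (half_sphere m n) \<sigma>) (n - 1)
      \<subseteq> simplicial_chains TYPE('k) (half_sphere m n) (n - 1)"
    unfolding simplicial_chains_def contrastar_def by blast
  then show ?thesis
    unfolding simplicial_relboundaries_def S zero by (auto simp: simplicial_boundary_zero)
qed

text \<open>Suppose a relative cycle involves facets containing \<sigma>, and let F be one of
  largest weight. As \<open>F - row_heads F\<close> is interior, \<sigma> misses one of its cells v.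
  The ridge \<open>F - {v}\<close> contains the row heads of F, so any other facet of the cycle
  through it would contain \<sigma> and have larger weight. Hence the ridge survives in the boundary
  although it contains \<sigma>.\<close>

lemma trivial_if_not_interior:
  assumes "\<not> interior_face m n \<sigma>"
  shows "relcycles TYPE('k::field) \<sigma> = relboundaries TYPE('k) \<sigma>"
proof
  have S: "Suc (n - 2) = n - 1" using mn by simp
  show "relcycles TYPE('k::field) \<sigma> \<subseteq> relboundaries TYPE('k) \<sigma>"
  proof
    fix c assume "c \<in> relcycles TYPE('k) \<sigma>"
    then have c: "c \<in> simplicial_chains TYPE('k) (half_sphere m n) (n - 1)"
      "simplicial_boundary var_gt c \<in> simplicial_chains TYPE('k) (contrastar (half_sphere m n) \<sigma>) (n - 2)"
      unfolding simplicial_relcycles_def S by auto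
    have facet: "\<tau> \<in> half_facets m n" if "\<tau> \<in> Poly_Mapping.keys c" for \<tau>
      using c(1) that top_faces unfolding simplicial_chains_def by blast
    have "\<not> \<sigma> \<subseteq> \<tau>" if "\<tau> \<in> Poly_Mapping.keys c" for \<tau>
    proof
      assume "\<sigma> \<subseteq> \<tau>"
      define S where "S = {\<tau> \<in> Poly_Mapping.keys c. \<sigma> \<subseteq> \<tau>}"
      have S: "finite S" "S \<noteq> {}" unfolding S_def using \<open>\<sigma> \<subseteq> \<tau>\<close> that by auto
      have "Max (shell_weight n ` S) \<in> shell_weight n ` S" using S by simp
      then obtain F where F: "F \<in> S" "shell_weight n F = Max (shell_weight n ` S)" by auto
      have max: "shell_weight n G \<le> shell_weight n F" if "G \<in> S" for G using that S F(2) by simp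
      have Fk: "F \<in> Poly_Mapping.keys c" "\<sigma> \<subseteq> F" "F \<in> half_facets m n" using F(1) facet unfolding S_def by auto
      have "\<not> F - row_heads F \<subseteq> \<sigma>" using inner assms Fk(3) by blast
      then obtain v where v: "v \<in> F" "v \<notin> row_heads F" "v \<notin> \<sigma>" by blast
      have other: "G = F" if "G \<in> Poly_Mapping.keys c" "F - {v} \<subseteq> G" for G
      proof -
        have "row_heads F \<subseteq> G" using that(2) v(2) heads_subset(1) by blast
        then have "F = G \<or> shell_weight n F < shell_weight n G" using less[OF Fk(3) facet[OF that(1)]] by blast
        moreover have "G \<in> S" using that v(3) Fk(2) unfolding S_def by blast
        ultimately show ?thesis using max[of G] by auto
      qed
      have "Poly_Mapping.lookup (simplicial_boundary var_gt c) (F - {v}) =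
        (\<Sum>\<tau>\<in>Poly_Mapping.keys c. \<Sum>x\<in>\<tau>. if \<tau> - {x} = F - {v} then (-1) ^ card {y \<in> \<tau>. var_gt y x} * Poly_Mapping.lookup c \<tau> else 0)"
        by (rule lookup_simplicial_boundary) auto
      also have "\<dots> = (\<Sum>\<tau>\<in>Poly_Mapping.keys c. if \<tau> = F then (-1) ^ card {y \<in> F. var_gt y v} * Poly_Mapping.lookup c F else 0)"
      proof (intro sum.cong refl)
        fix \<tau> assume \<tau>: "\<tau> \<in> Poly_Mapping.keys c"
        show "(\<Sum>x\<in>\<tau>. if \<tau> - {x} = F - {v} then (-1) ^ card {y \<in> \<tau>. var_gt y x} * Poly_Mapping.lookup c \<tau> else 0) =
          (if \<tau> = F then (-1) ^ card {y \<in> F. var_gt y v} * Poly_Mapping.lookup c F else 0)"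
        proof (cases "\<tau> = F")
          case True
          have "(\<Sum>x\<in>F. if F - {x} = F - {v} then (-1) ^ card {y \<in> F. var_gt y x} * Poly_Mapping.lookup c F else 0) =
            (\<Sum>x\<in>F. if x = v then (-1) ^ card {y \<in> F. var_gt y v} * Poly_Mapping.lookup c F else 0)"
            using v(1) by (intro sum.cong) auto
          also have "\<dots> = (-1) ^ card {y \<in> F. var_gt y v} * Poly_Mapping.lookup c F"
            using v(1) facet_finite[OF Fk(3)] by simp
          finally show ?thesis unfolding True by simp
        next
          case False
          then have "\<tau> - {x} \<noteq> F - {v}" for x using other[OF \<tau>] by blast
          then show ?thesis using False by simp
        qed
      qed
      also have "\<dots> = (-1) ^ card {y \<in> F. var_gt y v} * Poly_Mapping.lookup c F" using Fk(1) by simp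
      also have "\<dots> \<noteq> 0" using Fk(1) by (simp add: in_keys_iff)
      finally have "F - {v} \<in> Poly_Mapping.keys (simplicial_boundary var_gt c)" by (simp add: in_keys_iff)
      then have "\<not> \<sigma> \<subseteq> F - {v}" using c(2) unfolding simplicial_chains_def contrastar_def by blast
      then show False using Fk(2) v(3) by blast
    qed
    then show "c \<in> relboundaries TYPE('k) \<sigma>"
      unfolding relboundaries_eq using c(1) unfolding simplicial_chains_def contrastar_def by blast
  qed
  show "relboundaries TYPE('k) \<sigma> \<subseteq> relcycles TYPE('k::field) \<sigma>"
  proof
    fix c assume "c \<in> relboundaries TYPE('k) \<sigma>"
    then have c: "\<And>\<tau>. \<tau> \<in> Poly_Mapping.keys c \<Longrightarrow> \<tau> \<in> half_sphere m n \<and> \<not> \<sigma> \<subseteq> \<tau> \<and> finite \<tau> \<and> card \<tau> = n - 1"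
      unfolding relboundaries_eq unfolding simplicial_chains_def contrastar_def by blast
    have "\<rho> \<in> half_sphere m n \<and> \<not> \<sigma> \<subseteq> \<rho> \<and> finite \<rho> \<and> card \<rho> = n - 2"
      if "\<rho> \<in> Poly_Mapping.keys (simplicial_boundary var_gt c)" for \<rho>
    proof -
      have "(\<Sum>\<tau>\<in>Poly_Mapping.keys c. \<Sum>x\<in>\<tau>. if \<tau> - {x} = \<rho> then (-1) ^ card {y \<in> \<tau>. var_gt y x} * Poly_Mapping.lookup c \<tau> else 0) \<noteq> 0"
        using that lookup_simplicial_boundary[of "Poly_Mapping.keys c" c var_gt \<rho>] by (simp add: in_keys_iff)
      then obtain \<tau> where \<tau>: "\<tau> \<in> Poly_Mapping.keys c" and
        "(\<Sum>x\<in>\<tau>. if \<tau> - {x} = \<rho> then (-1) ^ card {y \<in> \<tau>. var_gt y x} * Poly_Mapping.lookup c \<tau> else 0) \<noteq> 0"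
        by (rule sum.not_neutral_contains_not_neutral)
      from this(2) obtain x where "x \<in> \<tau>" "\<tau> - {x} = \<rho>"
        by (rule sum.not_neutral_contains_not_neutral) (auto split: if_splits)
      note \<tau> = \<tau> this
      then show ?thesis using c[OF \<tau>(1)] down_closedD[OF \<Delta>(2), of \<tau> \<rho>] by auto
    qed
    then have "simplicial_boundary var_gt c \<in> simplicial_chains TYPE('k) (contrastar (half_sphere m n) \<sigma>) (n - 2)"
      unfolding simplicial_chains_def contrastar_def by blast
    then show "c \<in> relcycles TYPE('k) \<sigma>"
      using c unfolding simplicial_relcycles_def S simplicial_chains_def by blast
  qed
qed

text \<open>\<open>adjacent_facet\<close> removes a cell of a restriction set. If v is not one, the
  ridge lies in the dual interval of some facet, and the cell that this facet has in addition
  belongs to its row heads.\<close>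

lemma interior_ridge:
  assumes F: "F \<in> half_facets m n" and v: "v \<in> F" and inner: "interior_face m n (F - {v})"
  obtains w u where "w \<notin> F - {v}" "u \<notin> F - {v}" "u \<noteq> w" "insert w (F - {v}) \<in> half_facets m n"
    "insert u (F - {v}) \<in> half_facets m n"
    "\<And>G. G \<in> half_facets m n \<Longrightarrow> F - {v} \<subseteq> G \<Longrightarrow> G = insert w (F - {v}) \<or> G = insert u (F - {v})"
proof -
  let ?\<tau> = "F - {v}"
  have "?\<tau> \<in> half_sphere m n" using F Fs down_closedD[OF \<Delta>(2)] by blast
  have "\<exists>w F'. F' \<in> half_facets m n \<and> w \<in> row_heads F' \<and> F' - {w} = ?\<tau>"
  proof (cases "v \<in> row_heads F")
    case True
    then show ?thesis using F by blast
  next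
    case False
    obtain F' where F': "F' \<in> half_facets m n" "F' - row_heads F' \<subseteq> ?\<tau>" "?\<tau> \<subseteq> F'"
      using cover_dual[OF \<open>?\<tau> \<in> half_sphere m n\<close> inner] by blast
    have "card (F' - ?\<tau>) = card F' - card ?\<tau>"
      using F'(3) facet_finite[OF F] by (intro card_Diff_subset) auto
    also have "\<dots> = 1"
      using v facet_finite[OF F] card_facet[OF F'(1)] card_facet[OF F] mn by (simp add: card_Diff_singleton)
    finally obtain w where w: "F' - ?\<tau> = {w}" by (auto simp: card_1_singleton_iff)
    then have "w \<in> row_heads F'" using F'(2) by blast
    moreover have "F' - {w} = ?\<tau>" using w F'(3) by blast
    ultimately show ?thesis using F'(1) by blast
  qed
  then obtain w F' where F': "F' \<in> half_facets m n" "w \<in> row_heads F'" "F' - {w} = ?\<tau>" by blast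
  obtain u where u: "insert u (F' - {w}) \<in> half_facets m n" "u \<notin> F'"
    "\<And>G. G \<in> half_facets m n \<Longrightarrow> F' - {w} \<subseteq> G \<Longrightarrow> G = F' \<or> G = insert u (F' - {w})"
    by (rule adjacent_facet[OF F'(1,2)]) blast
  have wF: "w \<in> F'" using F'(2) heads_subset(1) by blast
  then have ins: "F' = insert w ?\<tau>" using F'(3) by blast
  show ?thesis
  proof (rule that)
    show "w \<notin> ?\<tau>" using F'(3) by blast
    show "u \<notin> ?\<tau>" "u \<noteq> w" using u(2) wF ins by auto
    show "insert w ?\<tau> \<in> half_facets m n" using F'(1) ins by simp
    show "insert u ?\<tau> \<in> half_facets m n" using u(1) F'(3) by simp
    show "\<And>G. G \<in> half_facets m n \<Longrightarrow> ?\<tau> \<subseteq> G \<Longrightarrow> G = insert w ?\<tau> \<or> G = insert u ?\<tau>"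
      using u(3) ins unfolding F'(3) by blast
  qed
qed

lemma nontrivial_if_interior:
  assumes \<sigma>: "\<sigma> \<in> half_sphere m n" and inner: "interior_face m n \<sigma>"
  shows "\<exists>c. c \<in> relcycles TYPE('k::field) \<sigma> \<and> c \<notin> relboundaries TYPE('k) \<sigma>"
proof -
  have S: "Suc (n - 2) = n - 1" using mn by simp
  have n: "1 \<le> n" using mn by simp
  have facet: "F \<in> facets n" if "F \<in> half_facets m n" for F using that unfolding half_facets_def by simp
  define o' where "o' F = (det (cell_matrix (n - 1) F) :: 'k)" for F
  define c where "c = (\<Sum>F\<in>half_facets m n. Poly_Mapping.single F (o' F))"
  have lookup: "Poly_Mapping.lookup c F = (if F \<in> half_facets m n then o' F else 0)" for F
    unfolding c_def using up.finite_Fs by (simp add: lookup_sum lookup_single when_def)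
  have keys: "Poly_Mapping.keys c \<subseteq> half_facets m n" 
    by (auto simp: in_keys_iff lookup split: if_splits)
  have chain: "c \<in> simplicial_chains TYPE('k) (half_sphere m n) (n - 1)"
    using keys top_faces facet_finite unfolding simplicial_chains_def by blast
  \<comment> \<open>A ridge containing \<sigma> is interior, so exactly two facets contribute; their
    contributions are the values of the ridge form on the two sides, which cancel.\<close>
  have boundary: "Poly_Mapping.lookup (simplicial_boundary var_gt c) (F - {v}) = 0"
    if F: "F \<in> half_facets m n" "v \<in> F" "\<sigma> \<subseteq> F - {v}" for F v
  proof -
    let ?\<tau> = "F - {v}"
    have "interior_face m n ?\<tau>" using inner F(3) unfolding interior_face_def by blast
    from interior_ridge[OF F(1,2) this] obtain w u where wu: "w \<notin> ?\<tau>" "u \<notin> ?\<tau>" "u \<noteq> w"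
      "insert w ?\<tau> \<in> half_facets m n" "insert u ?\<tau> \<in> half_facets m n"
      "\<And>G. G \<in> half_facets m n \<Longrightarrow> ?\<tau> \<subseteq> G \<Longrightarrow> G = insert w ?\<tau> \<or> G = insert u ?\<tau>" by metis
    define g where "g G = (\<Sum>x\<in>G. if G - {x} = ?\<tau> then (-1) ^ card {y \<in> G. var_gt y x} * Poly_Mapping.lookup c G else 0)" for G
    have g: "g (insert x ?\<tau>) = ridge_form (n - 1) ?\<tau> x" if x: "insert x ?\<tau> \<in> half_facets m n" "x \<notin> ?\<tau>" for x
    proof -
      let ?G = "insert x ?\<tau>"
      have fin: "finite ?G" by (rule facet_finite[OF x(1)])
      have "g ?G = (\<Sum>z\<in>?G. if z = x then (-1) ^ card {y \<in> ?G. var_gt y x} * Poly_Mapping.lookup c ?G else 0)"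
        unfolding g_def
      proof (intro sum.cong refl)
        fix z assume z: "z \<in> ?G"
        have "?G - {z} = ?\<tau> \<longleftrightarrow> z = x" using z x(2) by blast
        then show "(if ?G - {z} = ?\<tau> then (-1) ^ card {y \<in> ?G. var_gt y z} * Poly_Mapping.lookup c ?G else 0) =
          (if z = x then (-1) ^ card {y \<in> ?G. var_gt y x} * Poly_Mapping.lookup c ?G else 0)" by auto
      qed
      also have "\<dots> = (-1) ^ position ?G x * o' ?G" unfolding position_def using fin x(1) by (simp add: lookup)
      also have "\<dots> = ridge_form (n - 1) (?G - {x}) x"
        unfolding o'_def by (rule det_cell_matrix[OF fin card_facet[OF x(1)]]) simp
      also have "?G - {x} = ?\<tau>" using x(2) by blast
      finally show ?thesis .
    qed
    have "Poly_Mapping.lookup (simplicial_boundary var_gt c) ?\<tau> = (\<Sum>G\<in>half_facets m n. g G)"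
      unfolding g_def by (rule lookup_simplicial_boundary[OF up.finite_Fs keys])
    also have "\<dots> = (\<Sum>G\<in>{insert w ?\<tau>, insert u ?\<tau>}. g G)"
    proof (rule sum.mono_neutral_right[OF up.finite_Fs])
      show "{insert w ?\<tau>, insert u ?\<tau>} \<subseteq> half_facets m n" using wu(4,5) by simp
      show "\<forall>G\<in>half_facets m n - {insert w ?\<tau>, insert u ?\<tau>}. g G = 0"
      proof
        fix G assume G: "G \<in> half_facets m n - {insert w ?\<tau>, insert u ?\<tau>}"
        then have "G - {x} \<noteq> ?\<tau>" for x using wu(6)[of G] by blast
        then show "g G = 0" unfolding g_def by simp
      qed
    qed
    also have "\<dots> = ridge_form (n - 1) ?\<tau> w + ridge_form (n - 1) ?\<tau> u"
    proof -
      have "insert w ?\<tau> \<noteq> insert u ?\<tau>" using wu(1-3) by blast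
      then show ?thesis using g[OF wu(4,1)] g[OF wu(5,2)] by simp
    qed
    also have "\<dots> = 0"
      by (rule ridge_form_opposite[OF n facet[OF wu(4)] facet[OF wu(5)] wu(1,2) wu(3)[symmetric]])
    finally show ?thesis .
  qed
  have "\<rho> \<in> half_sphere m n \<and> \<not> \<sigma> \<subseteq> \<rho> \<and> finite \<rho> \<and> card \<rho> = n - 2"
    if \<rho>: "\<rho> \<in> Poly_Mapping.keys (simplicial_boundary var_gt c)" for \<rho>
  proof -
    have "(\<Sum>F\<in>half_facets m n. \<Sum>x\<in>F. if F - {x} = \<rho> then (-1) ^ card {y \<in> F. var_gt y x} * Poly_Mapping.lookup c F else 0) \<noteq> 0"
      using \<rho> lookup_simplicial_boundary[OF up.finite_Fs keys, of var_gt \<rho>] by (simp add: in_keys_iff)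
    then obtain F where F: "F \<in> half_facets m n" and
      "(\<Sum>x\<in>F. if F - {x} = \<rho> then (-1) ^ card {y \<in> F. var_gt y x} * Poly_Mapping.lookup c F else 0) \<noteq> 0"
      by (rule sum.not_neutral_contains_not_neutral)
    from this(2) obtain x where "x \<in> F" "F - {x} = \<rho>"
      by (rule sum.not_neutral_contains_not_neutral) (auto split: if_splits)
    note F = F this
    then have "\<not> \<sigma> \<subseteq> \<rho>" using boundary[OF F(1,2)] \<rho> by (auto simp: in_keys_iff)
    moreover have "\<rho> \<in> half_sphere m n" using F Fs down_closedD[OF \<Delta>(2), of F \<rho>] by blast
    ultimately show ?thesis using F facet_finite[OF F(1)] card_facet[OF F(1)] by auto
  qed
  then have "simplicial_boundary var_gt c \<in> simplicial_chains TYPE('k) (contrastar (half_sphere m n) \<sigma>) (n - 2)"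
    unfolding simplicial_chains_def contrastar_def by blast
  then have "c \<in> relcycles TYPE('k) \<sigma>" using chain unfolding simplicial_relcycles_def S by blast
  \<comment> \<open>Some facet contains \<sigma>, and its coefficient, a determinant of a lattice
    basis, is nonzero; so the cycle is not a chain of the contrastar.\<close>
  moreover obtain F where F: "F \<in> half_facets m n" "\<sigma> \<subseteq> F" using cover[OF \<sigma>] by blast
  have "Poly_Mapping.lookup c F \<noteq> 0"
    using F det_cell_matrix_nonzero[OF n facet[OF F(1)], where ?'k = 'k] unfolding lookup o'_def by simp
  then have "c \<notin> relboundaries TYPE('k) \<sigma>"
    using F(2) unfolding relboundaries_eq unfolding simplicial_chains_def contrastar_def
    by (auto simp: in_keys_iff)
  ultimately show ?thesis by blast
qed

lemma trivial_homology_iff: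
  assumes "\<sigma> \<in> half_sphere m n"
  shows "trivial_group (relative_simplicial_homology TYPE('k::field) var_gt (n - 2) (half_sphere m n)
    (contrastar (half_sphere m n) \<sigma>)) \<longleftrightarrow> \<not> interior_face m n \<sigma>"
  using trivial_relative_homologyI[OF trivial_if_not_interior, of \<sigma>]
    trivial_relative_homologyD nontrivial_if_interior[OF assms] by blast

end

section \<open>Minimal interior faces\<close>

theorem theorem3p8:
  fixes m n :: nat
  assumes "2 \<le> m" and "m < n"
  shows "(\<forall>\<sigma>\<in>G_set TYPE('k::field) m n. card \<sigma> = n - m)
    \<and> level_complex TYPE('k) (offdiag m n) (Delta TYPE('k) m n)"
proof
  have Delta: "Delta TYPE('k) m n = half_sphere m n"
    using Delta_eq[of m n, where ?'k = 'k] assms unfolding half_sphere_def by simp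
  show "level_complex TYPE('k) (offdiag m n) (Delta TYPE('k) m n)"
    unfolding Delta by (rule level_shelling.level[OF level_shelling_half_sphere[OF assms]])
  show "\<forall>\<sigma>\<in>G_set TYPE('k) m n. card \<sigma> = n - m"
  proof
    fix \<sigma> assume "\<sigma> \<in> G_set TYPE('k) m n"
    then have \<sigma>: "\<sigma> \<in> half_sphere m n" "interior_face m n \<sigma>"
      and min: "\<And>\<epsilon>. \<epsilon> \<subset> \<sigma> \<Longrightarrow> \<not> interior_face m n \<epsilon>"
    proof -
      assume G: "\<sigma> \<in> G_set TYPE('k) m n"
      show 1: "\<sigma> \<in> half_sphere m n" using G unfolding G_set_def Delta by blast
      show "interior_face m n \<sigma>"
        using G trivial_homology_iff[OF assms 1, where ?'k = 'k] unfolding G_set_def Delta by blast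
      fix \<epsilon> assume \<epsilon>: "\<epsilon> \<subset> \<sigma>"
      then have "\<epsilon> \<in> half_sphere m n" using 1 staircases_mono unfolding half_sphere_def by blast
      then show "\<not> interior_face m n \<epsilon>"
        using G \<epsilon> trivial_homology_iff[OF assms, of \<epsilon>, where ?'k = 'k] unfolding G_set_def Delta by blast
    qed
    \<comment> \<open>One cell of \<sigma> from each column beyond m already forms an interior face,
      so by minimality these are all cells of \<sigma>, and their columns distinguish them.\<close>
    have "\<forall>j\<in>{m + 1..n}. \<exists>v. v \<in> \<sigma> \<and> snd v = j" using \<sigma>(2) unfolding interior_face_def by blast
    then obtain f where f: "\<And>j. j \<in> {m + 1..n} \<Longrightarrow> f j \<in> \<sigma> \<and> snd (f j) = j" by metis
    have "interior_face m n (f ` {m + 1..n})"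
      unfolding interior_face_def using f by force
    moreover have "f ` {m + 1..n} \<subseteq> \<sigma>" using f by blast
    ultimately have "\<sigma> = f ` {m + 1..n}" using min by blast
    moreover have "inj_on f {m + 1..n}" using f by (metis inj_onI)
    ultimately show "card \<sigma> = n - m" by (simp add: card_image)
  qed
qed

end
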